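(* Let $n\ge2$, $p>n$, $\alpha\in(0,1)$ and $C_0>0$. There exist constants $\delta>0$ and $C>0$ depending only on $n,p,\alpha,C_0$ such that the following holds. Let $\rho_0$ be a mass density supported in $B_1\subset\mathbb{R}^n$ with $\int\rho_0=|B_1|$ and $C_0^{-1}\le\rho_0\le C_0$ on $B_1$. Let $\rho_1=\chi_E$, where $E\subset\mathbb{R}^n$ is measurable, $|E|=|B_1|$ and $B_{1/2}\subset E$. Let $T$ be the optimal transport map for the quadratic cost taking $\rho_0$ to $\rho_1$, let $\mathcal{E}=\mathcal{E}(\rho_0,\rho_1,T,1)$ and $\gamma=\|\rho_0\|_{p,1}+\|\rho_1\|_{p,1}$, and let $\rho(t,\cdot)$, $t\in[0,1]$, be the interpolation density between $\rho_0$ and $\rho_1$. If $\mathcal{E}+\gamma^2\le\delta$, then $$\int_0^1\int_{B_{1/2}}|\rho(t,x)-1|\,dx\,dt\le C\left(\mathcal{E}^{\frac{1}{n+2}}+\sqrt{\gamma}\right).$$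
   Context: $B_r$ is the open ball of radius $r$ centered at the origin of $\mathbb{R}^n$; $|A|$ is Lebesgue measure; $\chi_E$ is the characteristic function of $E$. For a density $\rho$ and $r>0$, $\|\rho\|_{p,r}:=\left(\frac{1}{|B_r|}\int_{B_r}|\rho-1|^p\,dx\right)^{1/p}$. The excess energy is $\mathcal{E}(\rho_0,\rho_1,T,R):=\frac{1}{R^2}\frac{1}{|B_R|}\int_{B_R}|T(x)-x|^2\rho_0(x)\,dx$. By Brenier's theorem $T=\nabla u$ for a convex function $u$. For $t\in[0,1]$ set $T_t(x):=tT(x)+(1-t)x$; the interpolation density is the push-forward $\rho(t,\cdot):=(T_t)_{\#}\rho_0$. *)

theory Defs
  imports "HOL-Analysis.Analysis"
begin

text \<open>
  Densities are Lebesgue measurable functions with values in \<open>real\<close>, considered up to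
  null sets. Transport maps are Lebesgue-to-Borel measurable; Lebesgue-to-Lebesgue would be too
  strong, since the values of a map outside the support of the source density are arbitrary.
\<close>

definition mass_density :: "('a::euclidean_space \<Rightarrow> real) \<Rightarrow> bool" where
  "mass_density \<rho> \<longleftrightarrow> \<rho> \<in> borel_measurable lebesgue \<and> (AE x in lebesgue. 0 \<le> \<rho> x)"

definition density_measure :: "('a::euclidean_space \<Rightarrow> real) \<Rightarrow> 'a measure" where
  "density_measure \<rho> = density lebesgue (\<lambda>x. ennreal (\<rho> x))"

definition push_forward ::
    "('a::euclidean_space \<Rightarrow> 'a) \<Rightarrow> ('a \<Rightarrow> real) \<Rightarrow> 'a measure" where
  "push_forward S \<rho> = distr (density_measure \<rho>) borel S"

text \<open>
  The condition \<open>S\<^sub># \<rho>0 = \<rho>1\<close>. It is tested on Borel sets only, as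
  \<^const>\<open>density_measure\<close> lives on the larger Lebesgue sigma-algebra.
\<close>

definition transport_map ::
    "('a::euclidean_space \<Rightarrow> real) \<Rightarrow> ('a \<Rightarrow> real) \<Rightarrow> ('a \<Rightarrow> 'a) \<Rightarrow> bool" where
  "transport_map \<rho>0 \<rho>1 S \<longleftrightarrow>
     S \<in> borel_measurable lebesgue \<and>
     (\<forall>A\<in>sets borel. emeasure (push_forward S \<rho>0) A = emeasure (density_measure \<rho>1) A)"

definition transport_cost ::
    "('a::euclidean_space \<Rightarrow> real) \<Rightarrow> ('a \<Rightarrow> 'a) \<Rightarrow> ennreal" where
  "transport_cost \<rho>0 S = (\<integral>\<^sup>+x. ennreal ((norm (S x - x))\<^sup>2) \<partial>density_measure \<rho>0)"

text \<open>
  If every transport map has infinite cost (the target density need not have a finite second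
  moment), then every transport map is optimal in this sense; a bound on the excess energy
  rules this case out when \<open>\<rho>0\<close> is supported in the ball in question.
\<close>

definition optimal_transport_map ::
    "('a::euclidean_space \<Rightarrow> real) \<Rightarrow> ('a \<Rightarrow> real) \<Rightarrow> ('a \<Rightarrow> 'a) \<Rightarrow> bool" where
  "optimal_transport_map \<rho>0 \<rho>1 T \<longleftrightarrow>
     transport_map \<rho>0 \<rho>1 T \<and>
     (\<forall>S. transport_map \<rho>0 \<rho>1 S \<longrightarrow> transport_cost \<rho>0 T \<le> transport_cost \<rho>0 S)"

text \<open>The excess energy takes values in \<open>[0, \<infinity>]\<close>; it does not depend on the target density.\<close>

definition excess_energy ::
    "('a::euclidean_space \<Rightarrow> real) \<Rightarrow> ('a \<Rightarrow> 'a) \<Rightarrow> real \<Rightarrow> ennreal" where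
  "excess_energy \<rho>0 T R =
     (\<integral>\<^sup>+x\<in>ball 0 R. ennreal ((norm (T x - x))\<^sup>2 * \<rho>0 x) \<partial>lebesgue) /
     ennreal (R\<^sup>2 * measure lebesgue (ball (0::'a) R))"

definition density_deviation ::
    "real \<Rightarrow> real \<Rightarrow> ('a::euclidean_space \<Rightarrow> real) \<Rightarrow> real" where
  "density_deviation p r \<rho> =
     (1 / measure lebesgue (ball (0::'a) r) *
        (LINT x:ball 0 r|lebesgue. \<bar>\<rho> x - 1\<bar> powr p)) powr (1 / p)"

definition interpolation_map ::
    "('a::euclidean_space \<Rightarrow> 'a) \<Rightarrow> real \<Rightarrow> 'a \<Rightarrow> 'a" where
  "interpolation_map T t x = t *\<^sub>R T x + (1 - t) *\<^sub>R x"

text \<open>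
  The push-forward \<open>(T\<^sub>t)\<^sub># \<rho>0\<close> as a function, i.e. its Lebesgue density. For optimal
  \<open>T\<close> of finite cost the push-forward is absolutely continuous for every \<open>t\<close> in \<open>[0, 1]\<close>, so
  the default value of \<^const>\<open>RN_deriv\<close> does not occur. The density is determined up to a null
  set for each \<open>t\<close>.
\<close>

definition interpolation_density ::
    "('a::euclidean_space \<Rightarrow> real) \<Rightarrow> ('a \<Rightarrow> 'a) \<Rightarrow> real \<Rightarrow> 'a \<Rightarrow> real" where
  "interpolation_density \<rho>0 T t x =
     enn2real (RN_deriv lborel (push_forward (interpolation_map T t) \<rho>0) x)"

end

theory Submission
  imports Defs "HOL-Probability.Weak_Convergence"
begin

text \<open>
  The estimate holds for every \<open>t\<close> in \<open>(0, 1)\<close>. Split \<open>\<rho>0\<close> into \<open>min \<rho>0 1\<close> and an excess of mass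
  at most of order \<open>\<gamma>\<close>. If the push-forward under \<open>T\<^sub>t\<close> of the first part has density at most 1,
  then the positive part of \<open>\<rho>(t) - 1\<close> is controlled by \<open>\<gamma>\<close>. Since \<open>T\<^sub>t\<close> moves little mass by more
  than \<open>h\<close> (Chebyshev), the mass of \<open>\<rho>(t)\<close> in the ball of radius 1/2 is at least that of \<open>\<rho>0\<close> in the
  ball of radius \<open>1/2 - h\<close>, which controls the negative part; the choice \<open>h = \<E>\<^sup>1\<^sup>/\<^sup>(\<^sup>n\<^sup>+\<^sup>2\<^sup>)\<close> gives the claim.

  The density bound is McCann's, but without Brenier's and Alexandrov's theorems: \<open>T\<close> is
  cyclically monotone on a set of full measure, so the inverse of \<open>T\<^sub>t\<close> extends to an everywhere
  defined map \<open>S = P/(1-t)\<close> with \<open>P\<close> and \<open>id - P = t (T \<circ> S)\<close> firmly nonexpansive gradients. By the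
  inequality of arithmetic and geometric means, \<open>det DP \<le> (div P/n)\<^sup>n\<close> and similarly for \<open>id - P\<close>. As
  \<open>div P + div (id - P) = n\<close>, at every point \<open>S\<close> or \<open>T \<circ> S\<close> does not increase volume, and either
  property bounds the density. Almost everywhere differentiability of \<open>P\<close> is replaced by smooth
  approximations whose divergences converge strongly.
\<close>

section \<open>Determinants and volumes of images\<close>

text \<open>Why one of the two maps suffices: mass that \<open>T_t\<close> sends into a set
  \<open>K\<close> starts in \<open>S(K)\<close> and ends in \<open>T(S(K))\<close>. A source
  density at most 1 bounds it by the volume of \<open>S(K)\<close>, a target density at most 1 by
  the volume of \<open>T(S(K))\<close>. The value 1 has to be met exactly, hence the cut at
  \<open>min \<rho>0 1\<close>; the target is an indicator and satisfies its bound already.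

  The delicate point is the limit of the smooth approximations. The volume bound is the n-th power
  of the divergence, and weak convergence does not pass such an upper bound on to the limit; the
  split of space into two sets also asks for one limit that serves \<open>P\<close> and
  \<open>id - P\<close> together. Moreover the images under the approximations may fail to cover the
  image under \<open>P\<close>. A small multiple of the identity is added to them, and the values of
  \<open>P\<close> with several preimages are discarded as a null set.

  The mass moved by more than \<open>h\<close> is of order \<open>\<E> / h^2\<close>, the volume
  lost by shrinking the ball of order \<open>h\<close>. With \<open>h^(n+2) = \<E>\<close> the
  former is \<open>h^n\<close>, which is at most \<open>h\<close> for \<open>h < 1\<close>.\<close>

text \<open>With \<open>A$k$k = 0\<close> the quadratic form at \<open>s e_k + e_j\<close> is affine
  in \<open>s\<close> with slope \<open>2 A$k$j\<close>, and an affine function bounded below is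
  constant.\<close>

lemma psd_zero_diagonal_imp_zero_row:
  fixes A :: "real^'n^'n"
  assumes sym: "transpose A = A" and psd: "\<And>x. 0 \<le> x \<bullet> (A *v x)" and zero: "A$k$k = 0"
  shows "A$k$j = 0"
proof -
  have Akj: "A$j$k = A$k$j"
    using arg_cong[OF sym, of "\<lambda>B. B$j$k"] by (simp add: transpose_def)
  have "0 \<le> 2 * s * A$k$j + A$j$j" for s :: real
  proof -
    have "(s *\<^sub>R axis k 1 + axis j 1) \<bullet> (A *v (s *\<^sub>R axis k 1 + axis j 1)) =
      s * s * A$k$k + s * A$k$j + s * A$j$k + A$j$j"
      by (simp add: matrix_vector_right_distrib matrix_vector_mult_scaleR inner_add_left inner_add_right
          matrix_vector_mult_basis column_def inner_axis' algebra_simps)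
    with psd[of "s *\<^sub>R axis k 1 + axis j 1"] zero Akj show ?thesis by simp
  qed
  \<comment> \<open>At this \<open>s\<close> the affine function would have the value -1.\<close>
  from this[of "- (A$j$j + 1) / (2 * A$k$j)"] show ?thesis
    by (cases "A$k$j = 0") (auto simp: field_simps)
qed

text \<open>The matrix is \<open>I - c e_k^T\<close>. Its transpose arises from the identity by
  adding to row \<open>k\<close> a combination of the other rows, since \<open>c\<close> has no
  component in direction \<open>k\<close>.\<close>

lemma det_rank_one_update:
  fixes c :: "real^'n"
  assumes "c$k = 0"
  shows "det (\<chi> i j. (if i = j then 1 else 0) - c$i * (if j = k then 1 else 0)) = 1"
proof -
  define Q :: "real^'n^'n" where "Q = (\<chi> i j. (if i = j then 1 else 0) - c$i * (if j = k then 1 else 0))"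
  have row1: "row j (mat 1 :: real^'n^'n) = axis j 1" for j
    by (simp add: row_def mat_def axis_def vec_eq_iff)
  have c: "- c = (\<Sum>j\<in>UNIV - {k}. (- c$j) *s axis j 1)"
    using assms by (auto simp: vec_eq_iff axis_def if_distrib sum.delta' cong: if_cong)
  have span: "- c \<in> vec.span {row j (mat 1 :: real^'n^'n) |j. j \<noteq> k}"
    unfolding c by (intro vec.span_sum vec.span_scale vec.span_base) (auto simp: row1)
  have "transpose Q = (\<chi> i. if i = k then row k (mat 1) + (- c) else row i (mat 1))"
    by (auto simp: vec_eq_iff Q_def transpose_def row1 axis_def)
  then have "det (transpose Q) = det (mat 1 :: real^'n^'n)"
    using det_row_span[OF span] by simp
  then show ?thesis by (simp add: Q_def det_transpose)
qed

lemma sum_elementary_row: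
  fixes f :: "'n::finite \<Rightarrow> real"
  shows "(\<Sum>l\<in>UNIV. ((if i = l then 1 else 0) - a * (if l = k then 1 else 0)) * f l) = f i - a * f k"
proof -
  have "(\<Sum>l\<in>UNIV. ((if i = l then 1 else 0) - a * (if l = k then 1 else 0)) * f l) =
    (\<Sum>l\<in>UNIV. (if l = i then f l else 0) - a * (if l = k then f l else 0))"
    by (intro sum.cong) (auto simp: algebra_simps)
  also have "\<dots> = f i - a * f k"
    by (simp add: sum_subtractf flip: sum_distrib_left)
  finally show ?thesis .
qed

text \<open>One step of symmetric Gaussian elimination, the congruence \<open>Q A Q^T\<close> with
  \<open>Q\<close> of determinant 1. A diagonal entry loses \<open>A$i$k^2 / A$k$k\<close>, hence
  only decreases. The last conjunct records that rows cleared earlier stay cleared, which makes the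
  step iterable. If the pivot vanishes, its row is zero already.\<close>

lemma psd_eliminate:
  fixes A :: "real^'n^'n"
  assumes sym: "transpose A = A" and psd: "\<And>x. 0 \<le> x \<bullet> (A *v x)"
  shows "\<exists>C. transpose C = C \<and> (\<forall>x. 0 \<le> x \<bullet> (C *v x)) \<and> det C = det A \<and>
    (\<forall>i. C$i$i \<le> A$i$i) \<and> (\<forall>j. j \<noteq> k \<longrightarrow> C$k$j = 0) \<and>
    (\<forall>i. (\<forall>j. j \<noteq> i \<longrightarrow> A$i$j = 0) \<longrightarrow> (\<forall>j. j \<noteq> i \<longrightarrow> C$i$j = 0))"
proof (cases "A$k$k = 0")
  case True
  then show ?thesis
    using psd_zero_diagonal_imp_zero_row[OF sym psd True] sym psd by (intro exI[of _ A]) auto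
next
  case False
  have symA: "A$i$j = A$j$i" for i j
    using arg_cong[OF sym, of "\<lambda>B. B$i$j"] by (simp add: transpose_def)
  define c :: "real^'n" where "c = (\<chi> i. if i = k then 0 else A$i$k / A$k$k)"
  define Q :: "real^'n^'n" where "Q = (\<chi> i j. (if i = j then 1 else 0) - c$i * (if j = k then 1 else 0))"
  define C where "C = Q ** A ** transpose Q"
  have QA: "(Q ** A)$i$j = A$i$j - c$i * A$k$j" for i j
    unfolding Q_def matrix_matrix_mult_def by (simp only: vec_lambda_beta sum_elementary_row)
  have C: "C$i$j = A$i$j - c$i * A$k$j - c$j * (A$i$k - c$i * A$k$k)" for i j
  proof -
    have "C$i$j = (\<Sum>l\<in>UNIV. ((if j = l then 1 else 0) - c$j * (if l = k then 1 else 0)) * (Q ** A)$i$l)"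
      unfolding C_def matrix_matrix_mult_def[of "Q ** A"] by (simp add: transpose_def Q_def mult.commute)
    then show ?thesis unfolding sum_elementary_row by (simp add: QA)
  qed
  have pos: "A$k$k \<ge> 0"
    using psd[of "axis k 1"] by (simp add: matrix_vector_mult_basis column_def inner_axis' )
  have "det Q = 1"
    unfolding Q_def by (rule det_rank_one_update) (simp add: c_def)
  then have "det C = det A"
    by (simp add: C_def det_mul det_transpose)
  moreover have "transpose C = C"
  proof -
    have "C$j$i = C$i$j" for i j
      unfolding C symA[of j i] symA[of j k] symA[of i k] by algebra
    then show ?thesis by (simp add: transpose_def vec_eq_iff)
  qed
  moreover have "0 \<le> x \<bullet> (C *v x)" for x
  proof -
    have "x \<bullet> (C *v x) = x \<bullet> (Q *v (A *v (transpose Q *v x)))"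
      by (simp only: C_def matrix_vector_mul_assoc matrix_mul_assoc)
    also have "\<dots> = (transpose Q *v x) \<bullet> (A *v (transpose Q *v x))"
      by (metis dot_lmul_matrix transpose_matrix_vector)
    finally show ?thesis using psd by simp
  qed
  moreover have "C$i$i \<le> A$i$i" for i
  proof (cases "i = k")
    case False
    have "C$i$i = A$i$i - A$i$k * A$i$k / A$k$k"
      using False \<open>A$k$k \<noteq> 0\<close> by (simp add: C c_def symA[of k i])
    then show ?thesis using pos by simp
  qed (simp add: C c_def)
  moreover have "C$k$j = 0" if "j \<noteq> k" for j
    using that False symA[of j k] by (simp add: C c_def)
  moreover have "C$i$j = 0" if "\<forall>j. j \<noteq> i \<longrightarrow> A$i$j = 0" "j \<noteq> i" for i j
    using that False symA[of j k] by (cases "i = k"; cases "j = k") (auto simp: C c_def)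
  ultimately show ?thesis by blast
qed

lemma psd_diagonalize:
  fixes A :: "real^'n^'n"
  assumes sym: "transpose A = A" and psd: "\<And>x. 0 \<le> x \<bullet> (A *v x)" and "finite I"
  shows "\<exists>C. transpose C = C \<and> (\<forall>x. 0 \<le> x \<bullet> (C *v x)) \<and> det C = det A \<and>
    (\<forall>i. C$i$i \<le> A$i$i) \<and> (\<forall>i\<in>I. \<forall>j. j \<noteq> i \<longrightarrow> C$i$j = 0)"
  using \<open>finite I\<close>
proof induction
  case empty
  then show ?case using sym psd by (intro exI[of _ A]) auto
next
  case (insert k I)
  from insert.IH obtain B where B: "transpose B = B" "\<forall>x. 0 \<le> x \<bullet> (B *v x)" "det B = det A"
    "\<forall>i. B$i$i \<le> A$i$i" "\<forall>i\<in>I. \<forall>j. j \<noteq> i \<longrightarrow> B$i$j = 0"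
    by (elim exE conjE)
  from psd_eliminate[OF B(1) B(2)[rule_format], of k]
  obtain C where C: "transpose C = C" "\<forall>x. 0 \<le> x \<bullet> (C *v x)" "det C = det B"
    "\<forall>i. C$i$i \<le> B$i$i" "\<forall>j. j \<noteq> k \<longrightarrow> C$k$j = 0"
    "\<forall>i. (\<forall>j. j \<noteq> i \<longrightarrow> B$i$j = 0) \<longrightarrow> (\<forall>j. j \<noteq> i \<longrightarrow> C$i$j = 0)"
    by (elim exE conjE)
  show ?case
  proof (intro exI[of _ C] conjI)
    show "\<forall>i. C$i$i \<le> A$i$i" using C(4) B(4) order_trans by blast
    show "\<forall>i\<in>insert k I. \<forall>j. j \<noteq> i \<longrightarrow> C$i$j = 0" using C(5,6) B(5) by blast
    show "det C = det A" using C(3) B(3) by (rule trans)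
  qed (rule C)+
qed

text \<open>Elimination keeps the determinant and lowers the diagonal, so the inequality of
  arithmetic and geometric means for the diagonal result gives a bound by the trace of the original
  matrix.\<close>

lemma psd_det_le_trace:
  fixes A :: "real^'n^'n"
  assumes sym: "transpose A = A" and psd: "\<And>x. 0 \<le> x \<bullet> (A *v x)"
  shows "0 \<le> det A" "det A \<le> (trace A / CARD('n)) ^ CARD('n)"
proof -
  obtain C where C: "\<forall>x. 0 \<le> x \<bullet> (C *v x)" "det C = det A"
    "\<And>i. C$i$i \<le> A$i$i" "\<And>i j. j \<noteq> i \<Longrightarrow> C$i$j = 0"
    using psd_diagonalize[OF sym psd finite[of UNIV]] by auto
  have nonneg: "0 \<le> C$i$i" for i
    using C(1)[rule_format, of "axis i 1"] by (simp add: matrix_vector_mult_basis column_def inner_axis')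
  have det: "det A = (\<Prod>i\<in>UNIV. C$i$i)"
    using det_diagonal[of C] C(2,4) by metis
  show "0 \<le> det A" unfolding det by (intro prod_nonneg) (auto simp: nonneg)
  have "det A powr (1 / CARD('n)) \<le> (\<Sum>i\<in>UNIV. C$i$i / CARD('n))"
    unfolding det by (rule arith_geom_mean) (auto simp: nonneg)
  also have "\<dots> \<le> trace A / CARD('n)"
    unfolding trace_def sum_divide_distrib by (intro sum_mono divide_right_mono C(3)) auto
  finally have le: "det A powr (1 / CARD('n)) \<le> trace A / CARD('n)" .
  have "det A = (det A powr (1 / CARD('n))) ^ CARD('n)"
    using root_powr_inverse[of "CARD('n)" "det A"] real_root_pow_pos2[of "CARD('n)" "det A"] \<open>0 \<le> det A\<close>
    by (cases "det A = 0") (auto simp: zero_less_card_finite)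
  also have "\<dots> \<le> (trace A / CARD('n)) ^ CARD('n)"
    using le by (intro power_mono) auto
  finally show "det A \<le> (trace A / CARD('n)) ^ CARD('n)" .
qed

text \<open>The change of variables theorems of the library need a wellordered index type.\<close>

typedef ('a::finite) index_copy = "{..<CARD('a)}"
  by (intro exI[of _ 0]) auto

instantiation index_copy :: (finite) linorder
begin
definition "less_eq_index_copy (x :: 'a index_copy) (y :: 'a index_copy) \<longleftrightarrow> Rep_index_copy x \<le> Rep_index_copy y"
definition "less_index_copy (x :: 'a index_copy) (y :: 'a index_copy) \<longleftrightarrow> Rep_index_copy x < Rep_index_copy y"
instance
  by standard (auto simp: less_eq_index_copy_def less_index_copy_def Rep_index_copy_inject)
end

instance index_copy :: (finite) wellorder
proof
  fix P :: "'a index_copy \<Rightarrow> bool" and a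
  assume "\<And>x. (\<And>y. y < x \<Longrightarrow> P y) \<Longrightarrow> P x"
  then show "P a"
    by (induction "Rep_index_copy a" arbitrary: a rule: less_induct) (metis less_index_copy_def)
qed

instance index_copy :: (finite) finite
proof
  have "finite (Abs_index_copy ` {..<CARD('a)} :: 'a index_copy set)" by simp
  then show "finite (UNIV :: 'a index_copy set)"
    by (metis type_definition.Abs_image type_definition_index_copy)
qed

lemma card_index_copy: "CARD('a::finite index_copy) = CARD('a)"
  using type_definition.card[OF type_definition_index_copy] by simp

section \<open>Divergence and the growth of volumes under maps with symmetric positive
  derivative\<close>

definition divergence :: "('a::euclidean_space \<Rightarrow> 'a) \<Rightarrow> 'a \<Rightarrow> real" where
  "divergence f x = (\<Sum>b\<in>Basis. frechet_derivative f (at x) b \<bullet> b)"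

text \<open>Difference quotients along the fixed sequence of steps \<open>1 / (k + 1)\<close> carry
  closed conditions on a map over to its derivative. They also make the divergence a limit of Borel
  functions, although the derivative is not assumed to be continuous.\<close>

lemma frechet_derivative_LIMSEQ:
  fixes f :: "'a::real_normed_vector \<Rightarrow> 'b::real_normed_vector"
  assumes "f differentiable (at x)"
  shows "(\<lambda>k. real (Suc k) *\<^sub>R (f (x + (1 / real (Suc k)) *\<^sub>R v) - f x))
    \<longlonglongrightarrow> frechet_derivative f (at x) v"
proof (cases "v = 0")
  case True
  then show ?thesis
    using linear_frechet_derivative[OF assms] by (simp add: linear_0)
next
  case False
  let ?D = "frechet_derivative f (at x)" and ?h = "\<lambda>k. (1 / real (Suc k)) *\<^sub>R v"
  have "(f has_derivative ?D) (at x)"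
    using assms frechet_derivative_works by blast
  then have lin: "bounded_linear ?D" and
    lim: "((\<lambda>h. norm (f (x + h) - f x - ?D h) / norm h) \<longlongrightarrow> 0) (at 0)"
    by (auto simp: has_derivative_at)
  have "filterlim ?h (at 0) sequentially"
    unfolding filterlim_at
  proof
    show "?h \<longlonglongrightarrow> 0"
      using tendsto_scaleR[OF LIMSEQ_inverse_real_of_nat tendsto_const, of v]
      by (simp add: inverse_eq_divide del: of_nat_Suc)
  qed (use False in auto)
  from filterlim_compose[OF lim this]
  have "(\<lambda>k. norm v * (norm (f (x + ?h k) - f x - ?D (?h k)) / norm (?h k))) \<longlonglongrightarrow> norm v * 0"
    by (intro tendsto_intros) (simp add: o_def)
  moreover have "norm v * (norm (f (x + ?h k) - f x - ?D (?h k)) / norm (?h k)) =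
    norm (real (Suc k) *\<^sub>R (f (x + ?h k) - f x) - ?D v)" for k
  proof -
    have "real (Suc k) *\<^sub>R (f (x + ?h k) - f x) - ?D v =
      real (Suc k) *\<^sub>R (f (x + ?h k) - f x - ?D (?h k))"
      using linear_scale[OF bounded_linear.linear[OF lin], of "1 / real (Suc k)" v]
      by (simp add: scaleR_diff_right del: of_nat_Suc)
    then show ?thesis using False by (simp del: of_nat_Suc)
  qed
  ultimately show ?thesis
    by (subst LIM_zero_iff[symmetric], subst tendsto_norm_zero_iff[symmetric]) (simp del: of_nat_Suc)
qed

lemma divergence_LIMSEQ:
  fixes f :: "'a::euclidean_space \<Rightarrow> 'a"
  assumes "f differentiable (at x)"
  shows "(\<lambda>k. \<Sum>b\<in>Basis. (real (Suc k) *\<^sub>R (f (x + (1 / real (Suc k)) *\<^sub>R b) - f x)) \<bullet> b)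
    \<longlonglongrightarrow> divergence f x"
  unfolding divergence_def
  by (intro tendsto_intros frechet_derivative_LIMSEQ assms)

lemma borel_measurable_divergence:
  fixes f :: "'a::euclidean_space \<Rightarrow> 'a"
  assumes diff: "\<And>x. f differentiable (at x)"
  shows "divergence f \<in> borel_measurable borel"
proof (rule borel_measurable_LIMSEQ_real[OF divergence_LIMSEQ[OF diff]])
  have "continuous_on UNIV f"
    using diff differentiable_imp_continuous_within continuous_at_imp_continuous_on by blast
  then have [measurable]: "f \<in> borel_measurable borel"
    by (rule borel_measurable_continuous_onI)
  show "(\<lambda>x. \<Sum>b\<in>Basis. (real (Suc k) *\<^sub>R (f (x + (1 / real (Suc k)) *\<^sub>R b) - f x)) \<bullet> b)
    \<in> borel_measurable borel" for k
    by measurable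
qed

lemma divergence_eq_trace:
  fixes f :: "real^'n \<Rightarrow> real^'n"
  shows "divergence f x = trace (matrix (frechet_derivative f (at x)))"
proof -
  have "(\<Sum>b\<in>Basis. frechet_derivative f (at x) b \<bullet> b) =
    (\<Sum>i\<in>UNIV. frechet_derivative f (at x) (axis i 1) \<bullet> axis i 1)"
    by (rule sum.reindex_bij_betw[symmetric])
      (auto simp: bij_betw_def Basis_vec_def inj_on_def axis_eq_axis)
  then show ?thesis
    by (simp add: divergence_def trace_def matrix_def inner_axis)
qed

lemma emeasure_image_le_divergence_wellorder:
  fixes f :: "real^'n::{finite,wellorder} \<Rightarrow> real^'n::_"
  assumes K: "compact K" and diff: "\<And>x. f differentiable (at x)"
    and sym: "\<And>x u v. frechet_derivative f (at x) u \<bullet> v = u \<bullet> frechet_derivative f (at x) v"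
    and psd: "\<And>x u. 0 \<le> u \<bullet> frechet_derivative f (at x) u"
    and bound: "\<And>x. divergence f x \<le> L"
  shows "emeasure lborel (f ` K) \<le> (\<integral>\<^sup>+x\<in>K. ennreal ((divergence f x / CARD('n)) ^ CARD('n)) \<partial>lborel)"
proof -
  let ?D = "\<lambda>x. matrix (frechet_derivative f (at x))"
  have der: "(f has_derivative frechet_derivative f (at x)) (at x within S)" for x S
    using diff[of x] frechet_derivative_works has_derivative_at_withinI by blast
  have D: "?D x *v u = frechet_derivative f (at x) u" for x u
    by (rule matrix_works) (use linear_frechet_derivative[OF diff] in \<open>simp add: linear_matrix_vector_mul_eq\<close>)
  have "transpose (?D x) = ?D x" for x
  proof -
    have "?D x $ j $ i = ?D x $ i $ j" for i j
      using sym[of x "axis i 1" "axis j 1"] by (simp add: matrix_def inner_axis inner_axis')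
    then show ?thesis by (simp add: transpose_def vec_eq_iff)
  qed
  note det = psd_det_le_trace[OF this, folded divergence_eq_trace, unfolded D, OF psd]
  have Kl: "K \<in> lmeasurable" using K by (rule lmeasurable_compact)
  have div0: "0 \<le> divergence f x" for x
    unfolding divergence_def by (intro sum_nonneg) (simp add: psd inner_commute)
  have "(\<lambda>x. det (?D x)) \<in> borel_measurable (lebesgue_on K)"
    using Kl by (intro borel_measurable_det_Jacobian[where f = f] der) auto
  \<comment> \<open>The derivative may be discontinuous, so compactness of \<open>K\<close> alone
    does not bound the determinant; the bound \<open>L\<close> on the divergence does.\<close>
  then have int: "integrable (lebesgue_on K) (\<lambda>x. \<bar>det (?D x)\<bar>)"
  proof (intro finite_measure.integrable_const_bound AE_I2)
    show "finite_measure (lebesgue_on K)"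
      using Kl by (intro finite_measure_lebesgue_on)
    fix x
    have "det (?D x) \<le> (divergence f x / CARD('n)) ^ CARD('n)" by (rule det(2))
    also have "\<dots> \<le> (L / CARD('n)) ^ CARD('n)"
      using div0 bound by (intro power_mono divide_right_mono) auto
    finally show "norm \<bar>det (?D x)\<bar> \<le> (L / CARD('n)) ^ CARD('n)"
      using det(1)[of x] by simp
  qed auto
  have meas: "f ` K \<in> lmeasurable" "measure lebesgue (f ` K) \<le> integral K (\<lambda>x. \<bar>det (?D x)\<bar>)"
    using measurable_differentiable_image[OF fmeasurableD[OF Kl] der]
      measure_differentiable_image[OF fmeasurableD[OF Kl] der]
      integrable_on_lebesgue_on[OF int fmeasurableD[OF Kl]] by blast+
  have comp: "compact (f ` K)"
    using K by (intro compact_continuous_image has_derivative_continuous_on[OF der])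
  have "emeasure lborel (f ` K) = ennreal (measure lebesgue (f ` K))"
    using emeasure_completion[of "f ` K" lborel] emeasure_eq_measure2[OF meas(1)] borel_compact[OF comp] by simp
  also have "\<dots> \<le> ennreal (LINT x|lebesgue_on K. \<bar>det (?D x)\<bar>)"
    using meas(2) by (intro ennreal_leI) (simp add: lebesgue_integral_eq_integral[OF int fmeasurableD[OF Kl]])
  also have "\<dots> = (\<integral>\<^sup>+x. ennreal \<bar>det (?D x)\<bar> \<partial>lebesgue_on K)"
    using int by (subst nn_integral_eq_integral) auto
  also have "\<dots> \<le> (\<integral>\<^sup>+x. ennreal ((divergence f x / CARD('n)) ^ CARD('n)) \<partial>lebesgue_on K)"
    using det by (intro nn_integral_mono ennreal_leI) auto
  also have "\<dots> = (\<integral>\<^sup>+x\<in>K. ennreal ((divergence f x / CARD('n)) ^ CARD('n)) \<partial>lebesgue)"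
    using Kl by (subst nn_integral_restrict_space) auto
  also have "\<dots> = (\<integral>\<^sup>+x\<in>K. ennreal ((divergence f x / CARD('n)) ^ CARD('n)) \<partial>lborel)"
    by (rule nn_integral_completion)
  finally show ?thesis .
qed

lemma divergence_cart:
  fixes f :: "real^'n \<Rightarrow> real^'n"
  shows "divergence f x = (\<Sum>i\<in>UNIV. frechet_derivative f (at x) (axis i 1) $ i)"
  by (simp add: divergence_eq_trace trace_def matrix_def)

lemma prod_Basis_cart: "(\<Prod>b\<in>Basis. h b) = (\<Prod>i\<in>UNIV. h (axis i (1::real)))"
  by (rule prod.reindex_bij_betw[symmetric])
    (auto simp: bij_betw_def Basis_vec_def inj_on_def axis_eq_axis)

text \<open>Relabelling the coordinates by a bijection of index types is an isometry:
  \<open>\<Psi>\<close> is the adjoint and the inverse of \<open>\<Phi>\<close>. It maps boxes to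
  boxes with the same side lengths, so it preserves volume, and it conjugates derivatives without
  changing symmetry, positivity or trace.\<close>

lemma emeasure_image_le_divergence:
  fixes f :: "real^'n::finite \<Rightarrow> real^'n"
  assumes K: "compact K" and diff: "\<And>x. f differentiable (at x)"
    and sym: "\<And>x u v. frechet_derivative f (at x) u \<bullet> v = u \<bullet> frechet_derivative f (at x) v"
    and psd: "\<And>x u. 0 \<le> u \<bullet> frechet_derivative f (at x) u"
    and bound: "\<And>x. divergence f x \<le> L"
  shows "emeasure lborel (f ` K) \<le> (\<integral>\<^sup>+x\<in>K. ennreal ((divergence f x / CARD('n)) ^ CARD('n)) \<partial>lborel)"
proof -
  obtain \<sigma> :: "'n index_copy \<Rightarrow> 'n" where \<sigma>: "bij \<sigma>"
    using finite_same_card_bij[of "UNIV :: 'n index_copy set" "UNIV :: 'n set"] card_index_copy by auto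
  have \<sigma>_inv [simp]: "\<sigma> (inv \<sigma> j) = j" "inv \<sigma> (\<sigma> i) = i" for i j
    using \<sigma> by (auto simp: bij_is_surj surj_f_inv_f bij_is_inj)
  define \<Phi> :: "real^'n \<Rightarrow> real^'n index_copy" where "\<Phi> x = (\<chi> i. x$\<sigma> i)" for x
  define \<Psi> :: "real^'n index_copy \<Rightarrow> real^'n" where "\<Psi> y = (\<chi> j. y$inv \<sigma> j)" for y
  have inverse [simp]: "\<Psi> (\<Phi> x) = x" "\<Phi> (\<Psi> y) = y" for x y
    by (simp_all add: \<Phi>_def \<Psi>_def vec_eq_iff)
  have inner: "\<Phi> x \<bullet> y = x \<bullet> \<Psi> y" for x y
    using sum.reindex_bij_betw[OF \<sigma>, of "\<lambda>j. x$j * y$inv \<sigma> j"] by (simp add: inner_vec_def \<Phi>_def \<Psi>_def)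
  have lin: "bounded_linear \<Phi>" "bounded_linear \<Psi>"
    unfolding linear_conv_bounded_linear[symmetric]
    by (auto intro!: linearI simp: \<Phi>_def \<Psi>_def vec_eq_iff)
  define g where "g y = \<Phi> (f (\<Psi> y))" for y
  have der: "(g has_derivative (\<lambda>u. \<Phi> (frechet_derivative f (at (\<Psi> y)) (\<Psi> u)))) (at y)" for y
    unfolding g_def
    by (rule bounded_linear.has_derivative[OF lin(1)], rule has_derivative_compose[OF bounded_linear.has_derivative[OF lin(2)]])
      (use diff frechet_derivative_works in auto)
  have fd: "frechet_derivative g (at y) = (\<lambda>u. \<Phi> (frechet_derivative f (at (\<Psi> y)) (\<Psi> u)))" for y
    using frechet_derivative_at[OF der] by simp
  have \<Psi>_axis: "\<Psi> (axis i 1) = axis (\<sigma> i) 1" for i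
    by (auto simp: \<Psi>_def axis_def vec_eq_iff)
  have div: "divergence g y = divergence f (\<Psi> y)" for y
    unfolding divergence_cart fd \<Psi>_axis
    by (subst sum.reindex_bij_betw[OF \<sigma>, symmetric]) (simp add: \<Phi>_def)
  have [measurable]: "\<Psi> \<in> borel_measurable borel"
    using lin(2) by (intro borel_measurable_continuous_onI linear_continuous_on)
  have distr: "lborel = distr lborel borel \<Psi>"
  proof (rule lborel_eqI)
    fix l u :: "real^'n" assume lu: "\<And>b. b \<in> Basis \<Longrightarrow> l \<bullet> b \<le> u \<bullet> b"
    then have lu': "l $ i \<le> u $ i" for i
      using lu[of "axis i 1"] by (simp add: inner_axis)
    have "\<Psi> -` box l u = box (\<Phi> l) (\<Phi> u)"
    proof -
      have "(\<forall>j. l $ j < y $ inv \<sigma> j \<and> y $ inv \<sigma> j < u $ j) \<longleftrightarrow>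
        (\<forall>i. l $ \<sigma> i < y $ i \<and> y $ i < u $ \<sigma> i)" for y :: "real^'n index_copy"
        by (metis \<sigma>_inv)
      then show ?thesis by (auto simp: mem_box_cart \<Phi>_def \<Psi>_def)
    qed
    then have "emeasure (distr lborel borel \<Psi>) (box l u) = emeasure lborel (box (\<Phi> l) (\<Phi> u))"
      by (subst emeasure_distr) auto
    also have "\<dots> = (\<Prod>b\<in>Basis. (\<Phi> u - \<Phi> l) \<bullet> b)"
      by (rule emeasure_lborel_box) (auto simp: Basis_vec_def inner_axis \<Phi>_def lu')
    also have "(\<Prod>b\<in>Basis. (\<Phi> u - \<Phi> l) \<bullet> b) = (\<Prod>b\<in>Basis. (u - l) \<bullet> b)"
      unfolding prod_Basis_cart
      by (subst prod.reindex_bij_betw[OF \<sigma>, symmetric]) (simp add: \<Phi>_def inner_axis)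
    finally show "emeasure (distr lborel borel \<Psi>) (box l u) = (\<Prod>b\<in>Basis. (u - l) \<bullet> b)" .
  qed simp
  have contf: "continuous_on S f" for S
    using diff differentiable_imp_continuous_within by (metis continuous_at_imp_continuous_on)
  have "f ` K \<in> sets borel"
    using K contf by (intro borel_compact compact_continuous_image)
  then have "emeasure lborel (f ` K) = emeasure lborel (\<Psi> -` (f ` K))"
    by (subst distr, subst emeasure_distr) auto
  also have "\<Psi> -` (f ` K) = g ` (\<Phi> ` K)"
    by (auto simp: g_def image_image) (metis imageI inverse(2))
  also have "emeasure lborel \<dots> \<le> (\<integral>\<^sup>+y\<in>\<Phi> ` K. ennreal ((divergence g y / CARD('n index_copy)) ^ CARD('n index_copy)) \<partial>lborel)"
  proof (rule emeasure_image_le_divergence_wellorder)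
    show "compact (\<Phi> ` K)"
      using K lin(1) by (intro compact_continuous_image linear_continuous_on)
    show "g differentiable (at y)" for y using der differentiable_def by blast
    show "divergence g y \<le> L" for y using bound by (simp add: div)
    show "frechet_derivative g (at y) u \<bullet> v = u \<bullet> frechet_derivative g (at y) v" for y u v
      using sym inner[of _ v] inner[of _ u] by (simp add: fd inner_commute[of u]) (metis inner_commute)
    show "0 \<le> u \<bullet> frechet_derivative g (at y) u" for y u
      using psd inner[of _ u] by (simp add: fd inner_commute[of u]) (metis inner_commute)
  qed
  also have "\<dots> = (\<integral>\<^sup>+y. ennreal ((divergence f (\<Psi> y) / CARD('n)) ^ CARD('n)) * indicator K (\<Psi> y) \<partial>lborel)"
    by (intro nn_integral_cong) (auto simp: card_index_copy div split: split_indicator, (metis imageI inverse(2))+)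
  also have "\<dots> = (\<integral>\<^sup>+x\<in>K. ennreal ((divergence f x / CARD('n)) ^ CARD('n)) \<partial>distr lborel borel \<Psi>)"
  proof (rule nn_integral_distr[symmetric])
    have [measurable]: "K \<in> sets borel" "divergence f \<in> borel_measurable borel"
      using K borel_measurable_divergence[OF diff] by (auto simp: borel_compact)
    show "(\<lambda>x. ennreal ((divergence f x / CARD('n)) ^ CARD('n)) * indicator K x)
      \<in> borel_measurable (distr lborel borel \<Psi>)"
      by (subst measurable_cong_sets[OF sets_distr refl]) measurable
  qed simp
  finally show ?thesis by (simp only: distr[symmetric])
qed

section \<open>Firmly nonexpansive and cyclically monotone maps\<close>

text \<open>The condition says that the reflection \<open>2 F - id\<close> is nonexpansive. In this
  form it is visibly convex in \<open>F\<close>, hence stable under averages, and symmetric under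
  the exchange of \<open>F\<close> and \<open>id - F\<close>.\<close>

definition firmly_nonexpansive :: "('a::real_inner \<Rightarrow> 'a) \<Rightarrow> bool" where
  "firmly_nonexpansive F \<longleftrightarrow> (\<forall>x y. norm (2 *\<^sub>R (F x - F y) - (x - y)) \<le> norm (x - y))"

text \<open>Cycles are infinite sequences of points of \<open>S\<close> of which the first
  \<open>N\<close> steps are read; repeated points are allowed.\<close>

definition cyclically_monotone_on :: "'a::real_inner set \<Rightarrow> ('a \<Rightarrow> 'a) \<Rightarrow> bool" where
  "cyclically_monotone_on S F \<longleftrightarrow>
    (\<forall>(x :: nat \<Rightarrow> 'a) N. (\<forall>i. x i \<in> S) \<longrightarrow> x N = x 0 \<longrightarrow> (\<Sum>i<N. F (x i) \<bullet> (x (Suc i) - x i)) \<le> 0)"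

lemma firmly_nonexpansive_iff:
  "firmly_nonexpansive F \<longleftrightarrow> (\<forall>x y. (norm (F x - F y))\<^sup>2 \<le> (F x - F y) \<bullet> (x - y))"
proof -
  have "norm (2 *\<^sub>R a - b) \<le> norm b \<longleftrightarrow> (norm a)\<^sup>2 \<le> a \<bullet> b" for a b :: 'a
  proof -
    have "norm (2 *\<^sub>R a - b) \<le> norm b \<longleftrightarrow> (norm (2 *\<^sub>R a - b))\<^sup>2 \<le> (norm b)\<^sup>2"
      by (simp add: abs_le_square_iff[symmetric])
    then show ?thesis
      by (simp add: power2_norm_eq_inner inner_diff_left inner_diff_right inner_commute)
  qed
  then show ?thesis by (simp add: firmly_nonexpansive_def)
qed

lemma firmly_nonexpansive_complement:
  assumes "firmly_nonexpansive F"
  shows "firmly_nonexpansive (\<lambda>x. x - F x)"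
  unfolding firmly_nonexpansive_def
proof (intro allI)
  fix x y
  have "2 *\<^sub>R (x - F x - (y - F y)) - (x - y) = - (2 *\<^sub>R (F x - F y) - (x - y))"
    by (simp add: algebra_simps scaleR_2)
  then show "norm (2 *\<^sub>R (x - F x - (y - F y)) - (x - y)) \<le> norm (x - y)"
    using assms by (metis firmly_nonexpansive_def norm_minus_cancel)
qed

lemma firmly_nonexpansive_lipschitz:
  assumes "firmly_nonexpansive F"
  shows "norm (F x - F y) \<le> norm (x - y)"
proof -
  have "norm (F x - F y) * norm (F x - F y) \<le> norm (F x - F y) * norm (x - y)"
    using assms norm_cauchy_schwarz[of "F x - F y" "x - y"] order_trans
    unfolding firmly_nonexpansive_iff power2_eq_square by blast
  then show ?thesis
    by (cases "norm (F x - F y) = 0") (auto simp: mult_le_cancel_left)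
qed

lemma firmly_nonexpansive_monotone:
  assumes "firmly_nonexpansive F"
  shows "0 \<le> (F x - F y) \<bullet> (x - y)"
  using assms unfolding firmly_nonexpansive_iff by (meson order_trans zero_le_power2)

lemma firmly_nonexpansive_continuous:
  assumes "firmly_nonexpansive F"
  shows "continuous_on S F"
  by (rule lipschitz_on_continuous_on[of 1], rule lipschitz_onI)
    (auto simp: dist_norm firmly_nonexpansive_lipschitz[OF assms])

lemma cyclically_monotone_onD:
  assumes "cyclically_monotone_on S F" "\<And>i. x i \<in> S" "x N = x 0"
  shows "(\<Sum>i<N. F (x i) \<bullet> (x (Suc i) - x i)) \<le> 0"
  using assms unfolding cyclically_monotone_on_def by blast

lemma firmly_nonexpansive_frechet_derivative:
  assumes firm: "firmly_nonexpansive F" and diff: "F differentiable (at x)"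
  shows "(norm (frechet_derivative F (at x) u))\<^sup>2 \<le> frechet_derivative F (at x) u \<bullet> u"
proof -
  let ?q = "\<lambda>k. real (Suc k) *\<^sub>R (F (x + (1 / real (Suc k)) *\<^sub>R u) - F x)"
  have lim: "?q \<longlonglongrightarrow> frechet_derivative F (at x) u"
    by (rule frechet_derivative_LIMSEQ[OF diff])
  have "(norm (?q k))\<^sup>2 \<le> ?q k \<bullet> u" for k
  proof -
    let ?d = "F (x + (1 / real (Suc k)) *\<^sub>R u) - F x"
    have "(norm ?d)\<^sup>2 \<le> ?d \<bullet> ((1 / real (Suc k)) *\<^sub>R u)"
      using firm[unfolded firmly_nonexpansive_iff, rule_format, of "x + (1 / real (Suc k)) *\<^sub>R u" x] by simp
    then have "(real (Suc k))\<^sup>2 * (norm ?d)\<^sup>2 \<le> (real (Suc k))\<^sup>2 * (?d \<bullet> ((1 / real (Suc k)) *\<^sub>R u))"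
      by (intro mult_left_mono) auto
    then show ?thesis
      by (simp add: power_mult_distrib power2_eq_square mult_ac del: of_nat_Suc)
  qed
  then show ?thesis
    using tendsto_power[OF tendsto_norm[OF lim], of 2] tendsto_inner[OF lim tendsto_const, of u]
    by (intro LIMSEQ_le) auto
qed

text \<open>For a basis vector \<open>b\<close> the derivative \<open>a = DF b\<close> satisfies
  \<open>\<bar>a\<bar>^2 \<le> a \<bullet> b \<le> \<bar>a\<bar>\<close>. This forces
  \<open>\<bar>a\<bar> \<le> 1\<close>, so every diagonal entry lies in
  \<open>[0, 1]\<close>.\<close>

lemma divergence_bounds:
  fixes F :: "'a::euclidean_space \<Rightarrow> 'a"
  assumes firm: "firmly_nonexpansive F" and diff: "F differentiable (at x)"
  shows "0 \<le> divergence F x" "divergence F x \<le> DIM('a)"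
proof -
  have *: "0 \<le> frechet_derivative F (at x) b \<bullet> b \<and> frechet_derivative F (at x) b \<bullet> b \<le> 1" if "b \<in> Basis" for b
  proof -
    let ?a = "frechet_derivative F (at x) b"
    have "(norm ?a)\<^sup>2 \<le> ?a \<bullet> b"
      by (rule firmly_nonexpansive_frechet_derivative[OF assms])
    moreover have "?a \<bullet> b \<le> norm ?a"
      using norm_cauchy_schwarz[of ?a b] that by simp
    moreover have "0 \<le> (norm ?a)\<^sup>2" by simp
    moreover have "norm ?a \<le> 1"
    proof (rule ccontr)
      assume "\<not> norm ?a \<le> 1"
      then have "norm ?a * 1 < norm ?a * norm ?a" by (intro mult_strict_left_mono) auto
      with calculation show False by (simp add: power2_eq_square)
    qed
    ultimately show ?thesis by linarith
  qed
  then show "0 \<le> divergence F x"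
    unfolding divergence_def by (intro sum_nonneg) auto
  have "divergence F x \<le> (\<Sum>b\<in>(Basis::'a set). 1)"
    unfolding divergence_def using * by (intro sum_mono) auto
  then show "divergence F x \<le> DIM('a)" by simp
qed

text \<open>The left Riemann sum, with \<open>m\<close> steps, of the line integral of the field
  \<open>A\<close> along the segment from \<open>a\<close> to \<open>a + d\<close>.\<close>

lemma sum_linear_segment:
  fixes A :: "'a::real_inner \<Rightarrow> 'a"
  assumes "linear A" "0 < m"
  shows "(\<Sum>i<m. A (a + (real i / real m) *\<^sub>R d) \<bullet> ((1 / real m) *\<^sub>R d)) =
    A a \<bullet> d + (A d \<bullet> d) * ((1 - 1 / real m) / 2)"
proof -
  define c where "c = (A d \<bullet> d) / (real m)\<^sup>2"
  have "A (a + (real i / real m) *\<^sub>R d) \<bullet> ((1 / real m) *\<^sub>R d) = (A a \<bullet> d) / real m + real i * c" for i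
    using assms(1) by (simp add: c_def linear_add linear_scale inner_add_left power2_eq_square add_divide_distrib)
  then have "(\<Sum>i<m. A (a + (real i / real m) *\<^sub>R d) \<bullet> ((1 / real m) *\<^sub>R d)) =
    (\<Sum>i<m. (A a \<bullet> d) / real m + real i * c)"
    by (simp only:)
  also have "\<dots> = A a \<bullet> d + (\<Sum>i<m. real i) * c"
    using \<open>0 < m\<close> by (simp add: sum.distrib sum_distrib_right)
  also have "(\<Sum>i<m. real i) = real m * (real m - 1) / 2"
    by (induction m) (auto simp: field_simps)
  also have "A a \<bullet> d + real m * (real m - 1) / 2 * c = A a \<bullet> d + (A d \<bullet> d) * ((1 - 1 / real m) / 2)"
    using \<open>0 < m\<close> by (simp add: c_def field_simps power2_eq_square)
  finally show ?thesis .
qed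

text \<open>The defining inequality is applied to a triangle with vertices \<open>0\<close>, \<open>p\<close>, \<open>q\<close> whose edges are subdivided into \<open>m\<close> steps.\<close>

lemma cyclically_monotone_linear_symmetric:
  fixes A :: "'a::real_inner \<Rightarrow> 'a"
  assumes lin: "linear A" and cyc: "cyclically_monotone_on UNIV A"
  shows "A p \<bullet> q = p \<bullet> A q"
proof -
  have le: "A p \<bullet> q \<le> A q \<bullet> p" for p q
  proof -
    have "A p \<bullet> (q - p) - A q \<bullet> q + (A p \<bullet> p + A (q - p) \<bullet> (q - p) + A q \<bullet> q) * ((1 - 1 / real (Suc k)) / 2) \<le> 0" for k
    proof -
      define m where "m = Suc k"
      then have "0 < m" by simp
      define x where "x i = (if i \<le> m then (real i / real m) *\<^sub>R p
        else if i \<le> 2 * m then p + (real (i - m) / real m) *\<^sub>R (q - p)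
        else q + (real (i - 2 * m) / real m) *\<^sub>R (- q))" for i
      have step: "x (Suc i) - x i = (1 / real m) *\<^sub>R p" "x i = 0 + (real i / real m) *\<^sub>R p" if "i < m" for i
        using that by (auto simp: x_def scaleR_left_diff_distrib[symmetric] diff_divide_distrib[symmetric])
      have step2: "x (Suc (m + i)) - x (m + i) = (1 / real m) *\<^sub>R (q - p)"
        "x (m + i) = p + (real i / real m) *\<^sub>R (q - p)" if "i < m" for i
        using that \<open>0 < m\<close> by (cases "i = 0", auto simp: x_def scaleR_left_diff_distrib[symmetric] diff_divide_distrib[symmetric])+
      have step3: "x (Suc (2 * m + i)) - x (2 * m + i) = (1 / real m) *\<^sub>R (- q)"
        "x (2 * m + i) = q + (real i / real m) *\<^sub>R (- q)" if "i < m" for i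
        using that \<open>0 < m\<close> by (cases "i = 0", auto simp: x_def scaleR_left_diff_distrib[symmetric] diff_divide_distrib[symmetric] algebra_simps)+
      let ?t = "\<lambda>i. A (x i) \<bullet> (x (Suc i) - x i)"
      have "x (3 * m) = x 0"
        using \<open>0 < m\<close> by (simp add: x_def)
      then have "(\<Sum>i<3 * m. ?t i) \<le> 0"
        using cyc by (intro cyclically_monotone_onD) auto
      also have "(\<Sum>i<3 * m. ?t i) = (\<Sum>i<m. ?t i) + (\<Sum>i<m. ?t (m + i)) + (\<Sum>i<m. ?t (2 * m + i))"
      proof -
        have "sum ?t {..<a + b} = sum ?t {..<a} + (\<Sum>i<b. ?t (a + i))" for a b
          by (induction b) auto
        from this[of "2 * m" m] this[of m m] show ?thesis
          by (simp add: mult_2 numeral_3_eq_3 add.assoc)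
      qed
      also have "(\<Sum>i<m. ?t i) = A 0 \<bullet> p + (A p \<bullet> p) * ((1 - 1 / real m) / 2)"
        unfolding sum_linear_segment[OF lin \<open>0 < m\<close>, symmetric]
        by (intro sum.cong refl, subst step(1), simp, subst step(2), simp_all)
      also have "(\<Sum>i<m. ?t (m + i)) = A p \<bullet> (q - p) + (A (q - p) \<bullet> (q - p)) * ((1 - 1 / real m) / 2)"
        unfolding sum_linear_segment[OF lin \<open>0 < m\<close>, symmetric]
        by (intro sum.cong refl, subst step2(1), simp, subst step2(2), simp_all)
      also have "(\<Sum>i<m. ?t (2 * m + i)) = A q \<bullet> (- q) + (A (- q) \<bullet> (- q)) * ((1 - 1 / real m) / 2)"
        unfolding sum_linear_segment[OF lin \<open>0 < m\<close>, symmetric]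
        by (intro sum.cong refl, subst step3(1), simp, subst step3(2), simp_all)
      finally show ?thesis
        using lin by (simp add: m_def linear_0 linear_neg distrib_right add_divide_distrib del: of_nat_Suc)
    qed
    \<comment> \<open>In the limit the sum around the triangle becomes half of
      \<open>A p \<bullet> q - A q \<bullet> p\<close>, the circulation of the field. Exchanging
      \<open>p\<close> and \<open>q\<close> reverses the orientation and yields the opposite
      inequality.\<close>
    moreover have "(\<lambda>k. 1 / real (Suc k)) \<longlonglongrightarrow> 0"
      using LIMSEQ_inverse_real_of_nat by (simp add: inverse_eq_divide del: of_nat_Suc)
    then have "(\<lambda>k. A p \<bullet> (q - p) - A q \<bullet> q + (A p \<bullet> p + A (q - p) \<bullet> (q - p) + A q \<bullet> q) * ((1 - 1 / real (Suc k)) / 2))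
      \<longlonglongrightarrow> A p \<bullet> (q - p) - A q \<bullet> q + (A p \<bullet> p + A (q - p) \<bullet> (q - p) + A q \<bullet> q) * ((1 - 0) / 2)"
      by (intro tendsto_intros) auto
    ultimately have "A p \<bullet> (q - p) - A q \<bullet> q + (A p \<bullet> p + A (q - p) \<bullet> (q - p) + A q \<bullet> q) * ((1 - 0) / 2) \<le> 0"
      by (intro LIMSEQ_le_const2) auto
    then show ?thesis
      using lin by (simp add: linear_diff inner_diff_left inner_diff_right field_simps)
  qed
  from le[of p q] le[of q p] show ?thesis by (simp add: inner_commute)
qed

text \<open>The derivative inherits cyclical monotonicity: in the difference quotients along a
  shrunken cycle the constant \<open>F x\<close> drops out, because the steps of a closed cycle add
  up to zero. Symmetry is thus obtained on the level of the map itself, where a potential would give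
  the symmetry of second derivatives.\<close>

lemma cyclically_monotone_frechet_derivative_symmetric:
  fixes F :: "'a::real_inner \<Rightarrow> 'a"
  assumes cyc: "cyclically_monotone_on UNIV F" and diff: "F differentiable (at x)"
  shows "frechet_derivative F (at x) u \<bullet> v = u \<bullet> frechet_derivative F (at x) v"
proof (rule cyclically_monotone_linear_symmetric)
  show "linear (frechet_derivative F (at x))"
    by (rule linear_frechet_derivative[OF diff])
  show "cyclically_monotone_on UNIV (frechet_derivative F (at x))"
    unfolding cyclically_monotone_on_def
  proof (intro allI impI)
    fix w :: "nat \<Rightarrow> 'a" and N assume "w N = w 0"
    then have tele: "(\<Sum>i<N. c \<bullet> (w (Suc i) - w i)) = 0" for c
      using sum_lessThan_telescope[of w N] by (simp flip: inner_sum_right)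
    let ?h = "\<lambda>k. 1 / real (Suc k)"
    have "(\<Sum>i<N. (real (Suc k) *\<^sub>R (F (x + ?h k *\<^sub>R w i) - F x)) \<bullet> (w (Suc i) - w i)) \<le> 0" for k
    proof -
      have "(\<Sum>i<N. F (x + ?h k *\<^sub>R w i) \<bullet> ((x + ?h k *\<^sub>R w (Suc i)) - (x + ?h k *\<^sub>R w i))) \<le> 0"
        using \<open>w N = w 0\<close> by (intro cyclically_monotone_onD[OF cyc]) auto
      also have "(\<Sum>i<N. F (x + ?h k *\<^sub>R w i) \<bullet> ((x + ?h k *\<^sub>R w (Suc i)) - (x + ?h k *\<^sub>R w i))) =
        ?h k * (\<Sum>i<N. F (x + ?h k *\<^sub>R w i) \<bullet> (w (Suc i) - w i))"
        unfolding sum_distrib_left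
        by (intro sum.cong) (simp_all add: inner_diff_right right_diff_distrib del: of_nat_Suc)
      finally have "(\<Sum>i<N. F (x + ?h k *\<^sub>R w i) \<bullet> (w (Suc i) - w i)) \<le> 0"
        by (simp add: divide_le_0_iff del: of_nat_Suc)
      then have "(\<Sum>i<N. (F (x + ?h k *\<^sub>R w i) - F x) \<bullet> (w (Suc i) - w i)) \<le> 0"
        using tele[of "F x"] by (simp add: inner_diff_left sum_subtractf)
      then have "real (Suc k) * (\<Sum>i<N. (F (x + ?h k *\<^sub>R w i) - F x) \<bullet> (w (Suc i) - w i)) \<le> 0"
        by (intro mult_nonneg_nonpos) auto
      then show ?thesis by (simp add: sum_distrib_left del: of_nat_Suc)
    qed
    moreover have "(\<lambda>k. \<Sum>i<N. (real (Suc k) *\<^sub>R (F (x + ?h k *\<^sub>R w i) - F x)) \<bullet> (w (Suc i) - w i))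
      \<longlonglongrightarrow> (\<Sum>i<N. frechet_derivative F (at x) (w i) \<bullet> (w (Suc i) - w i))"
      by (intro tendsto_intros frechet_derivative_LIMSEQ[OF diff])
    ultimately show "(\<Sum>i<N. frechet_derivative F (at x) (w i) \<bullet> (w (Suc i) - w i)) \<le> 0"
      by (intro LIMSEQ_le_const2) auto
  qed
qed

section \<open>Smoothing\<close>

lemma lborel_integral_reflect:
  fixes f :: "'a::euclidean_space \<Rightarrow> 'b::euclidean_space"
  assumes [measurable]: "f \<in> borel_measurable borel"
  shows "(LINT w|lborel. f (x - w)) = (LINT z|lborel. f z)"
proof -
  have "lborel = distr lborel borel (\<lambda>w. x - w)"
    using lborel_affine[of "-1" x] by (simp add: density_1)
  then have "(LINT z|lborel. f z) = (LINT z|distr lborel borel (\<lambda>w. x - w). f z)"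
    by (rule arg_cong)
  also have "\<dots> = (LINT w|lborel. f (x - w))"
    by (intro integral_distr) auto
  finally show ?thesis by simp
qed

text \<open>The unnormalised mollifier \<open>(e^2 - \<bar>w\<bar>^2)_+^2\<close>. Squaring the
  positive part makes it continuously differentiable across the boundary of its support, the ball of
  radius \<open>e\<close>.\<close>

definition bump :: "real \<Rightarrow> 'a::real_inner \<Rightarrow> real" where
  "bump e w = (max 0 (e\<^sup>2 - w \<bullet> w))\<^sup>2"

lemma bump_has_derivative:
  "(bump e has_derivative (\<lambda>h. (-4 * max 0 (e\<^sup>2 - w \<bullet> w)) *\<^sub>R w \<bullet> h)) (at w)"
proof -
  have "((\<lambda>s::real. (max 0 s)\<^sup>2) has_real_derivative 2 * max 0 s) (at s)" for s
  proof (cases s "0::real" rule: linorder_cases)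
    case less
    have "((\<lambda>s::real. 0) has_real_derivative 2 * max 0 s) (at s)"
      using less by (auto simp: max_def)
    then show ?thesis
      by (rule has_field_derivative_transform_within_open[of _ _ _ "{..<0}"]) (use less in auto)
  next
    case greater
    have "((\<lambda>s::real. s\<^sup>2) has_real_derivative 2 * max 0 s) (at s)"
      using greater by (auto intro!: derivative_eq_intros simp: max_def)
    then show ?thesis
      by (rule has_field_derivative_transform_within_open[of _ _ _ "{0<..}"]) (use greater in auto)
  next
    case equal
    have "((\<lambda>h::real. (max 0 h)\<^sup>2 / h) \<longlongrightarrow> 0) (at 0)"
    proof (rule Lim_null_comparison)
      show "\<forall>\<^sub>F h in at 0. norm ((max 0 h)\<^sup>2 / h) \<le> \<bar>h::real\<bar>"
        by (rule always_eventually) (auto simp: max_def power2_eq_square)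
      show "((\<lambda>h::real. \<bar>h\<bar>) \<longlongrightarrow> 0) (at 0)"
        by (intro tendsto_rabs_zero tendsto_ident_at)
    qed
    then show ?thesis using equal by (simp add: DERIV_def)
  qed
  then have "((\<lambda>s::real. (max 0 s)\<^sup>2) has_derivative (\<lambda>h. 2 * max 0 s * h)) (at s)" for s
    by (simp add: has_field_derivative_def mult_commute_abs)
  note square = this
  have "((\<lambda>w. e\<^sup>2 - w \<bullet> w) has_derivative (\<lambda>h. - (w \<bullet> h + h \<bullet> w))) (at w)"
    by (auto intro!: derivative_eq_intros)
  from has_derivative_compose[OF this square]
  have "((\<lambda>w. (max 0 (e\<^sup>2 - w \<bullet> w))\<^sup>2) has_derivative (\<lambda>h. 2 * max 0 (e\<^sup>2 - w \<bullet> w) * (- (w \<bullet> h + h \<bullet> w)))) (at w)" .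
  moreover have "(\<lambda>h. 2 * max 0 (e\<^sup>2 - w \<bullet> w) * (- (w \<bullet> h + h \<bullet> w))) = (\<lambda>h. (-4 * max 0 (e\<^sup>2 - w \<bullet> w)) *\<^sub>R w \<bullet> h)"
    by (auto simp: inner_commute)
  ultimately show ?thesis
    unfolding bump_def[abs_def] by simp
qed

lemma continuous_on_bump: "continuous_on S (bump e)"
  unfolding bump_def[abs_def] by (intro continuous_intros)

lemma bump_eq_0: "e \<le> norm w \<Longrightarrow> 0 \<le> e \<Longrightarrow> bump e w = 0"
  unfolding bump_def by (simp add: power2_norm_eq_inner[symmetric] max_def power_mono)

lemma bump_nonneg: "0 \<le> bump e w"
  by (simp add: bump_def)

lemma integrable_bump_scaleR:
  fixes g :: "'a::euclidean_space \<Rightarrow> 'b::euclidean_space"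
  assumes "continuous_on UNIV g" "0 \<le> e"
  shows "integrable lborel (\<lambda>w. bump e (x - w) *\<^sub>R g w)" "integrable lborel (\<lambda>w. bump e w *\<^sub>R g w)"
    "(LINT w|lborel. bump e (x - w) *\<^sub>R g w) = (LINT w:cball x e|lborel. bump e (x - w) *\<^sub>R g w)"
proof -
  have "set_integrable lborel (cball x e) (\<lambda>w. bump e (x - w) *\<^sub>R g w)" for x
    unfolding set_integrable_def
    by (intro borel_integrable_compact continuous_intros continuous_on_compose2[OF continuous_on_bump]
        continuous_on_subset[OF assms(1)]) auto
  moreover have ind: "indicat_real (cball x e) w *\<^sub>R (bump e (x - w) *\<^sub>R g w) = bump e (x - w) *\<^sub>R g w" for x w
    using bump_eq_0[of e "x - w"] assms(2) by (cases "norm (x - w) \<le> e") (auto simp: indicator_def dist_norm)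
  ultimately show *: "integrable lborel (\<lambda>w. bump e (x - w) *\<^sub>R g w)" for x
    by (simp only: set_integrable_def)
  have "bump e (- w) = bump e w" for w :: 'a by (simp add: bump_def)
  with *[of 0] show "integrable lborel (\<lambda>w. bump e w *\<^sub>R g w)" by simp
  show "(LINT w|lborel. bump e (x - w) *\<^sub>R g w) = (LINT w:cball x e|lborel. bump e (x - w) *\<^sub>R g w)"
    unfolding set_lebesgue_integral_def ind ..
qed

text \<open>Differentiation under the integral sign, with the derivative falling on the kernel. The
  box contains the supports of all kernels centred within distance 1 of \<open>x0\<close>, so near
  \<open>x0\<close> the convolution is an integral over one fixed compact domain.\<close>

lemma convolution_bump_differentiable:
  fixes P :: "'a::euclidean_space \<Rightarrow> 'a"
  assumes contP: "continuous_on UNIV P" and "0 \<le> e"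
  shows "(\<lambda>x. LINT z|lborel. bump e (x - z) *\<^sub>R P z) differentiable (at x0)"
proof -
  obtain a b where ab: "cball x0 (1 + e) \<subseteq> cbox a b"
    using bounded_subset_cbox_symmetric[OF bounded_cball] by metis
  define fx where "fx x z = blinfun_scaleR_left (P z) o\<^sub>L
    blinfun_inner_right ((-4 * max 0 (e\<^sup>2 - (x - z) \<bullet> (x - z))) *\<^sub>R (x - z))" for x z
  let ?f = "\<lambda>x z. bump e (x - z) *\<^sub>R P z"
  have "((\<lambda>x. integral (cbox a b) (?f x)) has_derivative integral (cbox a b) (fx x0)) (at x0 within ball x0 1)"
  proof (rule leibniz_rule)
    fix x z
    have "((\<lambda>x. bump e (x - z)) has_derivative (\<lambda>h. (-4 * max 0 (e\<^sup>2 - (x - z) \<bullet> (x - z))) *\<^sub>R (x - z) \<bullet> h)) (at x within ball x0 1)"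
      by (rule has_derivative_compose[OF _ bump_has_derivative]) (auto intro!: derivative_eq_intros)
    then show "((\<lambda>x. ?f x z) has_derivative blinfun_apply (fx x z)) (at x within ball x0 1)"
      unfolding fx_def by (auto intro!: derivative_eq_intros simp: blinfun_inner_right.rep_eq)
    show "?f x integrable_on cbox a b"
      by (intro integrable_continuous continuous_intros continuous_on_compose2[OF continuous_on_bump]
          continuous_on_subset[OF contP]) auto
  next
    show "continuous_on (ball x0 1 \<times> cbox a b) (\<lambda>(x, z). fx x z)"
      unfolding fx_def case_prod_unfold
      by (intro bounded_bilinear.continuous_on[OF bounded_bilinear_blinfun_compose]
          bounded_linear.continuous_on[OF bounded_linear_blinfun_scaleR_left]
          bounded_linear.continuous_on[OF bounded_linear_blinfun_inner_right]
          continuous_intros continuous_on_compose2[OF contP]) auto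
  qed auto
  then have "((\<lambda>x. integral (cbox a b) (?f x)) has_derivative integral (cbox a b) (fx x0)) (at x0)"
    by (simp add: at_within_open[of x0 "ball x0 1"])
  then have "((\<lambda>x. LINT z|lborel. ?f x z) has_derivative integral (cbox a b) (fx x0)) (at x0)"
  proof (rule has_derivative_transform_within_open[of _ _ _ _ "ball x0 1"])
    fix x assume "x \<in> ball x0 1"
    then have sub: "cball x e \<subseteq> cbox a b"
      using ab dist_triangle[of x0 _ x] by (intro order_trans[OF _ ab] subsetI) (smt (verit) mem_ball mem_cball)
    have eq: "indicator (cball x e) z *\<^sub>R ?f x z = indicator (cbox a b) z *\<^sub>R ?f x z" for z
      using bump_eq_0[of e "x - z"] \<open>0 \<le> e\<close> sub by (cases "norm (x - z) \<le> e") (auto simp: indicator_def dist_norm)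
    have "integral (cbox a b) (?f x) = (LINT z:cbox a b|lborel. ?f x z)"
      by (intro set_borel_integral_eq_integral(2)[symmetric], unfold set_integrable_def)
        (intro borel_integrable_compact continuous_intros continuous_on_compose2[OF continuous_on_bump]
          continuous_on_subset[OF contP], auto)
    also have "\<dots> = (LINT z|lborel. ?f x z)"
      unfolding integrable_bump_scaleR(3)[OF contP \<open>0 \<le> e\<close>] set_lebesgue_integral_def eq ..
    finally show "integral (cbox a b) (?f x) = (LINT z|lborel. ?f x z)" .
  qed auto
  then show ?thesis by (auto simp: differentiable_def)
qed

lemma integral_bump_pos:
  assumes "0 < e"
  shows "0 < (LINT w|lborel. bump e (w::'a::euclidean_space))"
proof -
  have int: "integrable lborel (bump e :: 'a \<Rightarrow> real)"
    using integrable_bump_scaleR(2)[of "\<lambda>_::'a. 1::real" e] assms by simp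
  have "(LINT w|lborel. bump e (w::'a)) \<noteq> 0"
  proof
    assume "(LINT w|lborel. bump e (w::'a)) = 0"
    then have AE: "AE w in lborel. bump e (w::'a) = 0"
      using integral_nonneg_eq_0_iff_AE[OF int] bump_nonneg by blast
    have "bump e w \<noteq> 0" if "w \<in> ball 0 e" for w :: 'a
    proof -
      have "(norm w)\<^sup>2 < e\<^sup>2"
        using that by (intro power_strict_mono) auto
      then show ?thesis by (simp add: bump_def power2_norm_eq_inner max_def)
    qed
    then have "AE w in lborel. (w::'a) \<notin> ball 0 e"
      using AE by (auto elim!: eventually_mono)
    then have "emeasure lborel (ball (0::'a) e) = 0"
      by (subst (asm) AE_iff_measurable[of "ball 0 e"]) auto
    moreover have "0 < measure lborel (ball (0::'a) e)"
      using content_ball_pos[OF assms] by simp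
    ultimately show False by (simp add: measure_def)
  qed
  moreover have "0 \<le> (LINT w|lborel. bump e (w::'a))"
    by (intro Bochner_Integration.integral_nonneg bump_nonneg)
  ultimately show ?thesis by simp
qed

text \<open>\<open>F\<close> is a weighted average of translates of \<open>P\<close>. Firm
  nonexpansiveness is a bound on a norm and cyclical monotonicity a linear inequality, and both
  survive averaging with nonnegative weights. As \<open>P\<close> is 1-Lipschitz and the weights
  live in a ball of radius \<open>e\<close>, the distance to \<open>P\<close> is at most
  \<open>e\<close>.\<close>

lemma firmly_nonexpansive_smoothing:
  fixes P :: "'a::euclidean_space \<Rightarrow> 'a"
  assumes firm: "firmly_nonexpansive P" and cyc: "cyclically_monotone_on UNIV P" and "0 < e"
  obtains F where "\<And>x. F differentiable (at x)" "firmly_nonexpansive F" "cyclically_monotone_on UNIV F"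
    "\<And>x. norm (F x - P x) \<le> e"
proof -
  define Z where "Z = (LINT w|lborel. bump e (w::'a))"
  have "0 < Z" unfolding Z_def by (rule integral_bump_pos[OF \<open>0 < e\<close>])
  define F where "F x = (1 / Z) *\<^sub>R (LINT w|lborel. bump e w *\<^sub>R P (x - w))" for x
  have contP: "continuous_on S P" for S by (rule firmly_nonexpansive_continuous[OF firm])
  note int = integrable_bump_scaleR(2)[OF _ less_imp_le[OF \<open>0 < e\<close>]]
  have contPx: "continuous_on UNIV (\<lambda>w. P (x - w))" for x
    by (intro continuous_on_compose2[OF contP[of UNIV]] continuous_intros) auto
  have intc: "(LINT w|lborel. bump e (w::'a) *\<^sub>R c) = Z *\<^sub>R c" for c :: 'a
    unfolding Z_def using int[of "\<lambda>_::'a. 1::real"] by (intro integral_scaleR_left) simp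
  have average_bound: "norm ((1 / Z) *\<^sub>R (LINT w|lborel. bump e w *\<^sub>R h w)) \<le> B"
    if h: "continuous_on UNIV h" and B: "\<And>w. norm w \<le> e \<Longrightarrow> norm (h w) \<le> B" for h :: "'a \<Rightarrow> 'a" and B
  proof -
    have "norm (LINT w|lborel. bump e w *\<^sub>R h w) \<le> (LINT w|lborel. bump e (w::'a) * B)"
    proof (rule Bochner_Integration.integral_norm_bound_integral)
      show "norm (bump e w *\<^sub>R h w) \<le> bump e w * B" for w
        using B[of w] bump_eq_0[of e w] bump_nonneg[of e w] \<open>0 < e\<close>
        by (cases "norm w \<le> e") (auto intro!: mult_left_mono)
      show "integrable lborel (\<lambda>w. bump e (w::'a) * B)"
        using int[of "\<lambda>_::'a. B"] by simp
    qed (use h in \<open>auto intro!: int\<close>)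
    also have "(LINT w|lborel. bump e (w::'a) * B) = Z * B"
      by (simp add: Z_def)
    finally show ?thesis using \<open>0 < Z\<close> by (simp add: field_simps)
  qed
  show ?thesis
  proof (rule that[of F])
    \<comment> \<open>The reflected form puts \<open>x\<close> into the kernel, which is
      differentiable, instead of into \<open>P\<close>.\<close>
    have "F = (\<lambda>x. (1 / Z) *\<^sub>R (LINT z|lborel. bump e (x - z) *\<^sub>R P z))"
    proof (intro ext)
      fix x
      have [measurable]: "P \<in> borel_measurable borel" "bump e \<in> borel_measurable (borel :: 'a measure)"
        by (auto intro!: borel_measurable_continuous_onI contP continuous_on_bump)
      have "(LINT w|lborel. bump e w *\<^sub>R P (x - w)) = (LINT w|lborel. bump e (x - (x - w)) *\<^sub>R P (x - w))"
        by simp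
      also have "\<dots> = (LINT z|lborel. bump e (x - z) *\<^sub>R P z)"
        by (rule lborel_integral_reflect[of "\<lambda>z. bump e (x - z) *\<^sub>R P z" x]) measurable
      finally show "F x = (1 / Z) *\<^sub>R (LINT z|lborel. bump e (x - z) *\<^sub>R P z)"
        by (simp add: F_def)
    qed
    then show "F differentiable (at x)" for x
      using convolution_bump_differentiable[OF contP, of e x] \<open>0 < e\<close> by simp
    show "firmly_nonexpansive F"
      unfolding firmly_nonexpansive_def
    proof (intro allI)
      fix x y
      have "2 *\<^sub>R (F x - F y) - (x - y) = (1 / Z) *\<^sub>R (LINT w|lborel. bump e w *\<^sub>R (2 *\<^sub>R (P (x - w) - P (y - w)) - (x - y)))"
      proof -
        have "(LINT w|lborel. bump e w *\<^sub>R (2 *\<^sub>R (P (x - w) - P (y - w)) - (x - y))) =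
          (LINT w|lborel. 2 *\<^sub>R (bump e w *\<^sub>R P (x - w) - bump e w *\<^sub>R P (y - w)) - bump e w *\<^sub>R (x - y))"
          by (intro Bochner_Integration.integral_cong) (auto simp: algebra_simps)
        also have "\<dots> = 2 *\<^sub>R ((LINT w|lborel. bump e w *\<^sub>R P (x - w)) - (LINT w|lborel. bump e w *\<^sub>R P (y - w))) - Z *\<^sub>R (x - y)"
          by (simp add: int contPx intc)
        finally have eq: "(LINT w|lborel. bump e w *\<^sub>R (2 *\<^sub>R (P (x - w) - P (y - w)) - (x - y))) =
          2 *\<^sub>R ((LINT w|lborel. bump e w *\<^sub>R P (x - w)) - (LINT w|lborel. bump e w *\<^sub>R P (y - w))) - Z *\<^sub>R (x - y)" .
        show ?thesis
          unfolding eq F_def using \<open>0 < Z\<close> by (simp add: scaleR_diff_right)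
      qed
      also have "norm \<dots> \<le> norm (x - y)"
      proof (rule average_bound)
        show "norm (2 *\<^sub>R (P (x - w) - P (y - w)) - (x - y)) \<le> norm (x - y)" for w
          using firm[unfolded firmly_nonexpansive_def, rule_format, of "x - w" "y - w"] by simp
      qed (intro continuous_intros contPx)
      finally show "norm (2 *\<^sub>R (F x - F y) - (x - y)) \<le> norm (x - y)" .
    qed
    show "cyclically_monotone_on UNIV F"
      unfolding cyclically_monotone_on_def
    proof (intro allI impI)
      fix x :: "nat \<Rightarrow> 'a" and N assume xN: "x N = x 0"
      have F: "(\<Sum>i<N. F (x i) \<bullet> (x (Suc i) - x i)) =
        (1 / Z) * (\<Sum>i<N. (LINT w|lborel. bump e w *\<^sub>R P (x i - w)) \<bullet> (x (Suc i) - x i))"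
        by (simp add: F_def sum_distrib_left)
      have "(\<Sum>i<N. (LINT w|lborel. bump e w *\<^sub>R P (x i - w)) \<bullet> (x (Suc i) - x i)) =
        (LINT w|lborel. (\<Sum>i<N. (bump e w *\<^sub>R P (x i - w)) \<bullet> (x (Suc i) - x i)))"
        by (subst Bochner_Integration.integral_sum[OF integrable_inner_left[OF int[OF contPx]]])
          (simp only: integral_inner_left[OF int[OF contPx]])
      also have "\<dots> \<le> 0"
      proof -
        have "0 \<le> - (\<Sum>i<N. (bump e w *\<^sub>R P (x i - w)) \<bullet> (x (Suc i) - x i))" for w
        proof -
          have "(\<Sum>i<N. P (x i - w) \<bullet> ((x (Suc i) - w) - (x i - w))) \<le> 0"
            using xN by (intro cyclically_monotone_onD[OF cyc]) auto
          then have "bump e w * (\<Sum>i<N. P (x i - w) \<bullet> (x (Suc i) - x i)) \<le> 0"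
            using bump_nonneg by (intro mult_nonneg_nonpos) auto
          then show ?thesis by (simp add: sum_distrib_left)
        qed
        then have "0 \<le> (LINT w|lborel. - (\<Sum>i<N. (bump e w *\<^sub>R P (x i - w)) \<bullet> (x (Suc i) - x i)))"
          by (intro Bochner_Integration.integral_nonneg)
        then show ?thesis by (simp only: Bochner_Integration.integral_minus neg_0_le_iff_le)
      qed
      finally show "(\<Sum>i<N. F (x i) \<bullet> (x (Suc i) - x i)) \<le> 0"
        unfolding F using \<open>0 < Z\<close> by (intro mult_nonneg_nonpos) auto
    qed
    show "norm (F x - P x) \<le> e" for x
    proof -
      have "F x - P x = (1 / Z) *\<^sub>R (LINT w|lborel. bump e w *\<^sub>R (P (x - w) - P x))"
        using \<open>0 < Z\<close> by (simp add: F_def scaleR_diff_right int contPx intc)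
      also have "norm \<dots> \<le> e"
      proof (rule average_bound)
        show "norm (P (x - w) - P x) \<le> e" if "norm w \<le> e" for w
          using firmly_nonexpansive_lipschitz[OF firm, of "x - w" x] that by simp
      qed (intro continuous_intros contPx)
      finally show ?thesis .
    qed
  qed
qed

section \<open>Strong convergence of the divergences\<close>

text \<open>The sum of the absolute differences has finite integral and is therefore finite almost
  everywhere; where it is finite, the sequence is the partial sum of an absolutely convergent
  telescoping series.\<close>

lemma AE_convergent_of_summable_differences:
  fixes g :: "nat \<Rightarrow> 'a \<Rightarrow> real"
  assumes [measurable]: "\<And>k. g k \<in> borel_measurable M"
    and le: "\<And>k. (\<integral>\<^sup>+x. ennreal \<bar>g k x - g (Suc k) x\<bar> \<partial>M) \<le> ennreal (c k)" and c: "summable c" "\<And>k. 0 \<le> c k"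
  shows "AE x in M. convergent (\<lambda>k. g k x)"
proof -
  have "(\<integral>\<^sup>+x. (\<Sum>k. ennreal \<bar>g k x - g (Suc k) x\<bar>) \<partial>M) = (\<Sum>k. \<integral>\<^sup>+x. ennreal \<bar>g k x - g (Suc k) x\<bar> \<partial>M)"
    by (rule nn_integral_suminf) simp
  also have "\<dots> \<le> (\<Sum>k. ennreal (c k))"
    by (intro suminf_le le) auto
  also have "\<dots> < \<infinity>"
    using c by (simp add: suminf_ennreal2)
  finally have "AE x in M. (\<Sum>k. ennreal \<bar>g k x - g (Suc k) x\<bar>) \<noteq> \<infinity>"
    by (intro nn_integral_PInf_AE) auto
  then show ?thesis
  proof (rule AE_mp, intro AE_I2 impI)
    fix x assume "(\<Sum>k. ennreal \<bar>g k x - g (Suc k) x\<bar>) \<noteq> \<infinity>"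
    then have "summable (\<lambda>k. \<bar>g k x - g (Suc k) x\<bar>)"
      by (intro summable_suminf_not_top) auto
    then have "summable (\<lambda>k. g (Suc k) x - g k x)"
      by (intro summable_rabs_cancel[of "\<lambda>k. g (Suc k) x - g k x"]) (simp add: abs_minus_commute)
    then have "convergent (\<lambda>n. \<Sum>k<n. g (Suc k) x - g k x)"
      using summable_iff_convergent by blast
    then have "convergent (\<lambda>n. g n x - g 0 x)"
      by (simp add: sum_lessThan_telescope[of "\<lambda>k. g k x"])
    then have "convergent (\<lambda>n. (g n x - g 0 x) + g 0 x)"
      by (intro convergent_add convergent_const)
    then show "convergent (\<lambda>k. g k x)" by simp
  qed
qed

text \<open>From \<open>\<bar>f\<bar> \<le> s + f^2 / s\<close>. With \<open>s\<close> of the size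
  of the L^2 norm this has the same order as the Cauchy-Schwarz bound.\<close>

lemma (in finite_measure) L1_le_L2:
  fixes f :: "'a \<Rightarrow> real"
  assumes [measurable]: "f \<in> borel_measurable M" and int: "integrable M (\<lambda>x. (f x)\<^sup>2)"
    and le: "(\<integral>x. (f x)\<^sup>2 \<partial>M) \<le> a * s\<^sup>2" and "0 < s"
  shows "(\<integral>\<^sup>+x. ennreal \<bar>f x\<bar> \<partial>M) \<le> ennreal (s * (measure M (space M) + a))"
proof -
  have "(\<integral>\<^sup>+x. ennreal \<bar>f x\<bar> \<partial>M) \<le> (\<integral>\<^sup>+x. ennreal (s + (f x)\<^sup>2 / s) \<partial>M)"
  proof (intro nn_integral_mono ennreal_leI)
    fix x
    have "0 \<le> (\<bar>f x\<bar> - s)\<^sup>2" by simp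
    then have "2 * (\<bar>f x\<bar> * s) \<le> s * s + (f x)\<^sup>2"
      by (simp add: power2_eq_square algebra_simps)
    moreover have "0 \<le> \<bar>f x\<bar> * s" using \<open>0 < s\<close> by simp
    ultimately have "\<bar>f x\<bar> * s \<le> s * s + (f x)\<^sup>2" by simp
    then show "\<bar>f x\<bar> \<le> s + (f x)\<^sup>2 / s" using \<open>0 < s\<close> by (simp add: field_simps)
  qed
  also have "\<dots> = ennreal (\<integral>x. s + (f x)\<^sup>2 / s \<partial>M)"
    using int \<open>0 < s\<close> by (intro nn_integral_eq_integral) auto
  also have "(\<integral>x. s + (f x)\<^sup>2 / s \<partial>M) = s * measure M (space M) + (\<integral>x. (f x)\<^sup>2 \<partial>M) / s"
    using int by simp
  also have "\<dots> \<le> s * (measure M (space M) + a)"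
    using le \<open>0 < s\<close> by (simp add: field_simps power2_eq_square)
  finally show ?thesis by (simp add: ennreal_leI)
qed

text \<open>
  Elements of almost minimal \<open>L\<^sup>2\<close> norm in a decreasing sequence of convex sets form a Cauchy
  sequence by the parallelogram law; this replaces weak compactness together with Mazur's lemma.
\<close>

lemma (in finite_measure) AE_convergent_selection:
  fixes G :: "nat \<Rightarrow> ('a \<Rightarrow> real) set"
  assumes dec: "decseq G" and ne: "\<And>k. G k \<noteq> {}"
    and meas: "\<And>k g. g \<in> G k \<Longrightarrow> g \<in> borel_measurable M"
    and bound: "\<And>k g x. g \<in> G k \<Longrightarrow> \<bar>g x\<bar> \<le> B"
    and mid: "\<And>k g h. g \<in> G k \<Longrightarrow> h \<in> G k \<Longrightarrow> (\<lambda>x. (g x + h x) / 2) \<in> G k"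
  obtains g where "\<And>k. g k \<in> G k" "AE x in M. convergent (\<lambda>k. g k x)"
proof -
  define J where "J g = (\<integral>x. (g x)\<^sup>2 \<partial>M)" for g :: "'a \<Rightarrow> real"
  have sq: "(g x)\<^sup>2 \<le> B\<^sup>2" if "g \<in> G k" for g k x
    using bound[OF that, of x] by (intro power2_le_iff_abs_le[THEN iffD2]) auto
  have int2: "integrable M (\<lambda>x. g x * h x)" if "g \<in> G k" "h \<in> G l" for g h k l
  proof (rule integrable_const_bound[of _ "B * B"])
    show "AE x in M. norm (g x * h x) \<le> B * B"
      using bound[OF that(1)] bound[OF that(2)] order_trans[OF abs_ge_zero bound[OF that(1)]]
      by (intro AE_I2) (auto simp: abs_mult intro!: mult_mono)
  qed (use meas[OF that(1)] meas[OF that(2)] in measurable)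
  have J_nonneg: "0 \<le> J g" for g by (simp add: J_def)
  have J_bound: "J g \<le> B\<^sup>2 * measure M (space M)" if "g \<in> G k" for g k
  proof -
    have "J g \<le> (\<integral>x. B\<^sup>2 \<partial>M)"
      unfolding J_def using int2[OF that that] sq[OF that]
      by (intro integral_mono) (auto simp: power2_eq_square)
    then show ?thesis by (simp add: mult.commute)
  qed
  define m where "m k = (INF g\<in>G k. J g)" for k
  have bdd: "bdd_below (J ` G k)" for k
    using J_nonneg by (auto simp: bdd_below_def)
  have m_le: "m k \<le> J g" if "g \<in> G k" for g k
    unfolding m_def using bdd that by (rule cINF_lower)
  have "incseq m"
    unfolding m_def incseq_def using bdd ne dec
    by (auto intro!: cINF_superset_mono dest: decseqD)
  moreover have "m k \<le> B\<^sup>2 * measure M (space M)" for k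
    using ne[of k] m_le J_bound order_trans by blast
  ultimately obtain m' where m': "m \<longlonglongrightarrow> m'" "\<And>k. m k \<le> m'"
    using incseq_convergent by blast
  \<comment> \<open>Each \<open>g\<close> is taken from a set \<open>G N\<close> so far out that the
    infimum over \<open>G N\<close> is within \<open>(1/4)^k\<close> of the limit \<open>m'\<close>.
    The midpoint of two consecutive choices lies in the larger of the two sets involved, so its norm
    cannot fall below \<open>m' - (1/4)^k\<close>.\<close>
  have "\<exists>g. g \<in> G k \<and> (\<exists>N\<ge>k. g \<in> G N \<and> m' - (1/4) ^ k \<le> m N \<and> J g \<le> m' + (1/4) ^ k)" for k
  proof -
    have "\<forall>\<^sub>F N in sequentially. m' - (1/4) ^ k < m N"
      using m'(1) by (rule order_tendstoD) simp
    then obtain N where N: "N \<ge> k" "m' - (1/4) ^ k < m N"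
      by (metis eventually_sequentially linorder_le_cases order.refl)
    have "(INF g\<in>G N. J g) < m' + (1/4) ^ k"
      using m'(2)[of N] by (simp add: m_def[symmetric] less_le_trans add_strict_increasing2 le_less_trans)
    then obtain g where "g \<in> G N" "J g < m' + (1/4) ^ k"
      using ne bdd by (subst (asm) cINF_less_iff) auto
    then show ?thesis
      using N dec by (intro exI[of _ g] conjI exI[of _ N]) (auto dest: decseqD)
  qed
  then obtain g where g: "\<And>k. g k \<in> G k"
    and gN: "\<And>k. \<exists>N\<ge>k. g k \<in> G N \<and> m' - (1/4) ^ k \<le> m N \<and> J (g k) \<le> m' + (1/4) ^ k"
    by metis
  have diff: "(\<integral>x. (g k x - g (Suc k) x)\<^sup>2 \<partial>M) \<le> 8 * ((1/2) ^ k)\<^sup>2" for k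
  proof -
    obtain N where N: "g k \<in> G N" "m' - (1/4) ^ k \<le> m N" "J (g k) \<le> m' + (1/4) ^ k"
      using gN[of k] by blast
    obtain N' where N': "g (Suc k) \<in> G N'" "m' - (1/4) ^ Suc k \<le> m N'" "J (g (Suc k)) \<le> m' + (1/4) ^ Suc k"
      using gN[of "Suc k"] by blast
    let ?N = "min N N'" and ?h = "\<lambda>x. (g k x + g (Suc k) x) / 2"
    have "g k \<in> G ?N" "g (Suc k) \<in> G ?N"
      using N(1) N'(1) decseqD[OF dec min.cobounded1[of N N']] decseqD[OF dec min.cobounded1[of N' N]]
      by (auto simp: min.commute)
    then have h: "?h \<in> G ?N" by (rule mid)
    have q: "(1/4::real) ^ Suc k = (1/4) ^ k / 4" "(0::real) \<le> (1/4) ^ k" by simp_all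
    then have "m' - (1/4) ^ k \<le> m N'"
      using N'(2) by linarith
    with N(2) have "m' - (1/4) ^ k \<le> m ?N"
      by (simp add: min_def)
    also have "\<dots> \<le> J ?h" using h by (rule m_le)
    finally have *: "m' - (1/4) ^ k \<le> J ?h" .
    have "(\<integral>x. (g k x - g (Suc k) x)\<^sup>2 \<partial>M) = 2 * J (g k) + 2 * J (g (Suc k)) - 4 * J ?h"
    proof -
      have "(\<integral>x. (g k x - g (Suc k) x)\<^sup>2 \<partial>M) =
        (\<integral>x. 2 * (g k x * g k x) + 2 * (g (Suc k) x * g (Suc k) x) - 4 * (?h x * ?h x) \<partial>M)"
        by (intro Bochner_Integration.integral_cong) (auto simp: power2_eq_square field_simps)
      also have "\<dots> = 2 * J (g k) + 2 * J (g (Suc k)) - 4 * J ?h"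
        unfolding J_def power2_eq_square
        by (subst Bochner_Integration.integral_diff Bochner_Integration.integral_add,
          (intro Bochner_Integration.integrable_add integrable_mult_right int2[OF g g] int2[OF h h])+)+
          (simp only: integral_mult_right_zero)
      finally show ?thesis .
    qed
    also have "\<dots> \<le> 2 * (m' + (1/4) ^ k) + 2 * (m' + (1/4) ^ Suc k) - 4 * (m' - (1/4) ^ k)"
      using N(3) N'(3) * by (intro diff_mono add_mono mult_left_mono) auto
    \<comment> \<open>The sum of the three errors is 13/2 times \<open>(1/4)^k\<close>; the square
      root \<open>(1/2)^k\<close> is summable, as the pointwise convergence requires.\<close>
    also have "\<dots> \<le> 8 * (1/4) ^ k" by (simp add: field_simps)
    also have "(1/4::real) ^ k = ((1/2) ^ k)\<^sup>2"
      by (simp add: power_mult[symmetric] mult.commute[of k] power_mult power2_eq_square power_mult_distrib[symmetric])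
    finally show ?thesis .
  qed
  have "AE x in M. convergent (\<lambda>k. g k x)"
  proof (rule AE_convergent_of_summable_differences)
    show "g k \<in> borel_measurable M" for k using g meas by blast
    show "(\<integral>\<^sup>+x. ennreal \<bar>g k x - g (Suc k) x\<bar> \<partial>M) \<le> ennreal ((1/2) ^ k * (measure M (space M) + 8))" for k
    proof (rule L1_le_L2[OF _ _ diff])
      show "(\<lambda>x. g k x - g (Suc k) x) \<in> borel_measurable M"
        using g meas by (intro borel_measurable_diff) blast+
      show "integrable M (\<lambda>x. (g k x - g (Suc k) x)\<^sup>2)"
        using int2[OF g[of k] g[of k]] int2[OF g[of "Suc k"] g[of "Suc k"]] int2[OF g[of k] g[of "Suc k"]]
        by (simp add: power2_eq_square algebra_simps)
    qed simp
    show "summable (\<lambda>k. (1/2) ^ k * (measure M (space M) + 8))"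
      by (intro summable_mult2 summable_geometric) simp
  qed simp
  with g show ?thesis by (rule that)
qed

lemma divergence_linear_combination:
  fixes F G :: "'a::euclidean_space \<Rightarrow> 'a"
  assumes F: "F differentiable (at x)" and G: "G differentiable (at x)"
  shows "(\<lambda>x. a *\<^sub>R F x + b *\<^sub>R G x) differentiable (at x)"
    "frechet_derivative (\<lambda>x. a *\<^sub>R F x + b *\<^sub>R G x) (at x) =
      (\<lambda>u. a *\<^sub>R frechet_derivative F (at x) u + b *\<^sub>R frechet_derivative G (at x) u)"
    "divergence (\<lambda>x. a *\<^sub>R F x + b *\<^sub>R G x) x = a * divergence F x + b * divergence G x"
proof -
  have "((\<lambda>x. a *\<^sub>R F x + b *\<^sub>R G x) has_derivative
      (\<lambda>u. a *\<^sub>R frechet_derivative F (at x) u + b *\<^sub>R frechet_derivative G (at x) u)) (at x)"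
    using F G by (intro has_derivative_add has_derivative_scaleR_right) (simp_all add: frechet_derivative_works)
  then show "(\<lambda>x. a *\<^sub>R F x + b *\<^sub>R G x) differentiable (at x)"
    and fd: "frechet_derivative (\<lambda>x. a *\<^sub>R F x + b *\<^sub>R G x) (at x) =
      (\<lambda>u. a *\<^sub>R frechet_derivative F (at x) u + b *\<^sub>R frechet_derivative G (at x) u)"
    by (auto simp: differentiable_def frechet_derivative_at[symmetric])
  show "divergence (\<lambda>x. a *\<^sub>R F x + b *\<^sub>R G x) x = a * divergence F x + b * divergence G x"
    by (simp add: divergence_def fd inner_add_left sum.distrib sum_distrib_left)
qed

lemma divergence_id:
  "divergence (\<lambda>x::'a::euclidean_space. x) x = DIM('a)"
  by (simp add: divergence_def frechet_derivative_ident flip: id_def)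

text \<open>The conditions are stable under midpoints and become stricter as \<open>e\<close>
  decreases, so the divergences of the approximants with error \<open>1 / (k + 1)\<close> form a
  decreasing sequence of sets closed under midpoints.\<close>

definition smooth_approximant :: "('a::euclidean_space \<Rightarrow> 'a) \<Rightarrow> real \<Rightarrow> ('a \<Rightarrow> 'a) \<Rightarrow> bool" where
  "smooth_approximant P e F \<longleftrightarrow> (\<forall>x. F differentiable (at x)) \<and> firmly_nonexpansive F \<and>
    cyclically_monotone_on UNIV F \<and> (\<forall>x. norm (F x - P x) \<le> e)"

lemma smooth_approximant_midpoint:
  assumes F: "smooth_approximant P e F" and G: "smooth_approximant P e G"
  shows "smooth_approximant P e (\<lambda>x. (1/2) *\<^sub>R F x + (1/2) *\<^sub>R G x)"
  unfolding smooth_approximant_def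
proof (intro conjI allI)
  show "(\<lambda>x. (1/2) *\<^sub>R F x + (1/2) *\<^sub>R G x) differentiable (at x)" for x
    using assms divergence_linear_combination(1) by (auto simp: smooth_approximant_def)
  show "firmly_nonexpansive (\<lambda>x. (1/2) *\<^sub>R F x + (1/2) *\<^sub>R G x)"
    unfolding firmly_nonexpansive_def
  proof (intro allI)
    fix x y
    have "2 *\<^sub>R ((1/2) *\<^sub>R F x + (1/2) *\<^sub>R G x - ((1/2) *\<^sub>R F y + (1/2) *\<^sub>R G y)) - (x - y) =
      (1/2) *\<^sub>R ((2 *\<^sub>R (F x - F y) - (x - y)) + (2 *\<^sub>R (G x - G y) - (x - y)))"
      by (simp add: algebra_simps scaleR_2[symmetric])
    also have "norm \<dots> \<le> (1/2) * (norm (2 *\<^sub>R (F x - F y) - (x - y)) + norm (2 *\<^sub>R (G x - G y) - (x - y)))"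
      using norm_triangle_ineq by simp
    also have "\<dots> \<le> (1/2) * (norm (x - y) + norm (x - y))"
      using assms unfolding smooth_approximant_def firmly_nonexpansive_def
      by (intro mult_left_mono add_mono) auto
    finally show "norm (2 *\<^sub>R ((1/2) *\<^sub>R F x + (1/2) *\<^sub>R G x - ((1/2) *\<^sub>R F y + (1/2) *\<^sub>R G y)) - (x - y)) \<le> norm (x - y)"
      by simp
  qed
  show "cyclically_monotone_on UNIV (\<lambda>x. (1/2) *\<^sub>R F x + (1/2) *\<^sub>R G x)"
    unfolding cyclically_monotone_on_def
  proof (intro allI impI)
    fix x :: "nat \<Rightarrow> 'a" and N assume "x N = x 0"
    then have "(\<Sum>i<N. F (x i) \<bullet> (x (Suc i) - x i)) \<le> 0" "(\<Sum>i<N. G (x i) \<bullet> (x (Suc i) - x i)) \<le> 0"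
      using assms by (auto intro!: cyclically_monotone_onD[of UNIV] simp: smooth_approximant_def)
    then show "(\<Sum>i<N. ((1/2) *\<^sub>R F (x i) + (1/2) *\<^sub>R G (x i)) \<bullet> (x (Suc i) - x i)) \<le> 0"
      by (simp add: inner_add_left sum.distrib flip: sum_divide_distrib)
  qed
  fix x
  have "(1/2) *\<^sub>R F x + (1/2) *\<^sub>R G x - P x = (1/2) *\<^sub>R ((F x - P x) + (G x - P x))"
    by (simp add: algebra_simps scaleR_2[symmetric])
  also have "norm \<dots> \<le> (1/2) * (norm (F x - P x) + norm (G x - P x))"
    using norm_triangle_ineq by simp
  also have "\<dots> \<le> (1/2) * (e + e)"
    using assms unfolding smooth_approximant_def by (intro mult_left_mono add_mono) auto
  finally show "norm ((1/2) *\<^sub>R F x + (1/2) *\<^sub>R G x - P x) \<le> e" by simp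
qed

text \<open>Any sequence of smoothings converges to \<open>P\<close> uniformly, but its divergences
  are only known to be bounded by the dimension. The almost minimal selection on the ball picks
  approximants whose divergences converge almost everywhere there.\<close>

lemma smooth_approximants_with_convergent_divergence:
  fixes P :: "'a::euclidean_space \<Rightarrow> 'a"
  assumes firm: "firmly_nonexpansive P" and cyc: "cyclically_monotone_on UNIV P"
  obtains F and d :: "'a \<Rightarrow> real" where "\<And>k. smooth_approximant P (1 / real (Suc k)) (F k)" "d \<in> borel_measurable borel"
    "\<And>x. 0 \<le> d x" "\<And>x. d x \<le> DIM('a)"
    "AE x in lborel. x \<in> cball 0 R \<longrightarrow> (\<lambda>k. divergence (F k) x) \<longlonglongrightarrow> d x"
proof -
  let ?M = "restrict_space lborel (cball 0 R) :: 'a measure"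
  have space: "cball 0 R \<inter> space lborel \<in> sets (lborel :: 'a measure)" by simp
  interpret finite_measure ?M
    using emeasure_lborel_cball_finite[of "0::'a" R]
    by (intro finite_measureI) (simp add: emeasure_restrict_space space_restrict_space)
  define G where "G k = divergence ` {F. smooth_approximant P (1 / real (Suc k)) F}" for k
  have bounds: "0 \<le> divergence F x" "divergence F x \<le> DIM('a)" if "smooth_approximant P e F" for F e x
    using divergence_bounds[of F x] that by (simp_all add: smooth_approximant_def)
  obtain g where g: "\<And>k. g k \<in> G k" and conv: "AE x in ?M. convergent (\<lambda>k. g k x)"
  proof (rule AE_convergent_selection[of G "real DIM('a)"])
    have mono: "smooth_approximant P e' F" if "smooth_approximant P e F" "e \<le> e'" for F e e'
      using that(1) by (auto simp: smooth_approximant_def intro: order_trans[OF _ that(2)])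
    have "1 / real (Suc n) \<le> 1 / real (Suc m)" if "m \<le> n" for m n
      using that by (simp add: field_simps)
    then have "G n \<subseteq> G m" if "m \<le> n" for m n
      unfolding G_def using mono that by blast
    then show "decseq G" unfolding decseq_def by simp
    show "G k \<noteq> {}" for k
    proof -
      obtain F where "\<And>x. F differentiable (at x)" "firmly_nonexpansive F" "cyclically_monotone_on UNIV F"
        "\<And>x. norm (F x - P x) \<le> 1 / real (Suc k)"
        using firmly_nonexpansive_smoothing[OF firm cyc, of "1 / real (Suc k)"] by auto
      then have "smooth_approximant P (1 / real (Suc k)) F" by (simp add: smooth_approximant_def)
      then show ?thesis by (auto simp: G_def)
    qed
    show "h \<in> borel_measurable ?M" if "h \<in> G k" for k h
      using that borel_measurable_divergence
      by (intro measurable_restrict_space1) (auto simp: G_def smooth_approximant_def)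
    show "\<bar>h x\<bar> \<le> DIM('a)" if "h \<in> G k" for k h x
      using that bounds by (auto simp: G_def)
    show "(\<lambda>x. (h x + h' x) / 2) \<in> G k" if "h \<in> G k" "h' \<in> G k" for k h h'
    proof -
      obtain F F' where F: "smooth_approximant P (1 / real (Suc k)) F" "h = divergence F"
        and F': "smooth_approximant P (1 / real (Suc k)) F'" "h' = divergence F'"
        using \<open>h \<in> G k\<close> \<open>h' \<in> G k\<close> by (auto simp: G_def)
      have "(\<lambda>x. (h x + h' x) / 2) = divergence (\<lambda>x. (1/2) *\<^sub>R F x + (1/2) *\<^sub>R F' x)"
        using F F' by (auto simp: divergence_linear_combination(3) smooth_approximant_def add_divide_distrib)
      then show ?thesis
        using smooth_approximant_midpoint[OF F(1) F'(1)] by (auto simp: G_def)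
    qed
  qed blast
  have "\<exists>F. smooth_approximant P (1 / real (Suc k)) F \<and> g k = divergence F" for k
    using g[of k] unfolding G_def by blast
  then obtain F where F: "\<And>k. smooth_approximant P (1 / real (Suc k)) (F k)" and gF: "\<And>k. g k = divergence (F k)"
    by metis
  \<comment> \<open>Clamping to \<open>[0, DIM('a)]\<close> gives the bounds everywhere, including
    the points where \<open>lim\<close> is a default value; where the limit exists it lies in this
    interval and is unchanged.\<close>
  define d where "d x = max 0 (min (DIM('a)) (lim (\<lambda>k. divergence (F k) x)))" for x
  show ?thesis
  proof (rule that[of F d])
    have [measurable]: "divergence (F k) \<in> borel_measurable borel" for k
      using F by (intro borel_measurable_divergence) (auto simp: smooth_approximant_def)
    show "d \<in> borel_measurable borel"
      unfolding d_def by measurable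
    have "AE x in lborel. x \<in> cball 0 R \<longrightarrow> convergent (\<lambda>k. divergence (F k) x)"
      using conv unfolding AE_restrict_space_iff[OF space] gF by simp
    then show "AE x in lborel. x \<in> cball 0 R \<longrightarrow> (\<lambda>k. divergence (F k) x) \<longlonglongrightarrow> d x"
    proof (rule AE_mp, intro AE_I2 impI)
      fix x assume "x \<in> cball 0 R \<longrightarrow> convergent (\<lambda>k. divergence (F k) x)" "x \<in> cball 0 R"
      then have lim: "(\<lambda>k. divergence (F k) x) \<longlonglongrightarrow> lim (\<lambda>k. divergence (F k) x)"
        by (simp add: convergent_LIMSEQ_iff)
      then have "0 \<le> lim (\<lambda>k. divergence (F k) x)" "lim (\<lambda>k. divergence (F k) x) \<le> DIM('a)"
        using bounds[OF F] by (auto intro: LIMSEQ_le_const LIMSEQ_le_const2)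
      with lim show "(\<lambda>k. divergence (F k) x) \<longlonglongrightarrow> d x" by (simp add: d_def)
    qed
  qed (use F in \<open>auto simp: d_def\<close>)
qed

section \<open>Almost every value of a firmly nonexpansive map has one preimage\<close>

text \<open>For a bounded piece of \<open>A\<close>, the translates by the multiples
  \<open>1 / (k + 1)\<close> of \<open>v\<close> are pairwise disjoint, have equal measure and lie
  in one ball. Infinitely many of them fit only if the measure is zero.\<close>

lemma null_sets_if_lines_meet_once:
  fixes A :: "'a::euclidean_space set"
  assumes [measurable]: "A \<in> sets borel" and once: "\<And>z s. z \<in> A \<Longrightarrow> 0 < s \<Longrightarrow> z + s *\<^sub>R v \<notin> A"
  shows "A \<in> null_sets lborel"
proof -
  have "A \<inter> cball 0 (real m) \<in> null_sets lborel" for m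
  proof -
    let ?A = "A \<inter> cball 0 (real m)"
    define c where "c k = (- (1 / real (Suc k))) *\<^sub>R v" for k
    define D where "D k = (+) (c k) -` ?A" for k
    have [measurable]: "D k \<in> sets borel" for k
    proof -
      have "(+) (c k) \<in> borel_measurable borel" by measurable
      from measurable_sets[OF this, of ?A] show ?thesis by (simp add: D_def)
    qed
    have eq: "emeasure lborel (D k) = emeasure lborel ?A" for k
    proof -
      have "emeasure lborel ?A = emeasure (distr lborel borel ((+) (c k))) ?A"
        by (simp only: lborel_distr_plus)
      also have "\<dots> = emeasure lborel (D k)"
        by (subst emeasure_distr) (simp_all add: D_def)
      finally show ?thesis by simp
    qed
    have "disjoint_family D"
    proof -
      have "D k \<inter> D l = {}" if "k < l" for k l
      proof (rule ccontr)
        assume "D k \<inter> D l \<noteq> {}"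
        then obtain z where z: "c k + z \<in> A" "c l + z \<in> A"
          by (auto simp: D_def)
        have pos: "0 < 1 / real (Suc k) - 1 / real (Suc l)"
          using that by (simp add: frac_less2)
        have "(c k + z) + (1 / real (Suc k) - 1 / real (Suc l)) *\<^sub>R v = c l + z"
          by (simp add: c_def scaleR_diff_left del: of_nat_Suc)
        with once[OF z(1) pos] z(2) show False by metis
      qed
      then show ?thesis unfolding disjoint_family_on_def by (metis Int_commute nat_neq_iff)
    qed
    then have "(\<Sum>k. emeasure lborel (D k)) = emeasure lborel (\<Union>k. D k)"
      by (intro suminf_emeasure) auto
    also have "\<dots> \<le> emeasure lborel (cball (0::'a) (real m + norm v))"
    proof (intro emeasure_mono)
      show "(\<Union>k. D k) \<subseteq> cball 0 (real m + norm v)"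
      proof (intro UN_least subsetI)
        fix k z assume "z \<in> D k"
        then have "norm (c k + z) \<le> real m" by (simp add: D_def)
        moreover have "norm (c k) \<le> norm v"
          by (simp add: c_def field_simps mult_left_le)
        ultimately show "z \<in> cball 0 (real m + norm v)"
          using norm_triangle_sub[of z "- c k"] by (simp add: add.commute)
      qed
    qed simp
    also have "\<dots> < \<infinity>" by (rule emeasure_lborel_cball_finite)
    finally have fin: "(\<Sum>k::nat. emeasure lborel ?A) \<noteq> \<infinity>" by (simp add: eq)
    have "emeasure lborel ?A < \<infinity>"
      by (rule le_less_trans[OF emeasure_mono emeasure_lborel_cball_finite[of 0 m]]) auto
    then obtain r where r: "emeasure lborel ?A = ennreal r" "0 \<le> r"
      by (metis ennreal_cases infinity_ennreal_def less_irrefl)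
    have "summable (\<lambda>_::nat. r)"
      using fin r by (intro summable_suminf_not_top) auto
    then have "r = 0" by (simp add: summable_const_iff)
    with r show ?thesis by (auto intro: null_setsI)
  qed
  then have "(\<Union>m. A \<inter> cball 0 (real m)) \<in> null_sets lborel" by (rule null_sets_UN)
  moreover have "(\<Union>m. A \<inter> cball 0 (real m)) = A"
    using real_arch_simple by auto
  ultimately show ?thesis by simp
qed

lemma borel_continuous_image_closed:
  fixes F :: "'a::euclidean_space \<Rightarrow> 'b::euclidean_space"
  assumes "continuous_on UNIV F" "closed S"
  shows "F ` S \<in> sets borel"
proof -
  have "S = (\<Union>m. S \<inter> cball 0 (real m))"
    using real_arch_simple by auto
  then have "F ` S = (\<Union>m. F ` (S \<inter> cball 0 (real m)))"
    by (metis image_UN)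
  moreover have "F ` (S \<inter> cball 0 (real m)) \<in> sets borel" for m
    using assms by (intro borel_compact compact_continuous_image closed_Int_compact) (auto intro: continuous_on_subset)
  ultimately show ?thesis by (metis (lifting) countableI_type sets.countable_UN'')
qed

text \<open>
  If \<open>z\<close> has two preimages that differ in the direction \<open>b\<close>, then by monotonicity the
  \<open>b\<close>-coordinate of the preimages of \<open>z + s b\<close> jumps across a fixed rational interval at \<open>s = 0\<close>,
  which it can do only once on each line.
\<close>

lemma firmly_nonexpansive_AE_injective:
  fixes F :: "'a::euclidean_space \<Rightarrow> 'a"
  assumes firm: "firmly_nonexpansive F"
  obtains N where "N \<in> null_sets lborel" "\<And>y y'. F y = F y' \<Longrightarrow> F y \<notin> N \<Longrightarrow> y = y'"
proof -
  define A where "A b c d = F ` {y. y \<bullet> b \<le> c} \<inter> F ` {y. d \<le> y \<bullet> b}" for b c d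
  let ?I = "{(b::'a, c, d). b \<in> Basis \<and> c \<in> \<rat> \<and> d \<in> \<rat> \<and> c < (d::real)}"
  define N where "N = (\<Union>(b, c, d)\<in>?I. A b c d)"
  have "A b c d \<in> null_sets lborel" if "c < d" "b \<in> Basis" for b c d
  proof (rule null_sets_if_lines_meet_once[where v = b])
    have "closed {y. y \<bullet> b \<le> c}" "closed {y. d \<le> y \<bullet> b}"
      by (auto intro!: closed_Collect_le continuous_intros)
    then show "A b c d \<in> sets borel"
      unfolding A_def using firmly_nonexpansive_continuous[OF firm]
      by (intro sets.Int borel_continuous_image_closed)
    fix z s assume "z \<in> A b c d" and s: "0 < (s::real)"
    show "z + s *\<^sub>R b \<notin> A b c d"
    proof
      assume "z + s *\<^sub>R b \<in> A b c d"
      then obtain p' where p': "z + s *\<^sub>R b = F p'" "p' \<bullet> b \<le> c" by (auto simp: A_def)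
      obtain p where p: "z = F p" "d \<le> p \<bullet> b" using \<open>z \<in> A b c d\<close> by (auto simp: A_def)
      \<comment> \<open>The difference of the values is a positive multiple of \<open>b\<close>, so
        \<open>p' \<bullet> b\<close> is at least \<open>p \<bullet> b\<close>, hence at least
        \<open>d\<close>, although it is at most \<open>c < d\<close>.\<close>
      have "0 \<le> (F p' - F p) \<bullet> (p' - p)" by (rule firmly_nonexpansive_monotone[OF firm])
      also have "F p' - F p = s *\<^sub>R b" by (simp only: p'(1)[symmetric] p(1)[symmetric]) simp
      finally have "0 \<le> b \<bullet> (p' - p)" using s by (simp add: zero_le_mult_iff)
      then show False using p p' that by (simp add: inner_diff_right inner_commute)
    qed
  qed
  moreover have "countable ?I"
  proof (rule countable_subset)
    show "?I \<subseteq> Basis \<times> \<rat> \<times> \<rat>" by auto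
    show "countable ((Basis :: 'a set) \<times> (\<rat> :: real set) \<times> (\<rat> :: real set))"
      by (intro countable_SIGMA countable_finite countable_rat) auto
  qed
  ultimately have N: "N \<in> null_sets lborel"
    unfolding N_def case_prod_unfold by (intro null_sets_UN') auto
  have "y = y'" if "F y = F y'" "F y \<notin> N" for y y'
  proof (rule ccontr)
    have sep: False if eq: "F y = F y'" and notin: "F y \<notin> N" and less: "y \<bullet> b < y' \<bullet> b" and b: "b \<in> Basis" for y y' b
    proof -
      obtain c where c: "c \<in> \<rat>" "y \<bullet> b < c" "c < y' \<bullet> b"
        using Rats_dense_in_real[OF less] by blast
      obtain d where d: "d \<in> \<rat>" "c < d" "d < y' \<bullet> b"
        using Rats_dense_in_real[OF c(3)] by blast
      have "F y \<in> F ` {y. y \<bullet> b \<le> c}"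
        by (rule imageI) (use c in simp)
      moreover have "F y' \<in> F ` {y. d \<le> y \<bullet> b}"
        by (rule imageI) (use d in simp)
      ultimately have "F y \<in> A b c d"
        using eq by (simp only: A_def Int_iff)
      moreover have "(b, c, d) \<in> ?I" using c d b by simp
      ultimately have "F y \<in> N" unfolding N_def by blast
      then show False using notin by simp
    qed
    assume "y \<noteq> y'"
    then obtain b where "b \<in> Basis" "y \<bullet> b \<noteq> y' \<bullet> b" using euclidean_eqI by blast
    then show False using sep[of y y' b] sep[of y' y b] that by (cases "y \<bullet> b < y' \<bullet> b") auto
  qed
  with N show ?thesis by (rule that)
qed

text \<open>With \<open>F = (id + N) / 2\<close> and \<open>N\<close> nonexpansive, the equation is a fixed point problem for a contraction.\<close>

lemma firmly_nonexpansive_plus_scaled_id_surj: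
  fixes F :: "'a::euclidean_space \<Rightarrow> 'a"
  assumes firm: "firmly_nonexpansive F" and "0 < s"
  shows "\<exists>y. F y + s *\<^sub>R y = z"
proof -
  \<comment> \<open>With \<open>F = (id + N) / 2\<close> the equation reads
    \<open>(1/2 + s) y = z - N y / 2\<close>; dividing by \<open>1/2 + s\<close> leaves the
    contraction factor \<open>c / 2 < 1\<close>.\<close>
  define c where "c = 1 / (1/2 + s)"
  have c: "0 < c" "c * (1/2) < 1" "c * (1/2 + s) = 1" using \<open>0 < s\<close> by (auto simp: c_def field_simps)
  define f where "f y = c *\<^sub>R (z - F y + (1/2) *\<^sub>R y)" for y
  have "\<exists>!y. f y = y"
  proof (rule banach_fix_type[of "c * (1/2)"])
    show "\<forall>x y. dist (f x) (f y) \<le> c * (1/2) * dist x y"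
    proof (intro allI)
      fix x y
      have "f x - f y = (- c * (1/2)) *\<^sub>R (2 *\<^sub>R (F x - F y) - (x - y))"
        by (simp add: f_def algebra_simps)
      also have "norm \<dots> \<le> c * (1/2) * norm (x - y)"
        using firm c(1) by (auto simp: firmly_nonexpansive_def intro!: mult_left_mono)
      finally show "dist (f x) (f y) \<le> c * (1/2) * dist x y" by (simp add: dist_norm)
    qed
  qed (use c in auto)
  then obtain y where "f y = y" by blast
  then have "(1/2 + s) *\<^sub>R y = (1/2 + s) *\<^sub>R f y" by simp
  also have "\<dots> = (c * (1/2 + s)) *\<^sub>R (z - F y + (1/2) *\<^sub>R y)"
    by (simp add: f_def mult.commute)
  finally have "(1/2 + s) *\<^sub>R y = z - F y + (1/2) *\<^sub>R y" by (simp add: c)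
  then show ?thesis by (intro exI[of _ y]) (simp add: algebra_simps)
qed

section \<open>Volume bounds for firmly nonexpansive maps\<close>

text \<open>A perturbation \<open>W\<close> of \<open>H\<close> that is monotone and onto still
  takes the value \<open>H y0\<close>; the question is where. On the sphere around \<open>y0\<close>
  the displacement \<open>H y - H y0\<close> has a definite outward component, and so has
  \<open>W y - H y0\<close> once the perturbation is small. By monotonicity along rays no solution
  can then lie outside the ball.\<close>

lemma firmly_nonexpansive_local_surj:
  fixes H :: "'a::euclidean_space \<Rightarrow> 'a"
  assumes firm: "firmly_nonexpansive H" "\<And>k. firmly_nonexpansive (F k)"
    and close: "\<And>k x. norm (F k x - H x) \<le> 1 / real (Suc k)"
    and unique: "\<And>y. H y = H y0 \<Longrightarrow> y = y0" and r: "0 < r"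
  shows "\<forall>\<^sub>F k in sequentially. \<exists>y\<in>cball y0 r. F k y + (1 / real (Suc k)) *\<^sub>R y = H y0"
proof -
  let ?S = "sphere y0 r"
  have "?S \<noteq> {}" using r by simp
  moreover have "continuous_on ?S (\<lambda>y. (norm (H y - H y0))\<^sup>2)"
    by (intro continuous_intros firmly_nonexpansive_continuous[OF firm(1)])
  ultimately obtain y1 where y1: "y1 \<in> ?S" "\<And>y. y \<in> ?S \<Longrightarrow> (norm (H y1 - H y0))\<^sup>2 \<le> (norm (H y - H y0))\<^sup>2"
    using continuous_attains_inf[OF compact_sphere] by blast
  \<comment> \<open>By uniqueness of the preimage \<open>H\<close> differs from \<open>H y0\<close>
    on the whole sphere, so compactness makes the minimum positive. Firm nonexpansiveness turns it
    into a lower bound for the outward component.\<close>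
  define c where "c = (norm (H y1 - H y0))\<^sup>2"
  have "y1 \<noteq> y0" using y1(1) r by auto
  then have "0 < c" using unique[of y1] by (auto simp: c_def)
  have "(\<lambda>k. (1 / real (Suc k)) * ((1 + norm y0 + r) * r)) \<longlonglongrightarrow> 0 * ((1 + norm y0 + r) * r)"
    using LIMSEQ_inverse_real_of_nat by (intro tendsto_mult tendsto_const) (simp add: inverse_eq_divide)
  then have "\<forall>\<^sub>F k in sequentially. (1 / real (Suc k)) * ((1 + norm y0 + r) * r) < c"
    using \<open>0 < c\<close> by (intro order_tendstoD(2)) auto
  then show ?thesis
  proof (rule eventually_mono)
    fix k assume small: "(1 / real (Suc k)) * ((1 + norm y0 + r) * r) < c"
    define s where "s = 1 / real (Suc k)"
    have "0 < s" by (simp add: s_def)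
    note small = small[folded s_def] and close_s = close[of k, folded s_def]
    define W where "W y = F k y + s *\<^sub>R y" for y
    have W_mono: "0 \<le> (W y - W y') \<bullet> (y - y')" for y y'
    proof -
      have "(W y - W y') \<bullet> (y - y') = (F k y - F k y') \<bullet> (y - y') + s * ((y - y') \<bullet> (y - y'))"
        by (simp add: W_def inner_diff_left inner_diff_right inner_add_left inner_add_right algebra_simps)
      then show ?thesis
        using firmly_nonexpansive_monotone[OF firm(2)[of k], of y y'] \<open>0 < s\<close> by simp
    qed
    have sphere: "0 < (W y - H y0) \<bullet> (y - y0)" if "y \<in> ?S" for y
    proof -
      have "c \<le> (norm (H y - H y0))\<^sup>2" using y1(2)[OF that] by (simp add: c_def)
      also have "\<dots> \<le> (H y - H y0) \<bullet> (y - y0)"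
        using firm(1) by (simp add: firmly_nonexpansive_iff)
      finally have 1: "c \<le> (H y - H y0) \<bullet> (y - y0)" .
      have n: "norm (y - y0) = r" using that by (simp add: dist_norm norm_minus_commute)
      have "norm (W y - H y) \<le> norm (F k y - H y) + norm (s *\<^sub>R y)"
        using norm_triangle_ineq[of "F k y - H y" "s *\<^sub>R y"] by (simp add: W_def add_diff_eq diff_add_eq)
      also have "\<dots> \<le> s + s * (norm y0 + r)"
        using close_s[of y] n norm_triangle_sub[of y y0] \<open>0 < s\<close> by (intro add_mono) simp_all
      finally have "norm (W y - H y) \<le> s * (1 + norm y0 + r)"
        by (simp add: algebra_simps)
      then have "norm (W y - H y) * r \<le> s * ((1 + norm y0 + r) * r)"
        using mult_right_mono[of "norm (W y - H y)" _ r] r by (simp add: mult.assoc)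
      moreover have "- (norm (W y - H y) * r) \<le> (W y - H y) \<bullet> (y - y0)"
        using Cauchy_Schwarz_ineq2[of "W y - H y" "y - y0", unfolded n] by linarith
      moreover have "(W y - H y0) \<bullet> (y - y0) = (W y - H y) \<bullet> (y - y0) + (H y - H y0) \<bullet> (y - y0)"
        by (simp add: inner_diff_left)
      ultimately show ?thesis using 1 small by linarith
    qed
    obtain y where y: "W y = H y0"
      using firmly_nonexpansive_plus_scaled_id_surj[OF firm(2) \<open>0 < s\<close>] unfolding W_def by blast
    have "norm (y - y0) \<le> r"
    proof (rule ccontr)
      assume "\<not> norm (y - y0) \<le> r"
      then have R: "r < norm (y - y0)" by simp
      \<comment> \<open>The point at parameter \<open>l\<close> on the segment from
        \<open>y0\<close> to \<open>y\<close> lies on the sphere.\<close>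
      define l where "l = r / norm (y - y0)"
      have R0: "0 < norm (y - y0)" using R r by linarith
      have l: "0 < l" "l < 1" unfolding l_def using R r R0 by (simp_all only: divide_pos_pos divide_less_eq_1_pos)
      define y' where "y' = y0 + l *\<^sub>R (y - y0)"
      have d: "y' - y0 = l *\<^sub>R (y - y0)" "y - y' = (1 - l) *\<^sub>R (y - y0)"
        by (auto simp: y'_def algebra_simps)
      have "norm (y' - y0) = r" using l R0 r by (simp add: d l_def)
      then have "0 < (W y' - H y0) \<bullet> (y' - y0)"
        by (intro sphere) (simp add: dist_norm norm_minus_commute)
      then have "0 < (W y' - W y) \<bullet> (y - y0)" using l by (simp add: d y zero_less_mult_iff)
      moreover have "0 \<le> (W y - W y') \<bullet> (y - y0)"
        using W_mono[of y y'] l by (simp add: d zero_le_mult_iff)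
      ultimately show False by (simp add: inner_diff_left)
    qed
    then show "\<exists>y\<in>cball y0 r. F k y + (1 / real (Suc k)) *\<^sub>R y = H y0"
      using y by (intro bexI[of _ y]) (auto simp: W_def s_def dist_norm norm_minus_commute)
  qed
qed

lemma compact_neighborhood:
  fixes K :: "'a::euclidean_space set"
  assumes "compact K"
  shows "compact {x + y |x y. x \<in> K \<and> y \<in> cball 0 r}"
  by (rule compact_sums[OF assms compact_cball])

text \<open>The maps \<open>W k\<close> are smooth and onto. A value of \<open>H\<close> on
  \<open>K\<close> with a single preimage is eventually attained by \<open>W k\<close> on the
  neighbourhood \<open>K'\<close>, so Fatou's lemma for indicators bounds the volume of
  \<open>H\<close> K\<open>by the volumes of\<close>W k \<open>K'\<close>. These are controlled by
  the divergences, which converge boundedly on \<open>K'\<close>.\<close>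

lemma volume_image_le_divergence_neighborhood:
  fixes H :: "real^'n::finite \<Rightarrow> real^'n"
  assumes firm: "firmly_nonexpansive H" "\<And>k. firmly_nonexpansive (F k)"
    and close: "\<And>k x. norm (F k x - H x) \<le> 1 / real (Suc k)"
    and diff: "\<And>k x. F k differentiable (at x)"
    and sym: "\<And>k x u v. frechet_derivative (F k) (at x) u \<bullet> v = u \<bullet> frechet_derivative (F k) (at x) v"
    and [measurable]: "d \<in> borel_measurable borel"
    and conv: "AE x in lborel. x \<in> K' \<longrightarrow> (\<lambda>k. divergence (F k) x) \<longlonglongrightarrow> d x"
    and K: "compact K" and r: "0 < r" and K': "K' = {x + y |x y. x \<in> K \<and> y \<in> cball 0 r}"
  shows "emeasure lborel (H ` K) \<le> (\<integral>\<^sup>+x\<in>K'. ennreal ((d x / CARD('n)) ^ CARD('n)) \<partial>lborel)"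
proof -
  let ?n = "CARD('n)"
  \<comment> \<open>The factor 1 brings \<open>W k\<close> into the shape of a linear combination of
    two maps, from which its derivative and divergence are read off.\<close>
  define W where "W k y = 1 *\<^sub>R F k y + (1 / real (Suc k)) *\<^sub>R y" for k y
  have compK': "compact K'" unfolding K' by (rule compact_neighborhood[OF K])
  have [measurable]: "K' \<in> sets borel" using compK' by (rule borel_compact)
  have diffW: "W k differentiable (at x)" for k x
    unfolding W_def by (intro divergence_linear_combination(1) diff) simp
  have fdW: "frechet_derivative (W k) (at x) = (\<lambda>u. frechet_derivative (F k) (at x) u + (1 / real (Suc k)) *\<^sub>R u)" for k x
    unfolding W_def by (subst divergence_linear_combination(2)[OF diff]) (auto simp: frechet_derivative_ident)
  have divW: "divergence (W k) x = divergence (F k) x + ?n / real (Suc k)" for k x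
    unfolding W_def by (subst divergence_linear_combination(3)[OF diff]) (auto simp: divergence_id)
  have bounds: "0 \<le> divergence (F k) x" "divergence (F k) x \<le> ?n" for k x
    using divergence_bounds[OF firm(2) diff] by auto
  have [measurable]: "divergence (F k) \<in> borel_measurable borel" for k
    by (rule borel_measurable_divergence[OF diff])
  have contW: "continuous_on S (W k)" for S k
    unfolding W_def by (intro continuous_intros firmly_nonexpansive_continuous[OF firm(2)])
  have compW: "compact (W k ` K')" for k
    by (intro compact_continuous_image contW compK')
  have imageW: "emeasure lborel (W k ` K') \<le> (\<integral>\<^sup>+x\<in>K'. ennreal ((divergence (F k) x / ?n + 1 / real (Suc k)) ^ ?n) \<partial>lborel)" for k
  proof -
    have "emeasure lborel (W k ` K') \<le> (\<integral>\<^sup>+x\<in>K'. ennreal ((divergence (W k) x / ?n) ^ ?n) \<partial>lborel)"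
    proof (rule emeasure_image_le_divergence[OF compK' diffW])
      show "frechet_derivative (W k) (at x) u \<bullet> v = u \<bullet> frechet_derivative (W k) (at x) v" for x u v
        using sym[of k x u v] by (simp add: fdW inner_add_left inner_add_right)
      show "0 \<le> u \<bullet> frechet_derivative (W k) (at x) u" for x u
        using firmly_nonexpansive_frechet_derivative[OF firm(2) diff, of k x u]
          order_trans[OF zero_le_power2[of "norm (frechet_derivative (F k) (at x) u)"]]
        by (simp add: fdW inner_add_right inner_commute)
      show "divergence (W k) x \<le> ?n + ?n" for x
        using bounds(2)[of k x] mult_left_mono[of 1 "real (Suc k)" "real ?n"] unfolding divW of_nat_add
        by (intro add_mono) (simp_all add: divide_le_eq del: of_nat_Suc)
    qed
    moreover have "divergence (W k) x / ?n = divergence (F k) x / ?n + 1 / real (Suc k)" for x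
      by (simp add: divW add_divide_distrib)
    ultimately show ?thesis by (simp only:)
  qed
  obtain N where N: "N \<in> null_sets lborel" "\<And>y y'. H y = H y' \<Longrightarrow> H y \<notin> N \<Longrightarrow> y = y'"
    by (rule firmly_nonexpansive_AE_injective[OF firm(1)]) blast
  have compH: "compact (H ` K)"
    by (intro compact_continuous_image firmly_nonexpansive_continuous[OF firm(1)] K)
  then have [measurable]: "H ` K \<in> sets borel" by (rule borel_compact)
  have [measurable]: "W k ` K' \<in> sets borel" for k using compW by (rule borel_compact)
  have [measurable]: "N \<in> sets borel" using N(1) by auto
  have "emeasure lborel (H ` K) = emeasure lborel (H ` K - N)"
    using N(1) by (simp add: emeasure_Diff_null_set)
  also have "\<dots> = (\<integral>\<^sup>+z. indicator (H ` K - N) z \<partial>lborel)"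
    by (simp add: nn_integral_indicator)
  \<comment> \<open>Fatou's lemma is prepared here: outside \<open>N\<close> the indicators on the
    right are eventually 1.\<close>
  also have "\<dots> \<le> (\<integral>\<^sup>+z. liminf (\<lambda>k. indicator (W k ` K') z) \<partial>lborel)"
  proof (rule nn_integral_mono)
    fix z :: "real^'n"
    show "indicator (H ` K - N) z \<le> liminf (\<lambda>k. indicator (W k ` K') z :: ennreal)"
    proof (cases "z \<in> H ` K - N")
      case True
      then obtain y0 where y0: "y0 \<in> K" "z = H y0" "H y0 \<notin> N" by auto
      have "\<forall>\<^sub>F k in sequentially. \<exists>y\<in>cball y0 r. F k y + (1 / real (Suc k)) *\<^sub>R y = H y0"
        using N(2) y0(3) by (intro firmly_nonexpansive_local_surj[OF firm close _ r]) metis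
      then have "\<forall>\<^sub>F k in sequentially. 1 \<le> (indicator (W k ` K') z :: ennreal)"
      proof (rule eventually_mono)
        fix k assume "\<exists>y\<in>cball y0 r. F k y + (1 / real (Suc k)) *\<^sub>R y = H y0"
        then obtain y where y: "y \<in> cball y0 r" "W k y = z" by (auto simp: W_def y0)
        have "y = y0 + (y - y0)" "y - y0 \<in> cball 0 r" using y(1) by (auto simp: dist_norm norm_minus_commute)
        then have "y \<in> K'" unfolding K' using y0(1) by blast
        with y(2) show "1 \<le> (indicator (W k ` K') z :: ennreal)" by (auto simp: indicator_def)
      qed
      then have "1 \<le> liminf (\<lambda>k. indicator (W k ` K') z :: ennreal)"
        by (rule Liminf_bounded)
      with True show ?thesis by simp
    qed simp
  qed
  also have "\<dots> \<le> liminf (\<lambda>k. \<integral>\<^sup>+z. indicator (W k ` K') z \<partial>lborel)"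
    by (rule nn_integral_liminf) measurable
  also have "\<dots> \<le> liminf (\<lambda>k. \<integral>\<^sup>+x\<in>K'. ennreal ((divergence (F k) x / ?n + 1 / real (Suc k)) ^ ?n) \<partial>lborel)"
    using imageW by (intro Liminf_mono always_eventually allI) (simp add: nn_integral_indicator)
  also have "\<dots> = (\<integral>\<^sup>+x\<in>K'. ennreal ((d x / ?n) ^ ?n) \<partial>lborel)"
  proof (rule lim_imp_Liminf)
    show "(\<lambda>k. \<integral>\<^sup>+x\<in>K'. ennreal ((divergence (F k) x / ?n + 1 / real (Suc k)) ^ ?n) \<partial>lborel)
      \<longlonglongrightarrow> (\<integral>\<^sup>+x\<in>K'. ennreal ((d x / ?n) ^ ?n) \<partial>lborel)"
    proof (rule nn_integral_dominated_convergence[where w = "\<lambda>x. ennreal (2 ^ ?n) * indicator K' x"])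
      show "AE x in lborel. ennreal ((divergence (F k) x / ?n + 1 / real (Suc k)) ^ ?n) * indicator K' x
        \<le> ennreal (2 ^ ?n) * indicator K' x" for k
      proof (intro AE_I2 mult_right_mono ennreal_leI power_mono)
        fix x
        have "divergence (F k) x / ?n \<le> 1" "0 \<le> divergence (F k) x / ?n" "1 / real (Suc k) \<le> 1" "0 \<le> 1 / real (Suc k)"
          using bounds[of k x] by (auto simp: divide_le_eq)
        then show "divergence (F k) x / ?n + 1 / real (Suc k) \<le> 2" "0 \<le> divergence (F k) x / ?n + 1 / real (Suc k)"
          by linarith+
      qed simp
      have "emeasure lborel K' < \<infinity>"
        using compK' by (intro emeasure_bounded_finite compact_imp_bounded)
      then show "(\<integral>\<^sup>+x. ennreal (2 ^ ?n) * indicator K' x \<partial>lborel) < \<infinity>"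
        by (simp add: nn_integral_cmult_indicator ennreal_mult_less_top)
      show "AE x in lborel. (\<lambda>k. ennreal ((divergence (F k) x / ?n + 1 / real (Suc k)) ^ ?n) * indicator K' x)
        \<longlonglongrightarrow> ennreal ((d x / ?n) ^ ?n) * indicator K' x"
        using conv
      proof (rule AE_mp, intro AE_I2 impI)
        fix x assume x: "x \<in> K' \<longrightarrow> (\<lambda>k. divergence (F k) x) \<longlonglongrightarrow> d x"
        show "(\<lambda>k. ennreal ((divergence (F k) x / ?n + 1 / real (Suc k)) ^ ?n) * indicator K' x)
          \<longlonglongrightarrow> ennreal ((d x / ?n) ^ ?n) * indicator K' x"
        proof (cases "x \<in> K'")
          case True
          have "(\<lambda>k. (divergence (F k) x / ?n + 1 / real (Suc k)) ^ ?n) \<longlonglongrightarrow> (d x / ?n + 0) ^ ?n"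
            using x True LIMSEQ_inverse_real_of_nat
            by (intro tendsto_power tendsto_add tendsto_divide tendsto_const) (auto simp: inverse_eq_divide)
          then show ?thesis using True by (auto intro!: tendsto_ennrealI simp del: of_nat_Suc)
        qed simp
      qed
    qed measurable
  qed simp
  finally show ?thesis .
qed

text \<open>The neighbourhoods of radius \<open>1 / (m + 1)\<close> shrink to \<open>K\<close>
  because \<open>K\<close> is closed. The margin 1 between \<open>K\<close> and the sphere of radius
  \<open>R\<close> keeps them in the ball where the divergences are known to converge.\<close>

lemma volume_image_le_divergence:
  fixes H :: "real^'n::finite \<Rightarrow> real^'n" and d :: "real^'n \<Rightarrow> real"
  assumes firm: "firmly_nonexpansive H" "\<And>k. firmly_nonexpansive (F k)"
    and close: "\<And>k x. norm (F k x - H x) \<le> 1 / real (Suc k)"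
    and diff: "\<And>k x. F k differentiable (at x)"
    and sym: "\<And>k x u v. frechet_derivative (F k) (at x) u \<bullet> v = u \<bullet> frechet_derivative (F k) (at x) v"
    and [measurable]: "d \<in> borel_measurable borel" and d: "\<And>x. 0 \<le> d x" "\<And>x. d x \<le> CARD('n)"
    and conv: "AE x in lborel. x \<in> cball 0 R \<longrightarrow> (\<lambda>k. divergence (F k) x) \<longlonglongrightarrow> d x"
    and K: "compact K" and KR: "K \<subseteq> cball 0 (R - 1)"
  shows "emeasure lborel (H ` K) \<le> (\<integral>\<^sup>+x\<in>K. ennreal ((d x / CARD('n)) ^ CARD('n)) \<partial>lborel)"
proof -
  let ?h = "\<lambda>x. ennreal ((d x / CARD('n)) ^ CARD('n))"
  define Km where "Km m = {x + y |x y. x \<in> K \<and> y \<in> cball 0 (1 / real (Suc m))}" for m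
  have comp: "compact (Km m)" for m unfolding Km_def by (rule compact_neighborhood[OF K])
  have [measurable]: "Km m \<in> sets borel" for m using comp by (rule borel_compact)
  have [measurable]: "K \<in> sets borel" using K by (rule borel_compact)
  have [measurable]: "cball (0::real^'n) R \<in> sets borel" by simp
  have sub: "Km m \<subseteq> cball 0 R" for m
  proof
    fix z assume "z \<in> Km m"
    then obtain x y where z: "z = x + y" "x \<in> K" "norm y \<le> 1 / real (Suc m)" by (auto simp: Km_def)
    have "norm x \<le> R - 1" using z KR by auto
    moreover have "1 / real (Suc m) \<le> 1" by simp
    ultimately have "norm z \<le> R" using z(3) norm_triangle_ineq[of x y] unfolding z(1) by linarith
    then show "z \<in> cball 0 R" by simp
  qed
  have le: "emeasure lborel (H ` K) \<le> (\<integral>\<^sup>+x\<in>Km m. ?h x \<partial>lborel)" for m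
  proof (rule volume_image_le_divergence_neighborhood[OF firm close diff sym _ _ K _ Km_def])
    show "AE x in lborel. x \<in> Km m \<longrightarrow> (\<lambda>k. divergence (F k) x) \<longlonglongrightarrow> d x"
      using conv sub[of m] by (auto elim!: eventually_mono)
  qed auto
  have "(\<lambda>m. \<integral>\<^sup>+x\<in>Km m. ?h x \<partial>lborel) \<longlonglongrightarrow> (\<integral>\<^sup>+x\<in>K. ?h x \<partial>lborel)"
  proof (rule nn_integral_dominated_convergence[where w = "\<lambda>x. indicator (cball 0 R) x"])
    show "AE x in lborel. ?h x * indicator (Km m) x \<le> indicator (cball 0 R) x" for m
    proof (intro AE_I2)
      fix x
      have "(d x / CARD('n)) ^ CARD('n) \<le> 1"
        using d[of x] by (intro power_le_one) (auto simp: divide_le_eq)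
      then have "?h x \<le> 1" by (simp add: ennreal_leI flip: ennreal_1)
      then show "?h x * indicator (Km m) x \<le> indicator (cball 0 R) x"
        using sub[of m] by (auto simp: indicator_def)
    qed
    show "(\<integral>\<^sup>+x. indicator (cball 0 R :: (real^'n) set) x \<partial>lborel) < \<infinity>"
      using emeasure_lborel_cball_finite[of "0::real^'n" R] by (simp add: nn_integral_indicator)
    show "AE x in lborel. (\<lambda>m. ?h x * indicator (Km m) x) \<longlonglongrightarrow> ?h x * indicator K x"
    proof (intro AE_I2)
      fix x
      have "\<forall>\<^sub>F m in sequentially. indicator (Km m) x = (indicator K x :: ennreal)"
      proof (cases "x \<in> K")
        case True
        then have "x \<in> Km m" for m unfolding Km_def by (intro CollectI exI[of _ x] exI[of _ 0]) auto
        then show ?thesis using True by simp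
      next
        case False
        then obtain e where e: "0 < e" "ball x e \<subseteq> - K"
          using compact_imp_closed[OF K] by (metis Compl_iff open_Compl open_contains_ball)
        have "\<forall>\<^sub>F m in sequentially. 1 / real (Suc m) < e"
          using order_tendstoD(2)[OF LIMSEQ_inverse_real_of_nat e(1)] by (simp add: inverse_eq_divide)
        then show ?thesis
        proof (rule eventually_mono)
          fix m assume m: "1 / real (Suc m) < e"
          have "x \<notin> Km m"
          proof
            assume "x \<in> Km m"
            then obtain a y where "x = a + y" "a \<in> K" "norm y \<le> 1 / real (Suc m)" by (auto simp: Km_def)
            then have "a \<in> ball x e" using m by (simp add: dist_norm)
            then show False using e \<open>a \<in> K\<close> by auto
          qed
          then show "indicator (Km m) x = (indicator K x :: ennreal)" using False by simp
        qed
      qed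
      then show "(\<lambda>m. ?h x * indicator (Km m) x) \<longlonglongrightarrow> ?h x * indicator K x"
        by (intro tendsto_eventually) (auto elim: eventually_mono)
    qed
  qed measurable
  then show ?thesis by (rule LIMSEQ_le_const) (use le in auto)
qed

section \<open>From volumes of images to bounds on densities\<close>

lemma emeasure_lborel_scaled_vimage:
  fixes B :: "'a::euclidean_space set"
  assumes [measurable]: "B \<in> sets borel" and "0 < c"
  shows "ennreal (c ^ DIM('a)) * emeasure lborel ((\<lambda>x. c *\<^sub>R x) -` B) = emeasure lborel B"
proof -
  have "emeasure lborel B = emeasure (density (distr lborel borel (\<lambda>x. 0 + c *\<^sub>R x)) (\<lambda>_. ennreal (\<bar>c\<bar> ^ DIM('a)))) B"
    using lborel_affine[of c "0::'a"] \<open>0 < c\<close> by simp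
  also have "\<dots> = ennreal (c ^ DIM('a)) * emeasure (distr lborel borel (\<lambda>x. c *\<^sub>R x)) B"
    using \<open>0 < c\<close> by (subst emeasure_density) (simp_all add: nn_integral_cmult_indicator)
  also have "emeasure (distr lborel borel (\<lambda>x. c *\<^sub>R x)) B = emeasure lborel ((\<lambda>x. c *\<^sub>R x) -` B)"
    by (subst emeasure_distr) auto
  finally show ?thesis by simp
qed

text \<open>A finite Borel measure is inner regular, so comparison on compact sets is enough. Their
  continuous images are again compact, hence Borel.\<close>

lemma measure_le_lborel_from_compact:
  fixes s :: "'a::euclidean_space measure"
  assumes "sets s = sets borel" "emeasure s (space s) \<noteq> \<infinity>" and A: "A \<in> sets borel"
    and le: "\<And>K. compact K \<Longrightarrow> K \<subseteq> A \<Longrightarrow> emeasure s K \<le> emeasure lborel K"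
  shows "emeasure s A \<le> emeasure lborel A"
proof -
  have "emeasure s A = (SUP K\<in>{K. K \<subseteq> A \<and> compact K}. emeasure s K)"
    by (rule inner_regular[OF assms(1-3)])
  also have "\<dots> \<le> emeasure lborel A"
  proof (rule SUP_least)
    fix K assume "K \<in> {K. K \<subseteq> A \<and> compact K}"
    then have K: "K \<subseteq> A" "compact K" by auto
    have "emeasure s K \<le> emeasure lborel K" by (rule le[OF K(2,1)])
    also have "\<dots> \<le> emeasure lborel A" using K A by (intro emeasure_mono) auto
    finally show "emeasure s K \<le> emeasure lborel A" .
  qed
  finally show ?thesis .
qed

text \<open>
  With \<open>d\<close> the divergence of \<open>P\<close>, volumes grow under \<open>P\<close> by at most \<open>(d/n)^n\<close> and under
  \<open>id - P\<close> by at most \<open>(1 - d/n)^n\<close>. At each point one of these is below the value, \<open>(1-t)^n\<close> resp.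
  \<open>t^n\<close>, that makes the corresponding factor \<open>P/(1-t)\<close> resp. \<open>(id - P)/t\<close> volume decreasing.
\<close>

lemma volume_dichotomy:
  fixes P :: "real^'n::finite \<Rightarrow> real^'n"
  assumes firm: "firmly_nonexpansive P" and cyc: "cyclically_monotone_on UNIV P" and t: "0 < t" "t < 1"
  obtains D where "D \<in> sets borel"
    "\<And>K. compact K \<Longrightarrow> K \<subseteq> cball 0 R \<inter> D \<Longrightarrow> emeasure lborel (P ` K) \<le> ennreal ((1 - t) ^ CARD('n)) * emeasure lborel K"
    "\<And>K. compact K \<Longrightarrow> K \<subseteq> cball 0 R - D \<Longrightarrow> emeasure lborel ((\<lambda>x. x - P x) ` K) \<le> ennreal (t ^ CARD('n)) * emeasure lborel K"
proof -
  let ?n = "CARD('n)"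
  obtain F and d :: "real^'n \<Rightarrow> real" where F: "\<And>k. smooth_approximant P (1 / real (Suc k)) (F k)"
    and [measurable]: "d \<in> borel_measurable borel"
    and d: "\<And>x. 0 \<le> d x" "\<And>x. d x \<le> ?n"
    and conv: "AE x in lborel. x \<in> cball 0 (R + 1) \<longrightarrow> (\<lambda>k. divergence (F k) x) \<longlonglongrightarrow> d x"
    using smooth_approximants_with_convergent_divergence[OF firm cyc, of "R + 1"] by (auto simp del: of_nat_Suc)
  have firmF: "firmly_nonexpansive (F k)" and diff: "F k differentiable (at x)"
    and cycF: "cyclically_monotone_on UNIV (F k)" and close: "norm (F k x - P x) \<le> 1 / real (Suc k)" for k x
    using F[of k] by (auto simp: smooth_approximant_def)
  have sym: "frechet_derivative (F k) (at x) u \<bullet> v = u \<bullet> frechet_derivative (F k) (at x) v" for k x u v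
    by (rule cyclically_monotone_frechet_derivative_symmetric[OF cycF diff])
  define E where "E k x = 1 *\<^sub>R x + (-1) *\<^sub>R F k x" for k x
  have E: "E k = (\<lambda>x. x - F k x)" for k by (auto simp: E_def)
  have firmE: "firmly_nonexpansive (E k)" for k
    unfolding E by (rule firmly_nonexpansive_complement[OF firmF])
  have diffE: "E k differentiable (at x)" for k x
    unfolding E_def by (intro divergence_linear_combination(1) diff) simp
  have fdE: "frechet_derivative (E k) (at x) = (\<lambda>u. u - frechet_derivative (F k) (at x) u)" for k x
    unfolding E_def by (subst divergence_linear_combination(2)[OF _ diff]) (auto simp: frechet_derivative_ident)
  have divE: "divergence (E k) x = ?n - divergence (F k) x" for k x
    unfolding E_def by (subst divergence_linear_combination(3)[OF _ diff]) (auto simp: divergence_id)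
  have closeE: "norm (E k x - (x - P x)) \<le> 1 / real (Suc k)" for k x
    using close[of k x] by (simp add: E norm_minus_commute)
  have symE: "frechet_derivative (E k) (at x) u \<bullet> v = u \<bullet> frechet_derivative (E k) (at x) v" for k x u v
    using sym[of k x u v] by (simp add: fdE inner_diff_left inner_diff_right)
  have convE: "AE x in lborel. x \<in> cball 0 (R + 1) \<longrightarrow> (\<lambda>k. divergence (E k) x) \<longlonglongrightarrow> ?n - d x"
    using conv by eventually_elim (auto simp: divE intro!: tendsto_diff)
  \<comment> \<open>On \<open>D\<close> the factor \<open>d / n\<close> is at most
    \<open>1 - t\<close>, off \<open>D\<close> the complementary factor \<open>1 - d / n\<close> is
    below \<open>t\<close>; the two thresholds add up to 1, so every point falls under one
    case.\<close>
  define D where "D = {x. d x \<le> ?n * (1 - t)}"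
  have const: "(\<integral>\<^sup>+x\<in>K. ennreal (h x) \<partial>lborel) \<le> ennreal c * emeasure lborel K"
    if "compact K" "\<And>x. x \<in> K \<Longrightarrow> h x \<le> c" for K :: "(real^'n) set" and h c
  proof -
    have "(\<integral>\<^sup>+x\<in>K. ennreal (h x) \<partial>lborel) \<le> (\<integral>\<^sup>+x. ennreal c * indicator K x \<partial>lborel)"
      using that(2) by (intro nn_integral_mono) (auto simp: indicator_def ennreal_leI)
    also have "\<dots> = ennreal c * emeasure lborel K"
      using that(1) by (intro nn_integral_cmult_indicator) (simp add: borel_compact)
    finally show ?thesis .
  qed
  show ?thesis
  proof (rule that[of D])
    show "D \<in> sets borel" unfolding D_def by measurable
    fix K :: "(real^'n) set" assume K: "compact K"
    { assume sub: "K \<subseteq> cball 0 R \<inter> D"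
      have "emeasure lborel (P ` K) \<le> (\<integral>\<^sup>+x\<in>K. ennreal ((d x / ?n) ^ ?n) \<partial>lborel)"
        by (rule volume_image_le_divergence[OF firm firmF close diff sym _ d conv K]) (use sub in auto)
      also have "\<dots> \<le> ennreal ((1 - t) ^ ?n) * emeasure lborel K"
      proof (rule const[OF K])
        fix x assume "x \<in> K"
        then have "d x / ?n \<le> 1 - t" using sub by (auto simp: D_def divide_le_eq mult.commute)
        then show "(d x / ?n) ^ ?n \<le> (1 - t) ^ ?n" using d(1)[of x] by (intro power_mono) auto
      qed
      finally show "emeasure lborel (P ` K) \<le> ennreal ((1 - t) ^ ?n) * emeasure lborel K" . }
    { assume sub: "K \<subseteq> cball 0 R - D"
      have "emeasure lborel ((\<lambda>x. x - P x) ` K) \<le> (\<integral>\<^sup>+x\<in>K. ennreal (((?n - d x) / ?n) ^ ?n) \<partial>lborel)"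
        by (rule volume_image_le_divergence[OF firmly_nonexpansive_complement[OF firm] firmE closeE diffE symE _ _ _ convE K])
          (use sub d in auto)
      also have "\<dots> \<le> ennreal (t ^ ?n) * emeasure lborel K"
      proof (rule const[OF K])
        fix x assume "x \<in> K"
        then have "?n * (1 - t) < d x" using sub by (auto simp: D_def)
        then have "(?n - d x) / ?n \<le> t" by (simp add: divide_le_eq algebra_simps)
        then show "((?n - d x) / ?n) ^ ?n \<le> t ^ ?n" using d(2)[of x] by (intro power_mono) auto
      qed
      finally show "emeasure lborel ((\<lambda>x. x - P x) ` K) \<le> ennreal (t ^ ?n) * emeasure lborel K" . }
  qed
qed

lemma ennreal_mult_le_cancel:
  fixes x y :: ennreal
  assumes "0 < c" "ennreal c * x \<le> ennreal c * y"
  shows "x \<le> y"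
  using assms by (simp add: ennreal_mult_le_mult_iff)

lemma displacement_density_bound:
  fixes T P :: "real^'n::finite \<Rightarrow> real^'n" and a :: "real^'n \<Rightarrow> ennreal"
  assumes firm: "firmly_nonexpansive P" and cyc: "cyclically_monotone_on UNIV P" and t: "0 < t" "t < 1"
    and P: "\<And>x. x \<in> G \<Longrightarrow> P (t *\<^sub>R T x + (1 - t) *\<^sub>R x) = (1 - t) *\<^sub>R x"
    and [measurable]: "T \<in> borel_measurable lebesgue" "a \<in> borel_measurable lebesgue"
    and a: "\<And>x. a x \<le> 1" "\<And>x. x \<notin> G \<Longrightarrow> a x = 0" and fin: "(\<integral>\<^sup>+x. a x \<partial>lebesgue) \<noteq> \<infinity>"
    and target: "\<And>A. A \<in> sets borel \<Longrightarrow> (\<integral>\<^sup>+x. a x * indicator A (T x) \<partial>lebesgue) \<le> emeasure lborel A"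
    and A: "A \<in> sets borel"
  shows "(\<integral>\<^sup>+x. a x * indicator A (t *\<^sub>R T x + (1 - t) *\<^sub>R x) \<partial>lebesgue) \<le> emeasure lborel A"
proof -
  let ?n = "CARD('n)" and ?Tt = "\<lambda>x. t *\<^sub>R T x + (1 - t) *\<^sub>R x"
  have [measurable]: "(\<lambda>x::real^'n. x) \<in> borel_measurable lebesgue"
    by (rule measurable_completion) simp
  have Tt [measurable]: "?Tt \<in> borel_measurable lebesgue" by measurable
  define s where "s = distr (density lebesgue a) borel ?Tt"
  have sets_s [measurable_cong]: "sets s = sets borel" by (simp add: s_def)
  have s: "emeasure s B = (\<integral>\<^sup>+x. a x * indicator B (?Tt x) \<partial>lebesgue)" if [measurable]: "B \<in> sets borel" for B
    unfolding s_def
    using measurable_sets[OF Tt that]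
    by (subst emeasure_distr, simp, simp, subst emeasure_density) (auto simp: indicator_def intro!: nn_integral_cong)
  have fin_s: "emeasure s (space s) \<noteq> \<infinity>"
    using fin s[of UNIV] by (simp add: s_def)
  have contP: "continuous_on S P" "continuous_on S (\<lambda>x. x - P x)" for S
    using firmly_nonexpansive_continuous[OF firm] firmly_nonexpansive_continuous[OF firmly_nonexpansive_complement[OF firm]] by auto
  have compact_le: "emeasure s K \<le> emeasure lborel K" if K: "compact K" for K
  proof -
    obtain R where R: "K \<subseteq> cball 0 R"
      using compact_imp_bounded[OF K] unfolding bounded_iff by (metis mem_cball_0 subsetI)
    obtain D where D [measurable]: "D \<in> sets borel"
      and D1: "\<And>K. compact K \<Longrightarrow> K \<subseteq> cball 0 R \<inter> D \<Longrightarrow> emeasure lborel (P ` K) \<le> ennreal ((1 - t) ^ ?n) * emeasure lborel K"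
      and D2: "\<And>K. compact K \<Longrightarrow> K \<subseteq> cball 0 R - D \<Longrightarrow> emeasure lborel ((\<lambda>x. x - P x) ` K) \<le> ennreal (t ^ ?n) * emeasure lborel K"
      by (rule volume_dichotomy[OF firm cyc t, of R]) blast
    have [measurable]: "K \<in> sets borel" using K by (rule borel_compact)
    have KD: "K \<inter> D \<in> sets borel" "K - D \<in> sets borel" by measurable
    have "emeasure s (K \<inter> D) \<le> emeasure lborel (K \<inter> D)"
    proof (rule measure_le_lborel_from_compact[OF sets_s fin_s KD(1)])
      fix K' assume K': "compact K'" "K' \<subseteq> K \<inter> D"
      have [measurable]: "K' \<in> sets borel" using K' by (intro borel_compact)
      have [measurable]: "P ` K' \<in> sets borel" using K' contP by (intro borel_compact compact_continuous_image)
      have vim: "(\<lambda>x. (1 - t) *\<^sub>R x) -` (P ` K') \<in> sets borel"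
        using measurable_sets[of "\<lambda>x. (1 - t) *\<^sub>R x" borel borel "P ` K'"] by simp
      \<comment> \<open>Source side: mass landing in \<open>K'\<close> starts in a set whose volume
        is at most that of \<open>K'\<close>, and \<open>a\<close> is at most 1.\<close>
      have "emeasure s K' \<le> (\<integral>\<^sup>+x. indicator ((\<lambda>x. (1 - t) *\<^sub>R x) -` (P ` K')) x \<partial>lebesgue)"
        unfolding s[OF \<open>K' \<in> sets borel\<close>]
      proof (rule nn_integral_mono)
        fix x
        show "a x * indicator K' (?Tt x) \<le> indicator ((\<lambda>x. (1 - t) *\<^sub>R x) -` (P ` K')) x"
        proof (cases "x \<in> G \<and> ?Tt x \<in> K'")
          case True
          then have "(1 - t) *\<^sub>R x \<in> P ` K'" using P[of x] by (metis imageI)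
          then show ?thesis using a(1)[of x] by (simp add: indicator_def)
        next
          case False
          then show ?thesis using a(2)[of x] by (auto simp: indicator_def)
        qed
      qed
      also have "\<dots> = emeasure lborel ((\<lambda>x. (1 - t) *\<^sub>R x) -` (P ` K'))"
        unfolding nn_integral_completion using vim by (intro nn_integral_indicator) simp
      finally have "ennreal ((1 - t) ^ ?n) * emeasure s K' \<le> ennreal ((1 - t) ^ ?n) * emeasure lborel ((\<lambda>x. (1 - t) *\<^sub>R x) -` (P ` K'))"
        by (rule mult_left_mono) simp
      also have "\<dots> = emeasure lborel (P ` K')"
        using emeasure_lborel_scaled_vimage[of "P ` K'" "1 - t"] t by simp
      also have "\<dots> \<le> ennreal ((1 - t) ^ ?n) * emeasure lborel K'"
        using K' R by (intro D1) auto
      finally show "emeasure s K' \<le> emeasure lborel K'"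
        by (rule ennreal_mult_le_cancel[rotated]) (use t in simp)
    qed
    moreover have "emeasure s (K - D) \<le> emeasure lborel (K - D)"
    proof (rule measure_le_lborel_from_compact[OF sets_s fin_s KD(2)])
      fix K' assume K': "compact K'" "K' \<subseteq> K - D"
      let ?Q = "(\<lambda>x. x - P x) ` K'"
      have [measurable]: "K' \<in> sets borel" using K' by (intro borel_compact)
      have [measurable]: "?Q \<in> sets borel" using K' contP by (intro borel_compact compact_continuous_image)
      have vim: "(\<lambda>x. t *\<^sub>R x) -` ?Q \<in> sets borel"
        using measurable_sets[of "\<lambda>x. t *\<^sub>R x" borel borel ?Q] by simp
      \<comment> \<open>Target side: the same mass is counted by where \<open>T\<close> sends it,
        and the hypothesis on the push-forward of \<open>a\<close> takes the place of the bound on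
        \<open>a\<close>.\<close>
      have "emeasure s K' \<le> (\<integral>\<^sup>+x. a x * indicator ((\<lambda>x. t *\<^sub>R x) -` ?Q) (T x) \<partial>lebesgue)"
        unfolding s[OF \<open>K' \<in> sets borel\<close>]
      proof (rule nn_integral_mono)
        fix x
        show "a x * indicator K' (?Tt x) \<le> a x * indicator ((\<lambda>x. t *\<^sub>R x) -` ?Q) (T x)"
        proof (cases "x \<in> G \<and> ?Tt x \<in> K'")
          case True
          have "t *\<^sub>R T x = ?Tt x - P (?Tt x)" using True by (simp add: P)
          then have "t *\<^sub>R T x \<in> ?Q" using True by (intro image_eqI[of _ _ "?Tt x"]) auto
          then show ?thesis by (simp add: indicator_def)
        next
          case False
          then show ?thesis using a(2)[of x] by (auto simp: indicator_def)
        qed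
      qed
      also have "\<dots> \<le> emeasure lborel ((\<lambda>x. t *\<^sub>R x) -` ?Q)"
        by (rule target[OF vim])
      finally have "ennreal (t ^ ?n) * emeasure s K' \<le> ennreal (t ^ ?n) * emeasure lborel ((\<lambda>x. t *\<^sub>R x) -` ?Q)"
        by (rule mult_left_mono) simp
      also have "\<dots> = emeasure lborel ?Q"
        using emeasure_lborel_scaled_vimage[of ?Q t] t by simp
      also have "\<dots> \<le> ennreal (t ^ ?n) * emeasure lborel K'"
        using K' R by (intro D2) auto
      finally show "emeasure s K' \<le> emeasure lborel K'"
        by (rule ennreal_mult_le_cancel[rotated]) (use t in simp)
    qed
    moreover have "emeasure M K = emeasure M (K \<inter> D) + emeasure M (K - D)" if "sets M = sets borel" for M :: "(real^'n) measure"
    proof -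
      have "K \<inter> D \<in> sets M" "K - D \<in> sets M" unfolding that by (rule KD)+
      then have "emeasure M (K \<inter> D) + emeasure M (K - D) = emeasure M ((K \<inter> D) \<union> (K - D))"
        by (intro plus_emeasure) auto
      then show ?thesis by (simp add: Int_Diff_Un)
    qed
    ultimately show ?thesis
      using sets_s by (simp add: add_mono)
  qed
  have "emeasure s A \<le> emeasure lborel A"
    by (rule measure_le_lborel_from_compact[OF sets_s fin_s A]) (rule compact_le)
  then show ?thesis by (simp add: s[OF A])
qed

section \<open>Potentials and resolvents\<close>

text \<open>Rockafellar's construction: \<open>u\<close> is the supremum of the affine functions
  obtained by summing increments along chains in \<open>G\<close> that start at \<open>g0\<close>. A
  chain is a pair of its length and its points, and its affine function has slope \<open>T\<close>
  at the last point. The slopes are bounded by \<open>M\<close>, which makes \<open>u\<close>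
  Lipschitz.\<close>

lemma cyclically_monotone_potential:
  fixes T :: "'a::euclidean_space \<Rightarrow> 'a"
  assumes cyc: "cyclically_monotone_on G T" and M: "\<And>x. x \<in> G \<Longrightarrow> norm (T x) \<le> M" and g0: "g0 \<in> G"
  obtains u :: "'a \<Rightarrow> real" where "\<And>x y. u x \<le> u y + M * norm (x - y)" "convex_on UNIV u"
    "\<And>x z. x \<in> G \<Longrightarrow> u x + T x \<bullet> (z - x) \<le> u z"
proof -
  define C where "C = {(N::nat, g::nat \<Rightarrow> 'a). (\<forall>i. g i \<in> G) \<and> g 0 = g0}"
  define v where "v = (\<lambda>(N, g) x. T (g N) \<bullet> (x - g N) + (\<Sum>i<N. T (g i) \<bullet> (g (Suc i) - g i)))"
  define u where "u x = (SUP c\<in>C. v c x)" for x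
  have "(0, \<lambda>_. g0) \<in> C" using g0 by (simp add: C_def)
  then have ne: "C \<noteq> {}" by auto
  have affine: "v c x = v c y + T (snd c (fst c)) \<bullet> (x - y)" for c x y
    by (simp add: v_def case_prod_unfold inner_diff_right)
  have step: "v c x \<le> v c y + M * norm (x - y)" if "c \<in> C" for c x y
  proof -
    have "T (snd c (fst c)) \<bullet> (x - y) \<le> norm (T (snd c (fst c))) * norm (x - y)"
      by (rule norm_cauchy_schwarz)
    also have "\<dots> \<le> M * norm (x - y)"
      using that M by (intro mult_right_mono) (auto simp: C_def)
    finally show ?thesis by (simp add: affine[of c x y])
  qed
  \<comment> \<open>Returning to \<open>g0\<close> closes the chain into a cycle. This is where
    cyclical monotonicity enters, and it makes the supremum finite at \<open>g0\<close>, hence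
    everywhere.\<close>
  have v0: "v c g0 \<le> 0" if "c \<in> C" for c
  proof -
    obtain N g where c: "c = (N, g)" "\<And>i. g i \<in> G" "g 0 = g0" using \<open>c \<in> C\<close> by (auto simp: C_def)
    define h where "h i = (if i \<le> N then g i else g0)" for i
    have "(\<Sum>i<Suc N. T (h i) \<bullet> (h (Suc i) - h i)) \<le> 0"
      using c g0 by (intro cyclically_monotone_onD[OF cyc]) (auto simp: h_def)
    moreover have "(\<Sum>i<N. T (h i) \<bullet> (h (Suc i) - h i)) = (\<Sum>i<N. T (g i) \<bullet> (g (Suc i) - g i))"
      by (intro sum.cong) (auto simp: h_def)
    ultimately show ?thesis by (simp add: v_def c h_def add.commute)
  qed
  have bdd: "bdd_above ((\<lambda>c. v c x) ` C)" for x
    using step[of _ x g0] v0 by (intro bdd_aboveI2[of _ _ "M * norm (x - g0)"]) force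
  have upper: "v c x \<le> u x" if "c \<in> C" for c x
    unfolding u_def using that bdd by (rule cSUP_upper)
  have least: "u x \<le> b" if "\<And>c. c \<in> C \<Longrightarrow> v c x \<le> b" for x b
    unfolding u_def using ne that by (rule cSUP_least)
  show ?thesis
  proof (rule that[of u])
    show "u x \<le> u y + M * norm (x - y)" for x y
      using step upper by (intro least) (meson add_right_mono order_trans)
    show "convex_on UNIV u"
    proof (rule convex_onI)
      fix l :: real and x y :: 'a assume l: "0 < l" "l < 1"
      show "u ((1 - l) *\<^sub>R x + l *\<^sub>R y) \<le> (1 - l) * u x + l * u y"
      proof (rule least)
        fix c assume c: "c \<in> C"
        have "v c ((1 - l) *\<^sub>R x + l *\<^sub>R y) = (1 - l) * v c x + l * v c y"
          using affine[of c x 0] affine[of c y 0] affine[of c "(1 - l) *\<^sub>R x + l *\<^sub>R y" 0]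
          by (simp add: inner_add_right algebra_simps)
        also have "\<dots> \<le> (1 - l) * u x + l * u y"
          using l upper[OF c] by (intro add_mono mult_left_mono) auto
        finally show "v c ((1 - l) *\<^sub>R x + l *\<^sub>R y) \<le> (1 - l) * u x + l * u y" .
      qed
    qed simp
    show "u x + T x \<bullet> (z - x) \<le> u z" if x: "x \<in> G" for x z
    proof -
      have "u x \<le> u z - T x \<bullet> (z - x)"
      proof (rule least)
        fix c assume "c \<in> C"
        then obtain N g where c: "c = (N, g)" "\<And>i. g i \<in> G" "g 0 = g0" by (auto simp: C_def)
        \<comment> \<open>Appending \<open>x\<close> to a chain adds the increment with slope
          \<open>T x\<close>, so every competitor for \<open>u x\<close> extends to one for
          \<open>u z\<close>.\<close>
        define h where "h i = (if i \<le> N then g i else x)" for i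
        have "(Suc N, h) \<in> C" using c x by (auto simp: C_def h_def)
        then have "v (Suc N, h) z \<le> u z" by (rule upper)
        moreover have "(\<Sum>i<N. T (h i) \<bullet> (h (Suc i) - h i)) = (\<Sum>i<N. T (g i) \<bullet> (g (Suc i) - g i))"
          by (intro sum.cong) (auto simp: h_def)
        then have "v (Suc N, h) z = T x \<bullet> (z - x) + v c x"
          by (simp add: v_def c h_def)
        ultimately show "v c x \<le> u z - T x \<bullet> (z - x)" by simp
      qed
      then show ?thesis by simp
    qed
  qed
qed

section \<open>The resolvent of the potential\<close>

text \<open>The minimiser is the value at \<open>y\<close> of the inverse of
  \<open>(1 - t) id + t \<partial>u\<close>, where \<open>\<partial>u\<close> is the
  subdifferential. It exists because the quadratic term dominates the linear growth of
  \<open>u\<close> and of the inner product.\<close>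

lemma proximal_minimizer:
  fixes u :: "'a::euclidean_space \<Rightarrow> real"
  assumes lip: "\<And>x y. u x \<le> u y + M * norm (x - y)" and "0 \<le> M" and t: "0 < t" "t < 1"
  obtains s where "\<And>x. (1 - t) / 2 * (s \<bullet> s) + t * u s - s \<bullet> y \<le> (1 - t) / 2 * (x \<bullet> x) + t * u x - x \<bullet> y"
proof -
  define f where "f x = (1 - t) / 2 * (x \<bullet> x) + t * u x - x \<bullet> y" for x
  \<comment> \<open>Beyond this radius half of \<open>(1 - t) \<bar>x\<bar>\<close> exceeds
    \<open>t M + \<bar>y\<bar>\<close>, so the functional is no smaller than its value
    \<open>t * u 0\<close> at the origin. The summand 1 keeps the ball nondegenerate.\<close>
  define r where "r = 2 * (t * M + norm y) / (1 - t) + 1"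
  have r: "0 < r" using t \<open>0 \<le> M\<close> by (auto simp: r_def intro!: add_nonneg_pos)
  have "dist (u x) (u z) \<le> M * dist x z" for x z
    using lip[of x z] lip[of z x] by (simp add: dist_norm norm_minus_commute abs_le_iff)
  then have "continuous_on UNIV u"
    using \<open>0 \<le> M\<close> by (intro lipschitz_on_continuous_on[of M] lipschitz_onI) auto
  then have "continuous_on (cball 0 r) f"
    unfolding f_def by (intro continuous_intros) (auto intro: continuous_on_subset)
  then obtain s where s: "s \<in> cball 0 r" "\<And>x. x \<in> cball 0 r \<Longrightarrow> f s \<le> f x"
    using continuous_attains_inf[of "cball 0 r" f] r by auto
  have "f s \<le> f x" for x
  proof (cases "x \<in> cball 0 r")
    case False
    then have x: "r < norm x" by simp
    have "t * u 0 - t * M * norm x \<le> t * u x"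
      using mult_left_mono[OF lip[of 0 x], of t] t by (simp add: algebra_simps)
    moreover have "x \<bullet> y \<le> norm y * norm x"
      using norm_cauchy_schwarz[of x y] by (simp add: mult.commute)
    moreover have "0 \<le> norm x * ((1 - t) / 2 * norm x - (t * M + norm y))"
    proof (intro mult_nonneg_nonneg)
      have "2 * (t * M + norm y) / (1 - t) \<le> norm x" using x by (simp add: r_def)
      then show "0 \<le> (1 - t) / 2 * norm x - (t * M + norm y)" using t by (simp add: field_simps)
    qed simp
    moreover have "norm x * ((1 - t) / 2 * norm x - (t * M + norm y)) =
      (1 - t) / 2 * (x \<bullet> x) - t * M * norm x - norm y * norm x"
      by (simp add: power2_norm_eq_inner[symmetric] power2_eq_square algebra_simps)
    ultimately have "t * u 0 \<le> f x"
      unfolding f_def by linarith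
    then show ?thesis using s(2)[of 0] r by (simp add: f_def)
  qed (rule s)
  then show ?thesis using that[of s] by (simp add: f_def)
qed

text \<open>The optimality condition: \<open>y - (1 - t) s\<close> is a subgradient of
  \<open>t u\<close> at \<open>s\<close>. Convexity is used on the segment from \<open>s\<close> to
  \<open>z\<close>; after division by the length parameter \<open>l\<close> the quadratic term
  disappears as \<open>l\<close> tends to 0.\<close>

lemma proximal_subgradient:
  fixes u :: "'a::euclidean_space \<Rightarrow> real"
  assumes conv: "convex_on UNIV u" and t: "0 < t" "t < 1"
    and min: "\<And>x. (1 - t) / 2 * (s \<bullet> s) + t * u s - s \<bullet> y \<le> (1 - t) / 2 * (x \<bullet> x) + t * u x - x \<bullet> y"
  shows "t * u s + (y - (1 - t) *\<^sub>R s) \<bullet> (z - s) \<le> t * u z"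
proof -
  define w where "w = z - s"
  define b where "b = (1 - t) * (s \<bullet> w) + t * (u z - u s) - w \<bullet> y"
  have "0 \<le> b + l * ((1 - t) / 2 * (w \<bullet> w))" if l: "0 < l" "l < 1" for l
  proof -
    have "u (s + l *\<^sub>R w) \<le> (1 - l) * u s + l * u z"
      using convex_onD[OF conv, of l s z] l by (simp add: w_def algebra_simps)
    then have "t * u (s + l *\<^sub>R w) \<le> t * ((1 - l) * u s + l * u z)"
      using t by (intro mult_left_mono) auto
    with min[of "s + l *\<^sub>R w"]
    have "0 \<le> (1 - t) / 2 * ((s + l *\<^sub>R w) \<bullet> (s + l *\<^sub>R w) - s \<bullet> s) + t * ((1 - l) * u s + l * u z) - t * u s - l * (w \<bullet> y)"
      by (simp add: inner_add_left algebra_simps)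
    also have "\<dots> = l * (b + l * ((1 - t) / 2 * (w \<bullet> w)))"
      by (simp add: b_def inner_add_left inner_add_right inner_commute[of w s] field_simps)
    finally show ?thesis using l by (simp add: zero_le_mult_iff)
  qed
  then have "\<forall>\<^sub>F l in at_right 0. 0 \<le> b + l * ((1 - t) / 2 * (w \<bullet> w))"
    unfolding eventually_at_right_field by (intro exI[of _ 1]) auto
  moreover have "((\<lambda>l. b + l * ((1 - t) / 2 * (w \<bullet> w))) \<longlongrightarrow> b + 0 * ((1 - t) / 2 * (w \<bullet> w))) (at_right 0)"
    by (intro tendsto_intros)
  ultimately have "0 \<le> b + 0 * ((1 - t) / 2 * (w \<bullet> w))"
    by (intro tendsto_lowerbound[of _ _ "at_right 0"]) auto
  then show ?thesis
    by (simp add: b_def w_def[symmetric] inner_diff_left inner_commute algebra_simps)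
qed

text \<open>\<open>S\<close> inverts \<open>(1 - t) id + t \<partial>u\<close>. Since
  \<open>T x\<close> is a subgradient of \<open>u\<close> at each \<open>x\<close> in
  \<open>G\<close>, this operator contains \<open>T_t\<close> on \<open>G\<close>, and
  \<open>S\<close> extends the inverse of \<open>T_t\<close> to all of space. Firm nonexpansiveness
  of \<open>(1 - t) S\<close> comes from monotonicity of subgradients.\<close>

lemma cyclically_monotone_resolvent:
  fixes T :: "'a::euclidean_space \<Rightarrow> 'a"
  assumes cyc: "cyclically_monotone_on G T" and M: "\<And>x. x \<in> G \<Longrightarrow> norm (T x) \<le> M" and t: "0 < t" "t < 1"
  obtains P where "firmly_nonexpansive P" "cyclically_monotone_on UNIV P"
    "\<And>x. x \<in> G \<Longrightarrow> P (t *\<^sub>R T x + (1 - t) *\<^sub>R x) = (1 - t) *\<^sub>R x"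
proof (cases "G = {}")
  case True
  then show ?thesis
    by (intro that[of "\<lambda>_. 0"]) (auto simp: firmly_nonexpansive_def cyclically_monotone_on_def norm_minus_commute)
next
  case False
  then obtain g0 where g0: "g0 \<in> G" by auto
  then have "0 \<le> M" using M[OF g0] norm_ge_zero order_trans by blast
  obtain u where lip: "\<And>x y. u x \<le> u y + M * norm (x - y)" and conv: "convex_on UNIV u"
    and sub: "\<And>x z. x \<in> G \<Longrightarrow> u x + T x \<bullet> (z - x) \<le> u z"
    by (rule cyclically_monotone_potential[OF cyc M g0]) blast+
  have "\<exists>s. \<forall>x. (1 - t) / 2 * (s \<bullet> s) + t * u s - s \<bullet> y \<le> (1 - t) / 2 * (x \<bullet> x) + t * u x - x \<bullet> y" for y
    by (rule proximal_minimizer[OF lip \<open>0 \<le> M\<close> t, of y]) blast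
  then obtain S where min: "\<And>y x. (1 - t) / 2 * (S y \<bullet> S y) + t * u (S y) - S y \<bullet> y \<le> (1 - t) / 2 * (x \<bullet> x) + t * u x - x \<bullet> y"
    by metis
  note subgrad = proximal_subgradient[OF conv t min]
  show ?thesis
  proof (rule that[of "\<lambda>y. (1 - t) *\<^sub>R S y"])
    show "firmly_nonexpansive (\<lambda>y. (1 - t) *\<^sub>R S y)"
      unfolding firmly_nonexpansive_iff
    proof (intro allI)
      fix x y
      define w where "w = S x - S y"
      have "(x - (1 - t) *\<^sub>R S x) \<bullet> (S y - S x) + (y - (1 - t) *\<^sub>R S y) \<bullet> (S x - S y) \<le> 0"
        using subgrad[of x "S y"] subgrad[of y "S x"] by linarith
      then have "(1 - t) * (w \<bullet> w) \<le> w \<bullet> (x - y)"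
        by (simp add: w_def inner_diff_left inner_diff_right inner_commute algebra_simps)
      then have "(1 - t) * ((1 - t) * (w \<bullet> w)) \<le> (1 - t) * (w \<bullet> (x - y))"
        using t by (intro mult_left_mono) auto
      then show "(norm ((1 - t) *\<^sub>R S x - (1 - t) *\<^sub>R S y))\<^sup>2 \<le> ((1 - t) *\<^sub>R S x - (1 - t) *\<^sub>R S y) \<bullet> (x - y)"
        by (simp only: scaleR_diff_right[symmetric] w_def[symmetric] power2_norm_eq_inner inner_scaleR_left inner_scaleR_right)
    qed
    show "cyclically_monotone_on UNIV (\<lambda>y. (1 - t) *\<^sub>R S y)"
      unfolding cyclically_monotone_on_def
    proof (intro allI impI)
      fix y :: "nat \<Rightarrow> 'a" and N assume N: "y N = y 0"
      \<comment> \<open>The Legendre transform of the convex function being minimised; minimality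
        says that \<open>S y\<close> is its subgradient at \<open>y\<close>, and subgradients are
        cyclically monotone by telescoping.\<close>
      define \<phi> where "\<phi> y = S y \<bullet> y - (1 - t) / 2 * (S y \<bullet> S y) - t * u (S y)" for y
      have "S x \<bullet> (z - x) \<le> \<phi> z - \<phi> x" for x z
        using min[of z "S x"] by (simp add: \<phi>_def inner_diff_right)
      then have "(\<Sum>i<N. S (y i) \<bullet> (y (Suc i) - y i)) \<le> (\<Sum>i<N. \<phi> (y (Suc i)) - \<phi> (y i))"
        by (intro sum_mono)
      also have "\<dots> = 0"
        using sum_lessThan_telescope[of "\<lambda>i. \<phi> (y i)" N] N by simp
      finally have "(1 - t) * (\<Sum>i<N. S (y i) \<bullet> (y (Suc i) - y i)) \<le> 0"
        using t by (intro mult_nonneg_nonpos) auto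
      then show "(\<Sum>i<N. ((1 - t) *\<^sub>R S (y i)) \<bullet> (y (Suc i) - y i)) \<le> 0"
        by (simp add: sum_distrib_left)
    qed
    fix x assume x: "x \<in> G"
    \<comment> \<open>Now \<open>x\<close> and \<open>S y\<close> both satisfy the optimality
      condition at \<open>y\<close>. Monotonicity together with the quadratic term, whose
      coefficient \<open>1 - t\<close> is positive, forces them to agree.\<close>
    define y where "y = t *\<^sub>R T x + (1 - t) *\<^sub>R x"
    have "t * u x + t * (T x \<bullet> (S y - x)) \<le> t * u (S y)"
      using mult_left_mono[OF sub[OF x, of "S y"], of t] t by (simp add: algebra_simps)
    with subgrad[of y x] have "(y - (1 - t) *\<^sub>R S y) \<bullet> (x - S y) + t * (T x \<bullet> (S y - x)) \<le> 0" by linarith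
    then have "(1 - t) * ((x - S y) \<bullet> (x - S y)) \<le> 0"
      by (simp add: y_def inner_diff_left inner_diff_right inner_add_left inner_commute algebra_simps)
    then have "(x - S y) \<bullet> (x - S y) = 0" using t inner_ge_zero[of "x - S y"] by (simp add: mult_le_0_iff)
    then have "x = S y" by simp
    then show "(1 - t) *\<^sub>R S (t *\<^sub>R T x + (1 - t) *\<^sub>R x) = (1 - t) *\<^sub>R x"
      by (simp add: y_def)
  qed
qed

section \<open>Transport from an atomless measure\<close>

text \<open>The shift on Cantor codes. Base three with digits 0 and 2 makes codes unambiguous, and
  comparison with 1/2 reads off the leading digit.\<close>

definition ternary_step :: "real \<Rightarrow> real" where
  "ternary_step r = (if r > 1/2 then 3 * r - 2 else 3 * r)"

definition ternary_code :: "(nat \<Rightarrow> bool) \<Rightarrow> real" where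
  "ternary_code b = (\<Sum>k. (if b k then 2 else 0) * (1/3) ^ Suc k)"

lemma summable_ternary: "summable (\<lambda>k. (if b k then 2 else 0) * (1/3::real) ^ Suc k)"
proof (rule summable_comparison_test'[of "\<lambda>k. 2 * (1/3::real) ^ k" 0])
  show "summable (\<lambda>k. 2 * (1/3::real) ^ k)"
    by (intro summable_mult summable_geometric) simp
qed auto

lemma ternary_code_bounds: "0 \<le> ternary_code b" "ternary_code b \<le> 1"
proof -
  show "0 \<le> ternary_code b"
    unfolding ternary_code_def by (intro suminf_nonneg summable_ternary) auto
  have "ternary_code b \<le> (\<Sum>k. 2/3 * (1/3::real) ^ k)"
    unfolding ternary_code_def
    by (intro suminf_le summable_ternary summable_mult summable_geometric) auto
  also have "\<dots> = 1"
    by (subst suminf_mult) (auto simp: suminf_geometric)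
  finally show "ternary_code b \<le> 1" .
qed

lemma ternary_code_Suc: "ternary_code b = (if b 0 then 2/3 else 0) + ternary_code (\<lambda>k. b (Suc k)) / 3"
proof -
  have "ternary_code b = (\<Sum>k. (if b (Suc k) then 2 else 0) * (1/3) ^ Suc (Suc k)) + (if b 0 then 2 else 0) * (1/3) ^ Suc 0"
    unfolding ternary_code_def by (subst suminf_split_head[OF summable_ternary]) simp
  also have "(\<Sum>k. (if b (Suc k) then 2 else 0) * (1/3::real) ^ Suc (Suc k)) = (1/3) * ternary_code (\<lambda>k. b (Suc k))"
    unfolding ternary_code_def by (subst suminf_mult[OF summable_ternary, symmetric]) (simp add: mult_ac)
  finally show ?thesis by simp
qed

lemma ternary_digit: "ternary_code b > 1/2 \<longleftrightarrow> b 0"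
  using ternary_code_bounds[of "\<lambda>k. b (Suc k)"] by (auto simp: ternary_code_Suc[of b])

lemma ternary_step_code: "ternary_step (ternary_code b) = ternary_code (\<lambda>k. b (Suc k))"
  unfolding ternary_step_def ternary_digit by (auto simp: ternary_code_Suc[of b])

lemma ternary_digits: "(ternary_step ^^ k) (ternary_code b) > 1/2 \<longleftrightarrow> b k"
proof -
  have "(ternary_step ^^ k) (ternary_code b) = ternary_code (\<lambda>i. b (k + i))"
    by (induction k) (auto simp: ternary_step_code)
  then show ?thesis by (simp only: ternary_digit add_0_right)
qed

text \<open>
  A point is coded by the truth values of \<open>q < x \<bullet> b\<close> for rational \<open>q\<close>; a coordinate is
  recovered as the supremum of the rationals below it.
\<close>

lemma borel_coding_real:
  obtains J :: "'a::euclidean_space \<Rightarrow> real" and L :: "real \<Rightarrow> 'a"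
  where "J \<in> borel_measurable borel" "L \<in> borel_measurable borel" "\<And>x. L (J x) = x"
proof -
  let ?I = "(Basis :: 'a set) \<times> (\<rat> :: real set)"
  define e where "e = from_nat_into ?I"
  have countI: "countable ?I"
    by (intro countable_SIGMA countable_finite countable_rat) auto
  have "?I \<noteq> {}" using Rats_0 nonempty_Basis by auto
  then have range_e: "range e = ?I" unfolding e_def using countI by (rule range_from_nat_into)
  define J where "J x = ternary_code (\<lambda>j. snd (e j) < x \<bullet> fst (e j))" for x
  \<comment> \<open>Extended reals give the supremum a meaning for every \<open>r\<close>, also off
    the range of \<open>J\<close>; infinite values become 0 in \<open>L\<close>.\<close>
  define l where "l b r = (SUP j. if fst (e j) = b \<and> (ternary_step ^^ j) r > 1/2 then ereal (snd (e j)) else -\<infinity>)" for b r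
  define L where "L r = (\<Sum>b\<in>Basis. real_of_ereal (l b r) *\<^sub>R b)" for r
  have [measurable]: "ternary_step \<in> borel_measurable borel"
    unfolding ternary_step_def[abs_def] by measurable
  have [measurable]: "(ternary_step ^^ j) \<in> borel_measurable borel" for j
    by (induction j) (auto simp: id_def comp_def)
  have [measurable]: "l b \<in> borel_measurable borel" for b
    unfolding l_def by measurable
  show ?thesis
  proof (rule that[of J L])
    show "J \<in> borel_measurable borel"
      unfolding J_def[abs_def] ternary_code_def by measurable
    show "L \<in> borel_measurable borel"
      unfolding L_def[abs_def] by measurable
    fix x
    have "l b (J x) = ereal (x \<bullet> b)" if b: "b \<in> Basis" for b
    proof (rule antisym)
      show "l b (J x) \<le> ereal (x \<bullet> b)"
        unfolding l_def J_def ternary_digits by (intro SUP_least) auto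
      show "ereal (x \<bullet> b) \<le> l b (J x)"
      proof (rule ccontr)
        assume "\<not> ereal (x \<bullet> b) \<le> l b (J x)"
        then obtain z where z: "l b (J x) < ereal z" "z < x \<bullet> b"
          using ereal_dense2[of "l b (J x)" "ereal (x \<bullet> b)"] by (auto simp: not_le)
        obtain q where q: "q \<in> \<rat>" "z < q" "q < x \<bullet> b"
          using Rats_dense_in_real[OF z(2)] by blast
        have "(b, q) \<in> range e" using b q(1) by (simp add: range_e)
        then obtain j where j: "e j = (b, q)" by (metis imageE)
        have "ereal q = (if fst (e j) = b \<and> (ternary_step ^^ j) (J x) > 1/2 then ereal (snd (e j)) else -\<infinity>)"
          unfolding J_def ternary_digits using q(3) by (simp add: j)
        also have "\<dots> \<le> l b (J x)" unfolding l_def by (rule SUP_upper) simp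
        also have "\<dots> < ereal z" by (rule z(1))
        finally show False using q(2) by simp
      qed
    qed
    then show "L (J x) = x"
      by (simp add: L_def euclidean_representation)
  qed
qed

section \<open>Distribution functions without atoms\<close>

lemma (in finite_borel_measure) atomless_cdf_surj:
  assumes atomless: "\<And>x. measure M {x} = 0" and c: "0 < c" "c < measure M (space M)"
  obtains z where "cdf M z = c"
proof -
  obtain a where a: "cdf M a < c"
    using order_tendstoD(2)[OF cdf_lim_at_bot c(1)] by (metis eventually_happens' trivial_limit_at_bot_linorder)
  obtain b where b: "c < cdf M b"
    using order_tendstoD(1)[OF cdf_lim_at_top c(2)] by (metis eventually_happens' trivial_limit_at_top_linorder)
  have "a \<le> b" using a b cdf_nondecreasing[of b a] by linarith
  then obtain z where "cdf M z = c"
    using IVT[of "cdf M" a c b] a b atomless isCont_cdf by (metis less_imp_le)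
  then show ?thesis by (rule that)
qed

text \<open>\<open>V\<close> is a sublevel set of \<open>X\<close> in \<open>U\<close>: without
  atoms the measure of these sets depends continuously on the level and takes every intermediate
  value.\<close>

lemma atomless_subset_of_measure:
  fixes X :: "'b \<Rightarrow> real"
  assumes [measurable]: "U \<in> sets M" "X \<in> borel_measurable M" and atomless: "\<And>c. emeasure M {x \<in> space M. X x = c} = 0"
    and m: "0 < m" "ennreal m \<le> emeasure M U" and fin: "emeasure M U \<noteq> \<infinity>"
  obtains V where "V \<in> sets M" "V \<subseteq> U" "emeasure M V = ennreal m"
proof (cases "emeasure M U = ennreal m")
  case True
  then show ?thesis using that[of U] assms(1) by simp
next
  case False
  define N where "N = distr (restrict_space M U) borel X"
  have UM: "U \<inter> space M = U" using sets.sets_into_space[OF assms(1)] by auto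
  have [measurable]: "X \<in> borel_measurable (restrict_space M U)"
    by (rule measurable_restrict_space1) simp
  have N: "emeasure N B = emeasure M {x \<in> U. X x \<in> B}" if [measurable]: "B \<in> sets borel" for B
  proof -
    have "X -` B \<inter> space (restrict_space M U) = {x \<in> U. X x \<in> B}"
      using UM by (auto simp: space_restrict_space)
    then show ?thesis
      unfolding N_def by (subst emeasure_distr) (auto simp: UM intro!: emeasure_restrict_space)
  qed
  interpret N: finite_borel_measure N
  proof (intro finite_borel_measure.intro finite_measureI finite_borel_measure_axioms.intro)
    show "sets N = sets borel" by (simp add: N_def)
    show "emeasure N (space N) \<noteq> \<infinity>"
      using N[of UNIV] fin by (simp add: N_def)
  qed
  have total: "measure N (space N) = measure M U"
    using N[of UNIV] by (simp add: N_def measure_def)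
  have "emeasure N {c} = 0" for c
  proof -
    have "emeasure M {x \<in> U. X x = c} \<le> emeasure M {x \<in> space M. X x = c}"
      using sets.sets_into_space[OF assms(1)] by (intro emeasure_mono) auto
    then show ?thesis using atomless[of c] N[of "{c}"] by simp
  qed
  moreover have "m < measure N (space N)"
    unfolding total using m False fin
    by (simp add: emeasure_eq_ennreal_measure order.strict_iff_order)
  ultimately obtain z where z: "cdf N z = m"
    using N.atomless_cdf_surj[of m] m(1) by (auto simp: measure_def)
  have "emeasure M {x \<in> U. X x \<in> {..z}} = ennreal m"
    using z N[of "{..z}"] m(1) by (simp add: cdf_def N.emeasure_eq_measure)
  moreover have "{x \<in> U. X x \<in> {..z}} = U \<inter> (X -` {..z} \<inter> space M)"
    using sets.sets_into_space[OF assms(1)] by auto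
  then have "{x \<in> U. X x \<in> {..z}} \<in> sets M" by simp
  ultimately show ?thesis using that by blast
qed

text \<open>The distribution function may be constant on intervals, so its sublevel set is squeezed
  between \<open>X \<le> z\<close> with value \<open>c\<close> and \<open>X \<le> z'\<close> with a
  value \<open>c'\<close> slightly above \<open>c\<close>.\<close>

lemma (in prob_space) uniform_cdf_transform:
  fixes X :: "'a \<Rightarrow> real"
  assumes [measurable]: "X \<in> borel_measurable M" and atomless: "\<And>c. prob {x \<in> space M. X x = c} = 0"
    and c: "0 < c" "c < 1"
  shows "prob {x \<in> space M. cdf (distr M borel X) (X x) \<le> c} = c"
proof -
  let ?F = "cdf (distr M borel X)"
  interpret X: real_distribution "distr M borel X" by (rule real_distribution_distr) simp
  have F: "?F z = prob {x \<in> space M. X x \<le> z}" for z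
    by (simp add: cdf_def measure_distr vimage_def Int_def conj_commute)
  have ex: "\<exists>z. ?F z = c'" if "0 < c'" "c' < 1" for c'
  proof (rule X.atomless_cdf_surj)
    show "measure (distr M borel X) {z} = 0" for z
      using atomless[of z] by (simp add: measure_distr vimage_def Int_def conj_commute)
  qed (use that X.prob_space in auto)
  have [measurable]: "?F \<in> borel_measurable borel"
    by (intro borel_measurable_mono monoI X.cdf_nondecreasing)
  obtain z where z: "?F z = c" using ex[OF c] by blast
  have "c \<le> prob {x \<in> space M. ?F (X x) \<le> c}"
  proof -
    have "prob {x \<in> space M. X x \<le> z} \<le> prob {x \<in> space M. ?F (X x) \<le> c}"
      using X.cdf_nondecreasing z by (intro finite_measure_mono) auto
    then show ?thesis using z F by simp
  qed
  moreover have "prob {x \<in> space M. ?F (X x) \<le> c} \<le> c"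
  proof (rule dense_ge_bounded[OF c(2)])
    fix c' assume c': "c < c'" "c' < 1"
    then obtain z' where z': "?F z' = c'" using ex[of c'] c by auto
    have "X x \<le> z'" if "?F (X x) \<le> c" for x
    proof (rule ccontr)
      assume "\<not> X x \<le> z'"
      then have "?F z' \<le> ?F (X x)" by (intro X.cdf_nondecreasing) simp
      with that z' c' show False by simp
    qed
    then have "prob {x \<in> space M. ?F (X x) \<le> c} \<le> prob {x \<in> space M. X x \<le> z'}"
      by (intro finite_measure_mono) auto
    then show "prob {x \<in> space M. ?F (X x) \<le> c} \<le> c'" using z' F by simp
  qed
  ultimately show ?thesis by simp
qed

text \<open>The quantile transform, after both measures have been moved to the real line.\<close>

lemma (in prob_space) exists_transport_from_atomless:
  fixes X :: "'a \<Rightarrow> real" and N :: "'b::euclidean_space measure"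
  assumes [measurable]: "X \<in> borel_measurable M" and atomless: "\<And>c. prob {x \<in> space M. X x = c} = 0"
    and N: "prob_space N" and sets_N [measurable_cong]: "sets N = sets borel"
  obtains s where "s \<in> borel_measurable M" "distr M borel s = N"
proof -
  obtain J :: "'b \<Rightarrow> real" and L :: "real \<Rightarrow> 'b"
    where [measurable]: "J \<in> borel_measurable borel" "L \<in> borel_measurable borel" and LJ: "\<And>x. L (J x) = x"
    by (rule borel_coding_real) blast
  let ?F = "cdf (distr M borel X)"
  interpret X: real_distribution "distr M borel X" by (rule real_distribution_distr) simp
  interpret Q: cdf_distribution "distr N borel J"
    using prob_space.real_distribution_distr[OF N, of J] by (simp add: cdf_distribution_def)
  have [measurable]: "?F \<in> borel_measurable borel"
    by (intro borel_measurable_mono monoI X.cdf_nondecreasing)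
  \<comment> \<open>The quantile function of the coded target, extended by 0. The extension is seen
    only on a null set, as the transformed variable lies in the open unit interval almost
    surely.\<close>
  define I where "I w = (if w \<in> {0<..<1} then Q.I w else 0)" for w
  have [measurable]: "I \<in> borel_measurable borel"
    unfolding I_def[abs_def] using Q.measurable_CI
    by (subst (asm) measurable_restrict_space_iff[where c = 0]) auto
  have unif: "prob {x \<in> space M. ?F (X x) \<le> c} = c" if "0 < c" "c < 1" for c
    by (rule uniform_cdf_transform[OF assms(1) atomless that])
  have AE01: "AE x in M. ?F (X x) \<in> {0<..<1}"
  proof -
    have "prob {x \<in> space M. ?F (X x) \<le> 0} \<le> 0"
    proof (rule dense_ge_bounded[of 0 1])
      fix c :: real assume c: "0 < c" "c < 1"
      have "prob {x \<in> space M. ?F (X x) \<le> 0} \<le> prob {x \<in> space M. ?F (X x) \<le> c}"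
        using c by (intro finite_measure_mono) auto
      then show "prob {x \<in> space M. ?F (X x) \<le> 0} \<le> c" using unif[OF c] by simp
    qed simp
    then have 0: "AE x in M. \<not> ?F (X x) \<le> 0"
      by (subst AE_iff_measurable[OF _ refl]) (auto simp: emeasure_eq_measure measure_le_0_iff)
    have "1 \<le> prob {x \<in> space M. ?F (X x) < 1}"
    proof (rule dense_le_bounded[of 0 1])
      fix c :: real assume c: "0 < c" "c < 1"
      have "prob {x \<in> space M. ?F (X x) \<le> c} \<le> prob {x \<in> space M. ?F (X x) < 1}"
        using c by (intro finite_measure_mono) auto
      then show "c \<le> prob {x \<in> space M. ?F (X x) < 1}" using unif[OF c] by simp
    qed simp
    then have "prob {x \<in> space M. ?F (X x) < 1} = 1"
      using prob_le_1 by (intro antisym) auto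
    then have "AE x in M. ?F (X x) < 1"
      by (subst (asm) prob_Collect_eq_1) auto
    with 0 show ?thesis by eventually_elim auto
  qed
  have IFX: "distr M borel (\<lambda>x. I (?F (X x))) = distr N borel J"
  proof (rule cdf_unique)
    show "real_distribution (distr M borel (\<lambda>x. I (?F (X x))))"
      by (rule real_distribution_distr) measurable
    show "real_distribution (distr N borel J)" by (rule Q.real_distribution_axioms)
    show "cdf (distr M borel (\<lambda>x. I (?F (X x)))) = cdf (distr N borel J)"
    proof
      fix z
      let ?c = "cdf (distr N borel J) z"
      have c: "0 \<le> ?c" "?c \<le> 1" using Q.cdf_nonneg Q.cdf_bounded_prob by auto
      have "cdf (distr M borel (\<lambda>x. I (?F (X x)))) z = prob {x \<in> space M. I (?F (X x)) \<le> z}"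
        by (simp add: cdf_def measure_distr vimage_def Int_def conj_commute)
      also have "\<dots> = prob {x \<in> space M. ?F (X x) \<le> ?c}"
      proof (rule finite_measure_eq_AE)
        show "AE x in M. x \<in> {x \<in> space M. I (?F (X x)) \<le> z} \<longleftrightarrow> x \<in> {x \<in> space M. ?F (X x) \<le> ?c}"
          using AE01
        proof eventually_elim
          case (elim x)
          then have "(?F (X x) \<le> ?c) = (Q.I (?F (X x)) \<le> z)"
            by (intro Q.pseudoinverse) auto
          then show ?case using elim by (simp only: I_def if_True mem_Collect_eq)
        qed
      qed measurable
      also have "\<dots> = ?c"
      proof -
        consider "?c = 0" | "0 < ?c" "?c < 1" | "?c = 1" using c by linarith
        then show ?thesis
        proof cases
          case 1
          have "prob {x \<in> space M. ?F (X x) \<le> ?c} = prob {}"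
          proof (intro finite_measure_eq_AE)
            show "AE x in M. x \<in> {x \<in> space M. ?F (X x) \<le> ?c} \<longleftrightarrow> x \<in> {}"
              using AE01 by eventually_elim (simp add: 1)
          qed measurable
          then show ?thesis using 1 by simp
        next
          case 3
          have "prob {x \<in> space M. ?F (X x) \<le> ?c} = prob (space M)"
          proof (intro finite_measure_eq_AE)
            show "AE x in M. x \<in> {x \<in> space M. ?F (X x) \<le> ?c} \<longleftrightarrow> x \<in> space M"
              using AE01 by eventually_elim (simp add: 3)
          qed measurable
          then show ?thesis using 3 prob_space by simp
        qed (rule unif)
      qed
      finally show "cdf (distr M borel (\<lambda>x. I (?F (X x)))) z = ?c" .
    qed
  qed
  show ?thesis
  proof (rule that[of "\<lambda>x. L (I (?F (X x)))"])
    have "distr M borel (\<lambda>x. L (I (?F (X x)))) = distr (distr M borel (\<lambda>x. I (?F (X x)))) borel L"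
      by (subst distr_distr) (auto simp: comp_def)
    also have "\<dots> = distr N borel (\<lambda>x. L (J x))"
      unfolding IFX by (subst distr_distr) (auto simp: comp_def)
    also have "\<dots> = N" using distr_id2[OF sets_N[symmetric]] by (simp add: LJ)
    finally show "distr M borel (\<lambda>x. L (I (?F (X x)))) = N" .
  qed measurable
qed

section \<open>Optimality implies cyclical monotonicity\<close>

text \<open>A greedy choice. The sets \<open>U i\<close> may overlap or coincide, since points of a
  cycle may repeat; after \<open>k < N\<close> choices at most \<open>k m\<close> of the mass
  \<open>N m\<close> of the next set is used up, so at least \<open>m\<close> remains.\<close>

lemma disjoint_subsets_of_equal_measure:
  fixes X :: "'b \<Rightarrow> real" and U :: "nat \<Rightarrow> 'b set"
  assumes "finite_measure M" and X: "X \<in> borel_measurable M" and atomless: "\<And>c. emeasure M {x \<in> space M. X x = c} = 0"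
    and U: "\<And>i. i < N \<Longrightarrow> U i \<in> sets M" and m: "0 < m" "\<And>i. i < N \<Longrightarrow> real N * m \<le> measure M (U i)"
  shows "k \<le> N \<Longrightarrow> \<exists>V. (\<forall>i<k. V i \<in> sets M \<and> V i \<subseteq> U i \<and> emeasure M (V i) = ennreal m) \<and> disjoint_family_on V {..<k}"
proof (induction k)
  case 0
  show ?case by (simp add: disjoint_family_on_def)
next
  case (Suc k)
  interpret finite_measure M by fact
  from Suc obtain V where V: "\<And>i. i < k \<Longrightarrow> V i \<in> sets M" "\<And>i. i < k \<Longrightarrow> V i \<subseteq> U i"
    "\<And>i. i < k \<Longrightarrow> emeasure M (V i) = ennreal m" and disj: "disjoint_family_on V {..<k}"
    by auto
  have "k < N" using Suc.prems by simp
  let ?W = "\<Union>i<k. V i"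
  have W: "?W \<in> sets M" using V(1) by auto
  have "measure M ?W \<le> (\<Sum>i<k. measure M (V i))"
    using V(1) by (intro measure_UNION_le) auto
  also have "\<dots> = real k * m" using V(3) m(1) by (simp add: measure_def)
  finally have "measure M ?W \<le> real k * m" .
  moreover have "real N * m \<le> measure M (U k)" by (rule m(2)[OF \<open>k < N\<close>])
  moreover have "real k * m + m \<le> real N * m"
    using \<open>k < N\<close> m(1) mult_right_mono[of "real k + 1" "real N" m] by (simp add: distrib_right)
  moreover have "measure M (U k) \<le> measure M (U k - ?W) + measure M ?W"
    using U[OF \<open>k < N\<close>] W finite_measure_mono[of "U k" "(U k - ?W) \<union> ?W"] measure_Un_le[of "U k - ?W" M ?W] by auto
  ultimately have "m \<le> measure M (U k - ?W)" by linarith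
  then have "ennreal m \<le> emeasure M (U k - ?W)" by (simp add: emeasure_eq_measure ennreal_leI)
  then obtain V' where V': "V' \<in> sets M" "V' \<subseteq> U k - ?W" "emeasure M V' = ennreal m"
    using atomless_subset_of_measure[of "U k - ?W" M X m] U[OF \<open>k < N\<close>] W X atomless m(1) by auto
  define V2 where "V2 = V(k := V')"
  have "disjoint_family_on V2 {..<Suc k}"
    using disj V'(2) unfolding disjoint_family_on_def V2_def by (auto simp: less_Suc_eq; blast)
  moreover have "\<forall>i<Suc k. V2 i \<in> sets M \<and> V2 i \<subseteq> U i \<and> emeasure M (V2 i) = ennreal m"
    using V V' by (auto simp: V2_def less_Suc_eq)
  ultimately show ?case by blast
qed

text \<open>The property says that \<open>(x, T x)\<close> lies in the support of the push-forward
  of \<open>M\<close> under \<open>(id, T)\<close>. Points outside it fall into one of countably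
  many basic open sets without mass.\<close>

lemma AE_in_essential_graph:
  fixes T :: "'a::euclidean_space \<Rightarrow> 'a"
  assumes [measurable]: "(\<lambda>x. x) \<in> borel_measurable M" "T \<in> borel_measurable M"
  shows "AE x in M. \<forall>e>0. 0 < emeasure M {z \<in> space M. dist z x < e \<and> dist (T z) (T x) < e}"
proof -
  obtain B :: "('a \<times> 'a) set set" where B: "countable B" "topological_basis B"
    using ex_countable_basis by blast
  have openB: "open b" if "b \<in> B" for b using B(2) that by (rule topological_basis_open)
  define Z where "Z b = {z \<in> space M. (z, T z) \<in> b}" for b
  have Z [measurable]: "Z b \<in> sets M" if "open b" for b
  proof -
    have "(\<lambda>z. (z, T z)) \<in> borel_measurable M" by measurable
    from measurable_sets[OF this, of b] that show ?thesis by (simp add: Z_def vimage_def Int_def conj_commute)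
  qed
  define B0 where "B0 = {b \<in> B. Z b \<in> null_sets M}"
  have "(\<Union>b\<in>B0. Z b) \<in> null_sets M"
    using B(1) by (intro null_sets_UN') (auto simp: B0_def intro: countable_subset)
  then have "AE x in M. x \<notin> (\<Union>b\<in>B0. Z b)" by (rule AE_not_in)
  then show ?thesis
    using AE_space
  proof eventually_elim
    case (elim x)
    show ?case
    proof (intro allI impI)
      fix e :: real assume "0 < e"
      let ?O = "ball x e \<times> ball (T x) e"
      have "open ?O" "(x, T x) \<in> ?O" using \<open>0 < e\<close> by (auto intro: open_Times)
      then obtain b where b: "b \<in> B" "(x, T x) \<in> b" "b \<subseteq> ?O"
        using topological_basisE[OF B(2)] by metis
      have "x \<in> Z b" using b elim by (simp add: Z_def)
      then have "Z b \<notin> null_sets M" using elim b(1) by (auto simp: B0_def)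
      then have "0 < emeasure M (Z b)"
        using Z[OF openB[OF b(1)]] by (auto simp: null_sets_def zero_less_iff_neq_zero)
      also have "\<dots> \<le> emeasure M (Z ?O)"
        using b(3) Z[OF \<open>open ?O\<close>] by (intro emeasure_mono) (auto simp: Z_def)
      also have "Z ?O = {z \<in> space M. dist z x < e \<and> dist (T z) (T x) < e}"
        by (auto simp: Z_def dist_commute)
      finally show "0 < emeasure M {z \<in> space M. dist z x < e \<and> dist (T z) (T x) < e}" .
    qed
  qed
qed

text \<open>Both sides are continuous in \<open>e\<close> at 0. The shift is \<open>2 * e\<close>
  because source point and image point may each move by \<open>e\<close>.\<close>

lemma strict_sum_inequality_stable:
  fixes a b :: "nat \<Rightarrow> real"
  assumes "(\<Sum>i<N. (a i)\<^sup>2) < (\<Sum>i<N. (b i)\<^sup>2)" "\<And>i. 0 \<le> b i"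
  obtains e where "0 < e" "(\<Sum>i<N. (a i + 2 * e)\<^sup>2) < (\<Sum>i<N. (max 0 (b i - 2 * e))\<^sup>2)"
proof -
  let ?f = "\<lambda>e. (\<Sum>i<N. (max 0 (b i - 2 * e))\<^sup>2) - (\<Sum>i<N. (a i + 2 * e)\<^sup>2)"
  have "(?f \<longlongrightarrow> (\<Sum>i<N. (max 0 (b i - 2 * 0))\<^sup>2) - (\<Sum>i<N. (a i + 2 * 0)\<^sup>2)) (at_right 0)"
    by (intro tendsto_intros)
  then have "\<forall>\<^sub>F e in at_right 0. 0 < ?f e"
    using assms by (intro order_tendstoD(1)) (auto simp: max_absorb2)
  moreover have "\<forall>\<^sub>F e in at_right (0::real). 0 < e" by (rule eventually_at_right_less)
  ultimately have "\<forall>\<^sub>F e in at_right 0. 0 < e \<and> 0 < ?f e" by eventually_elim simp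
  then obtain e where "0 < e" "0 < ?f e"
    using eventually_happens'[of "at_right (0::real)"] by auto
  then show ?thesis using that[of e] by simp
qed

text \<open>
  Interchanging the values of \<open>T\<close> between small neighbourhoods of the points of a cycle along
  which cyclical monotonicity fails lowers the cost.
\<close>

lemma optimal_imp_cyclically_monotone:
  fixes T :: "'a::euclidean_space \<Rightarrow> 'a" and M :: "'a measure"
  assumes fin: "finite_measure M" and sets_M: "space M = UNIV"
    and [measurable]: "(\<lambda>x. x) \<in> borel_measurable M" "T \<in> borel_measurable M"
    and hyperplane: "\<And>b c. b \<in> Basis \<Longrightarrow> emeasure M {x. x \<bullet> b = c} = 0"
    and cost: "(\<integral>\<^sup>+x. ennreal ((norm (T x - x))\<^sup>2) \<partial>M) \<noteq> \<infinity>"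
    and opt: "\<And>S. S \<in> borel_measurable M \<Longrightarrow> distr M borel S = distr M borel T \<Longrightarrow>
      (\<integral>\<^sup>+x. ennreal ((norm (T x - x))\<^sup>2) \<partial>M) \<le> (\<integral>\<^sup>+x. ennreal ((norm (S x - x))\<^sup>2) \<partial>M)"
    and G: "\<And>x. x \<in> G \<Longrightarrow> \<forall>e>0. 0 < emeasure M {z \<in> space M. dist z x < e \<and> dist (T z) (T x) < e}"
  shows "cyclically_monotone_on G T"
  unfolding cyclically_monotone_on_def
proof (intro allI impI, rule ccontr)
  interpret finite_measure M by fact
  fix x :: "nat \<Rightarrow> 'a" and N
  assume xG: "\<forall>i. x i \<in> G" and xN: "x N = x 0" and "\<not> (\<Sum>i<N. T (x i) \<bullet> (x (Suc i) - x i)) \<le> 0"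
  then have pos: "0 < (\<Sum>i<N. T (x i) \<bullet> (x (Suc i) - x i))" by simp
  then have "0 < N" by (cases N) auto
  \<comment> \<open>\<open>p\<close> is the cyclic predecessor. The new map sends the piece near
    \<open>x j\<close> to where \<open>T\<close> sent the piece near its predecessor, so its cost is
    measured by \<open>a (p j)\<close>.\<close>
  define p where "p j = (if j = 0 then N - 1 else j - 1)" for j
  have p_less: "p j < N" if "j < N" for j using that by (auto simp: p_def)
  have x_p: "x (Suc (p j)) = x j" if "j < N" for j using that xN \<open>0 < N\<close> by (cases j) (auto simp: p_def)
  have bij: "bij_betw p {..<N} {..<N}"
  proof (rule bij_betw_byWitness[where f' = "\<lambda>i. if i = N - 1 then 0 else Suc i"])
    show "\<forall>j\<in>{..<N}. (if p j = N - 1 then 0 else Suc (p j)) = j" by (auto simp: p_def)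
    show "\<forall>i\<in>{..<N}. p (if i = N - 1 then 0 else Suc i) = i" by (auto simp: p_def)
  qed (auto simp: p_def)
  define a where "a i = norm (T (x i) - x (Suc i))" for i
  define b where "b i = norm (T (x i) - x i)" for i
  \<comment> \<open>Expanding the squares, everything cancels around the cycle except twice the sum
    in the definition of cyclical monotonicity; a positive sum makes the shifted assignment strictly
    cheaper.\<close>
  have "(\<Sum>i<N. (b i)\<^sup>2) - (\<Sum>i<N. (a i)\<^sup>2) =
    (\<Sum>i<N. 2 * (T (x i) \<bullet> (x (Suc i) - x i)) - (x (Suc i) \<bullet> x (Suc i) - x i \<bullet> x i))"
    unfolding sum_subtractf[symmetric]
    by (intro sum.cong) (auto simp: a_def b_def power2_norm_eq_inner inner_diff_left inner_diff_right inner_commute)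
  also have "\<dots> = 2 * (\<Sum>i<N. T (x i) \<bullet> (x (Suc i) - x i))"
    using sum_lessThan_telescope[of "\<lambda>i. x i \<bullet> x i" N] xN by (simp add: sum_subtractf sum_distrib_left)
  finally have "(\<Sum>i<N. (a i)\<^sup>2) < (\<Sum>i<N. (b i)\<^sup>2)" using pos by simp
  then obtain e where e: "0 < e" "(\<Sum>i<N. (a i + 2 * e)\<^sup>2) < (\<Sum>i<N. (max 0 (b i - 2 * e))\<^sup>2)"
    by (rule strict_sum_inequality_stable) (auto simp: b_def)
  define U where "U i = {z \<in> space M. dist z (x i) < e \<and> dist (T z) (T (x i)) < e}" for i
  have [measurable]: "U i \<in> sets M" for i unfolding U_def by measurable
  have U_pos: "0 < measure M (U i)" for i
    using G[of "x i"] xG e(1) by (simp add: U_def emeasure_eq_measure)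
  \<comment> \<open>Division by \<open>N\<close> leaves room for \<open>N\<close> disjoint pieces
    even when all neighbourhoods coincide.\<close>
  define m where "m = Min ((\<lambda>i. measure M (U i)) ` {..<N}) / real N"
  have Min: "0 < Min ((\<lambda>i. measure M (U i)) ` {..<N})"
    using U_pos \<open>0 < N\<close> by (subst Min_gr_iff) auto
  then have "0 < m" using \<open>0 < N\<close> by (simp add: m_def)
  have m_le: "real N * m \<le> measure M (U i)" if "i < N" for i
    using that \<open>0 < N\<close> by (auto simp: m_def intro!: Min_le)
  obtain b0 :: 'a where b0: "b0 \<in> Basis" using nonempty_Basis by blast
  obtain V where V: "\<And>i. i < N \<Longrightarrow> V i \<in> sets M" "\<And>i. i < N \<Longrightarrow> V i \<subseteq> U i"
    "\<And>i. i < N \<Longrightarrow> emeasure M (V i) = ennreal m" and disj: "disjoint_family_on V {..<N}"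
  proof -
    have "\<exists>V. (\<forall>i<N. V i \<in> sets M \<and> V i \<subseteq> U i \<and> emeasure M (V i) = ennreal m) \<and> disjoint_family_on V {..<N}"
    proof (rule disjoint_subsets_of_equal_measure[OF fin, where X = "\<lambda>x. x \<bullet> b0" and N = N and k = N and m = m])
      show "emeasure M {x \<in> space M. x \<bullet> b0 = c} = 0" for c
        using hyperplane[OF b0] sets_M by simp
    qed (use \<open>0 < m\<close> m_le in auto)
    then show ?thesis using that by blast
  qed
  have prob: "prob_space (uniform_measure M (V i))" if "i < N" for i
    using V(3)[OF that] \<open>0 < m\<close> by (intro prob_space_uniform_measure) auto
  have unif: "(\<integral>\<^sup>+z. h z \<partial>uniform_measure M (V i)) = (\<integral>\<^sup>+z. h z * indicator (V i) z \<partial>M) / ennreal m"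
    if "i < N" "h \<in> borel_measurable M" for i and h :: "'a \<Rightarrow> ennreal"
    using nn_integral_uniform_measure[OF that(2) V(1)[OF that(1)]] V(3)[OF that(1)] by simp
  have "\<exists>s. s \<in> borel_measurable M \<and> distr (uniform_measure M (V j)) borel s = distr (uniform_measure M (V (p j))) borel T"
    if j: "j < N" for j
  proof -
    interpret j: prob_space "uniform_measure M (V j)" by (rule prob[OF j])
    interpret pj: prob_space "uniform_measure M (V (p j))" by (rule prob[OF p_less[OF j]])
    have "j.prob {x \<in> space (uniform_measure M (V j)). x \<bullet> b0 = c} = 0" for c
    proof -
      have "emeasure M (V j \<inter> {x. x \<bullet> b0 = c}) \<le> emeasure M {x. x \<bullet> b0 = c}"
      proof (rule emeasure_mono)
        have "{z \<in> space M. z \<bullet> b0 = c} \<in> sets M" by measurable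
        then show "{x. x \<bullet> b0 = c} \<in> sets M" by (simp add: sets_M)
      qed auto
      then have "emeasure M (V j \<inter> {x. x \<bullet> b0 = c}) = 0" using hyperplane[OF b0] by simp
      moreover have "{z \<in> space M. z \<bullet> b0 = c} \<in> sets M" by measurable
      then have "{x. x \<bullet> b0 = c} \<in> sets M" by (simp add: sets_M)
      ultimately show ?thesis
        using V(1)[OF j] by (simp add: measure_def sets_M)
    qed
    note atom = this
    show ?thesis
    proof (rule j.exists_transport_from_atomless[of "\<lambda>x. x \<bullet> b0", OF _ atom])
      show "prob_space (distr (uniform_measure M (V (p j))) borel T)"
        by (rule pj.prob_space_distr) simp
      fix s assume "s \<in> borel_measurable (uniform_measure M (V j))"
        "distr (uniform_measure M (V j)) borel s = distr (uniform_measure M (V (p j))) borel T"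
      then show ?thesis by (intro exI[of _ s]) simp
    qed simp_all
  qed
  then obtain \<sigma> where \<sigma> [measurable]: "\<And>j. j < N \<Longrightarrow> \<sigma> j \<in> borel_measurable M"
    and \<sigma>_distr: "\<And>j. j < N \<Longrightarrow> distr (uniform_measure M (V j)) borel (\<sigma> j) = distr (uniform_measure M (V (p j))) borel T"
    by metis
  define W where "W = space M - (\<Union>j<N. V j)"
  have W_sets [measurable]: "W \<in> sets M" unfolding W_def using V(1) by auto
  have cover: "(\<exists>j<N. z \<in> V j \<and> z \<notin> W \<and> (\<forall>i<N. i \<noteq> j \<longrightarrow> z \<notin> V i)) \<or> (z \<in> W \<and> (\<forall>i<N. z \<notin> V i))" for z
  proof (cases "\<exists>j<N. z \<in> V j")
    case True
    then obtain j where j: "j < N" "z \<in> V j" by blast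
    then have "z \<notin> V i" if "i < N" "i \<noteq> j" for i
      using disj that unfolding disjoint_family_on_def by blast
    with j show ?thesis by (auto simp: W_def)
  qed (auto simp: W_def sets_M)
  \<comment> \<open>On the piece \<open>V j\<close> the map \<open>\<sigma> j\<close> reproduces the
    law of \<open>T\<close> on \<open>V (p j)\<close>; elsewhere \<open>T\<close> is kept. The
    pieces have equal mass and \<open>p\<close> permutes them, so the push-forward is
    unchanged.\<close>
  define S where "S z = (\<Sum>j<N. indicator (V j) z *\<^sub>R \<sigma> j z) + indicator W z *\<^sub>R T z" for z
  have S_V: "S z = \<sigma> j z" if "j < N" "z \<in> V j" for j z
  proof -
    have "(\<Sum>i<N. indicator (V i) z *\<^sub>R \<sigma> i z) = (\<Sum>i<N. if i = j then \<sigma> j z else 0)"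
      using cover[of z] that by (intro sum.cong) (auto simp: indicator_def)
    then show ?thesis using cover[of z] that by (auto simp: S_def)
  qed
  have S_W: "S z = T z" if "z \<in> W" for z
    using cover[of z] that by (auto simp: S_def indicator_def intro!: sum.neutral)
  have S [measurable]: "S \<in> borel_measurable M"
    unfolding S_def[abs_def]
    by (intro borel_measurable_add borel_measurable_sum borel_measurable_scaleR borel_measurable_indicator \<sigma> V(1)) auto
  have split: "(\<integral>\<^sup>+z. h z (R z) \<partial>M) = (\<Sum>j<N. \<integral>\<^sup>+z. h z (R z) * indicator (V j) z \<partial>M) + (\<integral>\<^sup>+z. h z (R z) * indicator W z \<partial>M)"
    if h: "(\<lambda>z. h z (R z)) \<in> borel_measurable M" for h :: "'a \<Rightarrow> 'a \<Rightarrow> ennreal" and R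
  proof -
    have "(\<integral>\<^sup>+z. h z (R z) \<partial>M) = (\<integral>\<^sup>+z. (\<Sum>j<N. h z (R z) * indicator (V j) z) + h z (R z) * indicator W z \<partial>M)"
    proof (rule nn_integral_cong)
      fix z
      have "(\<Sum>j<N. indicator (V j) z) + indicator W z = (1::ennreal)"
      proof (cases "z \<in> W")
        case True
        then show ?thesis using cover[of z] by (auto intro!: sum.neutral)
      next
        case False
        then obtain j where j: "j < N" "z \<in> V j" "\<forall>i<N. i \<noteq> j \<longrightarrow> z \<notin> V i" using cover[of z] by auto
        then have "(\<Sum>i<N. indicator (V i) z) = (\<Sum>i<N. if i = j then 1 else (0::ennreal))"
          by (intro sum.cong) (auto simp: indicator_def)
        then show ?thesis using False j by simp
      qed
      then show "h z (R z) = (\<Sum>j<N. h z (R z) * indicator (V j) z) + h z (R z) * indicator W z"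
        by (simp add: sum_distrib_left[symmetric] distrib_left[symmetric])
    qed
    also have "\<dots> = (\<Sum>j<N. \<integral>\<^sup>+z. h z (R z) * indicator (V j) z \<partial>M) + (\<integral>\<^sup>+z. h z (R z) * indicator W z \<partial>M)"
    proof -
      have mV: "(\<lambda>z. h z (R z) * indicator (V j) z) \<in> borel_measurable M" if "j \<in> {..<N}" for j
        using that by (intro borel_measurable_times_ennreal h borel_measurable_indicator V(1)) simp
      have mW: "(\<lambda>z. h z (R z) * indicator W z) \<in> borel_measurable M"
        by (intro borel_measurable_times_ennreal h borel_measurable_indicator W_sets)
      have 1: "(\<integral>\<^sup>+z. (\<Sum>j<N. h z (R z) * indicator (V j) z) \<partial>M) = (\<Sum>j<N. \<integral>\<^sup>+z. h z (R z) * indicator (V j) z \<partial>M)"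
        by (rule nn_integral_sum[OF mV])
      have "(\<lambda>z. \<Sum>j<N. h z (R z) * indicator (V j) z) \<in> borel_measurable M"
        by (rule borel_measurable_sum[OF mV])
      from nn_integral_add[OF this mW] show ?thesis by (simp only: 1)
    qed
    finally show ?thesis .
  qed
  have scaled: "ennreal m * (x / ennreal m) = x" for x
    using \<open>0 < m\<close> by (simp add: ennreal_times_divide ennreal_mult_divide_eq mult.commute)
  have push: "(\<integral>\<^sup>+z. h (\<sigma> j z) * indicator (V j) z \<partial>M) = (\<integral>\<^sup>+z. h (T z) * indicator (V (p j)) z \<partial>M)"
    if j: "j < N" and [measurable]: "h \<in> borel_measurable borel" for j and h :: "'a \<Rightarrow> ennreal"
  proof -
    have [measurable]: "\<sigma> j \<in> borel_measurable M" by (rule \<sigma>[OF j])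
    have "(\<integral>\<^sup>+z. h (\<sigma> j z) * indicator (V j) z \<partial>M) / ennreal m = (\<integral>\<^sup>+z. h (\<sigma> j z) \<partial>uniform_measure M (V j))"
      by (rule unif[OF j, symmetric]) measurable
    also have "\<dots> = (\<integral>\<^sup>+y. h y \<partial>distr (uniform_measure M (V j)) borel (\<sigma> j))"
      by (rule nn_integral_distr[symmetric]) auto
    also have "\<dots> = (\<integral>\<^sup>+y. h y \<partial>distr (uniform_measure M (V (p j))) borel T)"
      by (simp only: \<sigma>_distr[OF j])
    also have "\<dots> = (\<integral>\<^sup>+z. h (T z) \<partial>uniform_measure M (V (p j)))"
      by (rule nn_integral_distr) auto
    also have "\<dots> = (\<integral>\<^sup>+z. h (T z) * indicator (V (p j)) z \<partial>M) / ennreal m"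
      by (rule unif[OF p_less[OF j]]) measurable
    finally have "ennreal m * ((\<integral>\<^sup>+z. h (\<sigma> j z) * indicator (V j) z \<partial>M) / ennreal m) =
      ennreal m * ((\<integral>\<^sup>+z. h (T z) * indicator (V (p j)) z \<partial>M) / ennreal m)" by simp
    then show ?thesis by (simp only: scaled)
  qed
  have "distr M borel S = distr M borel T"
  proof (rule measure_eqI)
    fix A assume "A \<in> sets (distr M borel S)"
    then have [measurable]: "A \<in> sets borel" by simp
    have em: "emeasure (distr M borel R) A = (\<integral>\<^sup>+z. indicator A (R z) \<partial>M)" if [measurable]: "R \<in> borel_measurable M" for R
      by (subst nn_integral_distr[symmetric, of R M borel "indicator A"]) auto
    have "(\<integral>\<^sup>+z. indicator A (S z) \<partial>M) = (\<Sum>j<N. \<integral>\<^sup>+z. indicator A (S z) * indicator (V j) z \<partial>M) + (\<integral>\<^sup>+z. indicator A (S z) * indicator W z \<partial>M)"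
      by (rule split[of "\<lambda>_. indicator A"]) measurable
    also have "(\<Sum>j<N. \<integral>\<^sup>+z. indicator A (S z) * indicator (V j) z \<partial>M) = (\<Sum>j<N. \<integral>\<^sup>+z. indicator A (\<sigma> j z) * indicator (V j) z \<partial>M)"
      by (intro sum.cong nn_integral_cong) (auto simp: S_V indicator_def)
    also have "\<dots> = (\<Sum>j<N. \<integral>\<^sup>+z. indicator A (T z) * indicator (V (p j)) z \<partial>M)"
      by (intro sum.cong push) auto
    also have "\<dots> = (\<Sum>j<N. \<integral>\<^sup>+z. indicator A (T z) * indicator (V j) z \<partial>M)"
      by (rule sum.reindex_bij_betw[OF bij])
    also have "(\<integral>\<^sup>+z. indicator A (S z) * indicator W z \<partial>M) = (\<integral>\<^sup>+z. indicator A (T z) * indicator W z \<partial>M)"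
      by (intro nn_integral_cong) (auto simp: S_W indicator_def)
    also have "(\<Sum>j<N. \<integral>\<^sup>+z. indicator A (T z) * indicator (V j) z \<partial>M) + \<dots> = (\<integral>\<^sup>+z. indicator A (T z) \<partial>M)"
      by (rule split[of "\<lambda>_. indicator A", symmetric]) measurable
    finally show "emeasure (distr M borel S) A = emeasure (distr M borel T) A"
      by (simp add: em)
  qed simp
  then have le: "(\<integral>\<^sup>+z. ennreal ((norm (T z - z))\<^sup>2) \<partial>M) \<le> (\<integral>\<^sup>+z. ennreal ((norm (S z - z))\<^sup>2) \<partial>M)"
    by (intro opt S)
  let ?c = "\<lambda>z y. ennreal ((norm (y - z))\<^sup>2)"
  \<comment> \<open>The common cost off the pieces. Its finiteness lets the strict inequality on the
    pieces survive the addition.\<close>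
  define out where "out = (\<integral>\<^sup>+z. ?c z (T z) * indicator W z \<partial>M)"
  have "out \<le> (\<integral>\<^sup>+z. ?c z (T z) \<partial>M)"
    unfolding out_def by (intro nn_integral_mono) (auto simp: indicator_def)
  then have out: "out < \<infinity>" using cost by (simp add: less_top le_less_trans)
  have const: "(\<integral>\<^sup>+z. ennreal r * indicator (V j) z \<partial>M) = ennreal (r * m)" if "j < N" "0 \<le> r" for j r
    using V(1,3)[OF that(1)] that \<open>0 < m\<close> by (simp add: nn_integral_cmult_indicator ennreal_mult)
  have upper: "(\<integral>\<^sup>+z. ?c z (S z) * indicator (V j) z \<partial>M) \<le> ennreal ((a (p j) + 2 * e)\<^sup>2 * m)" if j: "j < N" for j
  proof -
    \<comment> \<open>\<open>\<sigma> j\<close> is known only through its law; equality of laws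
      shows that it stays within \<open>e\<close> of \<open>T (x (p j))\<close> almost everywhere on
      \<open>V j\<close>.\<close>
    let ?bad = "indicator (- ball (T (x (p j))) e) :: 'a \<Rightarrow> ennreal"
    have "(\<integral>\<^sup>+z. ?bad (\<sigma> j z) * indicator (V j) z \<partial>M) = (\<integral>\<^sup>+z. ?bad (T z) * indicator (V (p j)) z \<partial>M)"
      by (rule push[OF j]) measurable
    also have "\<dots> = (\<integral>\<^sup>+z. 0 \<partial>M)"
      using V(2)[OF p_less[OF j]] by (intro nn_integral_cong) (auto simp: U_def indicator_def dist_commute)
    finally have "(\<integral>\<^sup>+z. ?bad (\<sigma> j z) * indicator (V j) z \<partial>M) = 0" by simp
    then have "AE z in M. ?bad (\<sigma> j z) * indicator (V j) z = 0"
      using \<sigma>[OF j] V(1)[OF j] by (subst (asm) nn_integral_0_iff_AE) auto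
    then have "(\<integral>\<^sup>+z. ?c z (S z) * indicator (V j) z \<partial>M) \<le> (\<integral>\<^sup>+z. ennreal ((a (p j) + 2 * e)\<^sup>2) * indicator (V j) z \<partial>M)"
    proof (intro nn_integral_mono_AE, eventually_elim)
      case (elim z)
      show ?case
      proof (cases "z \<in> V j")
        case True
        then have *: "dist (\<sigma> j z) (T (x (p j))) < e" using elim by (auto simp: indicator_def dist_commute split: if_splits)
        have "dist z (x j) < e" using True V(2)[OF j] by (auto simp: U_def)
        with * have "norm (\<sigma> j z - z) \<le> a (p j) + 2 * e"
          unfolding a_def x_p[OF j] dist_norm
          using norm_triangle_ineq[of "\<sigma> j z - T (x (p j))" "T (x (p j)) - x j"]
            norm_triangle_ineq[of "\<sigma> j z - x j" "x j - z"] by (simp add: norm_minus_commute[of z])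
        then have "(norm (\<sigma> j z - z))\<^sup>2 \<le> (a (p j) + 2 * e)\<^sup>2" by (intro power_mono) auto
        then show ?thesis using True S_V[OF j True] by (simp add: ennreal_leI)
      qed simp
    qed
    also have "\<dots> = ennreal ((a (p j) + 2 * e)\<^sup>2 * m)" by (rule const[OF j]) simp
    finally show ?thesis .
  qed
  have lower: "ennreal ((max 0 (b j - 2 * e))\<^sup>2 * m) \<le> (\<integral>\<^sup>+z. ?c z (T z) * indicator (V j) z \<partial>M)" if j: "j < N" for j
  proof -
    have "ennreal ((max 0 (b j - 2 * e))\<^sup>2 * m) = (\<integral>\<^sup>+z. ennreal ((max 0 (b j - 2 * e))\<^sup>2) * indicator (V j) z \<partial>M)"
      by (rule const[OF j, symmetric]) simp
    also have "\<dots> \<le> (\<integral>\<^sup>+z. ?c z (T z) * indicator (V j) z \<partial>M)"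
    proof (intro nn_integral_mono)
      fix z
      show "ennreal ((max 0 (b j - 2 * e))\<^sup>2) * indicator (V j) z \<le> ?c z (T z) * indicator (V j) z"
      proof (cases "z \<in> V j")
        case True
        then have "dist z (x j) < e" "dist (T z) (T (x j)) < e" using V(2)[OF j] by (auto simp: U_def)
        then have "b j - 2 * e \<le> norm (T z - z)"
          unfolding b_def dist_norm
          using norm_triangle_ineq[of "T (x j) - T z" "T z - z"]
            norm_triangle_ineq[of "T (x j) - z" "z - x j"] by (simp add: norm_minus_commute[of "T z" "T (x j)"])
        then have "(max 0 (b j - 2 * e))\<^sup>2 \<le> (norm (T z - z))\<^sup>2" by (intro power_mono) auto
        then show ?thesis using True by (simp add: ennreal_leI)
      qed simp
    qed
    finally show ?thesis .
  qed
  have "(\<integral>\<^sup>+z. ?c z (S z) \<partial>M) = (\<Sum>j<N. \<integral>\<^sup>+z. ?c z (S z) * indicator (V j) z \<partial>M) + (\<integral>\<^sup>+z. ?c z (S z) * indicator W z \<partial>M)"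
    by (rule split) measurable
  also have "(\<integral>\<^sup>+z. ?c z (S z) * indicator W z \<partial>M) = out"
    unfolding out_def by (intro nn_integral_cong) (auto simp: S_W indicator_def)
  also have "(\<Sum>j<N. \<integral>\<^sup>+z. ?c z (S z) * indicator (V j) z \<partial>M) \<le> (\<Sum>j<N. ennreal ((a (p j) + 2 * e)\<^sup>2 * m))"
    by (intro sum_mono upper) simp
  also have "\<dots> = (\<Sum>j<N. ennreal ((a j + 2 * e)\<^sup>2 * m))"
    by (rule sum.reindex_bij_betw[OF bij])
  also have "\<dots> = ennreal ((\<Sum>j<N. (a j + 2 * e)\<^sup>2) * m)"
    using \<open>0 < m\<close> by (simp add: sum_ennreal sum_distrib_right)
  also have "\<dots> + out < ennreal ((\<Sum>j<N. (max 0 (b j - 2 * e))\<^sup>2) * m) + out"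
  proof -
    obtain r where r: "out = ennreal r" "0 \<le> r"
      using out by (cases out) auto
    have A: "0 \<le> (\<Sum>j<N. (a j + 2 * e)\<^sup>2) * m" "0 \<le> (\<Sum>j<N. (max 0 (b j - 2 * e))\<^sup>2) * m"
      using \<open>0 < m\<close> by (auto intro!: mult_nonneg_nonneg sum_nonneg)
    have "(\<Sum>j<N. (a j + 2 * e)\<^sup>2) * m + r < (\<Sum>j<N. (max 0 (b j - 2 * e))\<^sup>2) * m + r"
      using e(2) \<open>0 < m\<close> by simp
    then show ?thesis
      unfolding r(1) ennreal_plus[OF A(1) r(2), symmetric] ennreal_plus[OF A(2) r(2), symmetric]
      using A r(2) by (intro ennreal_lessI) auto
  qed
  also have "ennreal ((\<Sum>j<N. (max 0 (b j - 2 * e))\<^sup>2) * m) = (\<Sum>j<N. ennreal ((max 0 (b j - 2 * e))\<^sup>2 * m))"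
    using \<open>0 < m\<close> by (simp add: sum_ennreal sum_distrib_right)
  also have "\<dots> + out \<le> (\<Sum>j<N. \<integral>\<^sup>+z. ?c z (T z) * indicator (V j) z \<partial>M) + out"
    by (intro add_right_mono sum_mono lower) simp
  also have "\<dots> = (\<integral>\<^sup>+z. ?c z (T z) \<partial>M)"
    unfolding out_def by (rule split[symmetric]) measurable
  finally show False using le by (simp add: not_le[symmetric])
qed

section \<open>The interpolation density\<close>

lemma push_forward_emeasure:
  assumes [measurable]: "\<rho> \<in> borel_measurable lebesgue" "S \<in> borel_measurable lebesgue" "A \<in> sets borel"
  shows "emeasure (push_forward S \<rho>) A = (\<integral>\<^sup>+x. ennreal (\<rho> x) * indicator A (S x) \<partial>lebesgue)"
proof -
  have "emeasure (push_forward S \<rho>) A = (\<integral>\<^sup>+y. indicator A y \<partial>distr (density_measure \<rho>) borel S)"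
    by (simp add: push_forward_def)
  also have "\<dots> = (\<integral>\<^sup>+x. indicator A (S x) \<partial>density_measure \<rho>)"
    by (rule nn_integral_distr) (simp_all add: density_measure_def)
  also have "\<dots> = (\<integral>\<^sup>+x. ennreal (\<rho> x) * indicator A (S x) \<partial>lebesgue)"
    unfolding density_measure_def by (rule nn_integral_density) measurable
  finally show ?thesis .
qed

lemma transport_map_nn_integral:
  assumes "mass_density \<rho>0" "transport_map \<rho>0 \<rho>1 T" "A \<in> sets borel"
  shows "(\<integral>\<^sup>+x. ennreal (\<rho>0 x) * indicator A (T x) \<partial>lebesgue) = emeasure (density_measure \<rho>1) A"
  using assms push_forward_emeasure[of \<rho>0 T A] by (auto simp: mass_density_def transport_map_def)

lemma measurable_id_lebesgue_borel: "(\<lambda>x::'a::euclidean_space. x) \<in> borel_measurable lebesgue"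
  by (rule measurable_completion) simp

text \<open>\<open>G\<close> is the projection of the part of the graph of \<open>T\<close> that
  lies in the support of the transport plan. Hyperplanes are Lebesgue null, so the coordinates have
  no atoms, and every map with the same push-forward as \<open>T\<close> is an admissible
  competitor.\<close>

lemma optimal_transport_map_cyclically_monotone:
  fixes T :: "'a::euclidean_space \<Rightarrow> 'a"
  assumes \<rho>0: "mass_density \<rho>0" and opt: "optimal_transport_map \<rho>0 \<rho>1 T"
    and mass: "(\<integral>\<^sup>+x. ennreal (\<rho>0 x) \<partial>lebesgue) \<noteq> \<infinity>" and cost: "transport_cost \<rho>0 T \<noteq> \<infinity>"
  obtains G where "cyclically_monotone_on G T" "AE x in lebesgue. 0 < \<rho>0 x \<longrightarrow> x \<in> G"
proof -
  define M where "M = density_measure \<rho>0"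
  have T: "transport_map \<rho>0 \<rho>1 T" using opt by (simp add: optimal_transport_map_def)
  have [measurable]: "\<rho>0 \<in> borel_measurable lebesgue" "T \<in> borel_measurable lebesgue"
    using \<rho>0 T by (auto simp: mass_density_def transport_map_def)
  have sets_M [measurable_cong, simp]: "sets M = sets lebesgue" "space M = UNIV"
    by (auto simp: M_def density_measure_def)
  have measM: "f \<in> borel_measurable M \<longleftrightarrow> f \<in> borel_measurable lebesgue" for f :: "'a \<Rightarrow> 'a"
    by (simp add: measurable_cong_sets[OF sets_M(1) refl])
  define G where "G = {x. \<forall>e>0. 0 < emeasure M {z \<in> space M. dist z x < e \<and> dist (T z) (T x) < e}}"
  have "AE x in M. \<forall>e>0. 0 < emeasure M {z \<in> space M. dist z x < e \<and> dist (T z) (T x) < e}"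
    by (rule AE_in_essential_graph) (simp_all add: measM measurable_id_lebesgue_borel)
  then have "AE x in M. x \<in> G" by (simp add: G_def)
  then have "AE x in lebesgue. 0 < ennreal (\<rho>0 x) \<longrightarrow> x \<in> G"
    unfolding M_def density_measure_def by (subst (asm) AE_density) auto
  then have "AE x in lebesgue. 0 < \<rho>0 x \<longrightarrow> x \<in> G" by simp
  moreover have "cyclically_monotone_on G T"
  proof (rule optimal_imp_cyclically_monotone[where M = M])
    show "finite_measure M"
    proof
      show "emeasure M (space M) \<noteq> \<infinity>"
        using mass by (simp add: M_def density_measure_def emeasure_density)
    qed
    show "emeasure M {x. x \<bullet> b = c} = 0" if "b \<in> Basis" for b c
    proof -
      have "negligible {x. b \<bullet> x = c}"
        using that by (intro negligible_hyperplane) (auto simp: nonzero_Basis)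
      then have null: "{x. x \<bullet> b = c} \<in> null_sets lebesgue"
        by (simp add: negligible_iff_null_sets inner_commute)
      then have "AE x in lebesgue. x \<notin> {x. x \<bullet> b = c}" by (rule AE_not_in)
      then have "(\<integral>\<^sup>+x. ennreal (\<rho>0 x) * indicator {x. x \<bullet> b = c} x \<partial>lebesgue) = (\<integral>\<^sup>+x. 0 \<partial>(lebesgue :: 'a measure))"
        by (intro nn_integral_cong_AE) (auto elim!: eventually_mono)
      then show ?thesis
        using null by (simp add: M_def density_measure_def emeasure_density null_setsD2)
    qed
    show "(\<integral>\<^sup>+x. ennreal ((norm (T x - x))\<^sup>2) \<partial>M) \<noteq> \<infinity>"
      using cost by (simp add: transport_cost_def M_def)
    show "(\<integral>\<^sup>+x. ennreal ((norm (T x - x))\<^sup>2) \<partial>M) \<le> (\<integral>\<^sup>+x. ennreal ((norm (S x - x))\<^sup>2) \<partial>M)"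
      if S: "S \<in> borel_measurable M" "distr M borel S = distr M borel T" for S
    proof -
      have "transport_map \<rho>0 \<rho>1 S"
        using T S unfolding transport_map_def measM by (simp add: push_forward_def M_def)
      then show ?thesis
        using opt by (simp add: optimal_transport_map_def transport_cost_def M_def)
    qed
  qed (auto simp: measM measurable_id_lebesgue_borel G_def)
  ultimately show ?thesis using that by blast
qed

text \<open>The resolvent requires \<open>T\<close> to be bounded. The density is therefore cut off
  where \<open>norm (T x)\<close> exceeds \<open>m\<close>, and on the null set where cyclical
  monotonicity is not known; dominated convergence removes the cutoff.\<close>

lemma displacement_interpolation_bound:
  fixes T :: "real^'n::finite \<Rightarrow> real^'n" and a :: "real^'n \<Rightarrow> ennreal"
  assumes \<rho>0: "mass_density \<rho>0" and opt: "optimal_transport_map \<rho>0 (indicator E) T" and E: "E \<in> sets lebesgue"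
    and mass: "(\<integral>\<^sup>+x. ennreal (\<rho>0 x) \<partial>lebesgue) \<noteq> \<infinity>" and cost: "transport_cost \<rho>0 T \<noteq> \<infinity>"
    and t: "0 < t" "t < 1" and a_meas [measurable]: "a \<in> borel_measurable lebesgue"
    and a: "\<And>x. a x \<le> 1" "\<And>x. a x \<le> ennreal (\<rho>0 x)" and A [measurable]: "A \<in> sets borel"
  shows "(\<integral>\<^sup>+x. a x * indicator A (interpolation_map T t x) \<partial>lebesgue) \<le> emeasure lborel A"
proof -
  have T: "transport_map \<rho>0 (indicator E) T" using opt by (simp add: optimal_transport_map_def)
  have [measurable]: "\<rho>0 \<in> borel_measurable lebesgue" "T \<in> borel_measurable lebesgue"
    using \<rho>0 T by (auto simp: mass_density_def transport_map_def)
  note [measurable] = measurable_id_lebesgue_borel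
  obtain G where G: "cyclically_monotone_on G T" "AE x in lebesgue. 0 < \<rho>0 x \<longrightarrow> x \<in> G"
    by (rule optimal_transport_map_cyclically_monotone[OF \<rho>0 opt mass cost])
  then obtain N where N: "N \<in> null_sets lebesgue" "\<And>x. 0 < \<rho>0 x \<Longrightarrow> x \<notin> N \<Longrightarrow> x \<in> G"
    unfolding eventually_ae_filter by auto
  have [measurable]: "N \<in> sets lebesgue" using N(1) by auto
  define am where "am m x = a x * (indicator (- N) x * indicator {x. norm (T x) \<le> real m} x)" for m x
  have am_le: "am m x \<le> a x" for m x by (auto simp: am_def indicator_def)
  have [measurable]: "{x. norm (T x) \<le> r} \<in> sets lebesgue" for r
  proof -
    have "{x \<in> space lebesgue. norm (T x) \<le> r} \<in> sets lebesgue" by measurable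
    then show ?thesis by simp
  qed
  have am_meas [measurable]: "am m \<in> borel_measurable lebesgue" for m
    unfolding am_def[abs_def] by measurable
  have [measurable]: "interpolation_map T t \<in> borel_measurable lebesgue"
    unfolding interpolation_map_def[abs_def] by measurable
  have le: "(\<integral>\<^sup>+x. am m x * indicator A (interpolation_map T t x) \<partial>lebesgue) \<le> emeasure lborel A" for m
  proof -
    define Gm where "Gm = {x \<in> G. norm (T x) \<le> real m}"
    have "cyclically_monotone_on Gm T"
      using G(1) unfolding cyclically_monotone_on_def Gm_def by blast
    then obtain P where P: "firmly_nonexpansive P" "cyclically_monotone_on UNIV P"
      "\<And>x. x \<in> Gm \<Longrightarrow> P (t *\<^sub>R T x + (1 - t) *\<^sub>R x) = (1 - t) *\<^sub>R x"
      by (rule cyclically_monotone_resolvent[OF _ _ t, of Gm T "real m"]) (auto simp: Gm_def)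
    show ?thesis
      unfolding interpolation_map_def
    proof (rule displacement_density_bound[OF P(1,2) t P(3) _ am_meas _ _ _ _ A])
      show "am m x \<le> 1" for x using am_le a(1) order_trans by blast
      show "am m x = 0" if "x \<notin> Gm" for x
      proof (rule ccontr)
        assume *: "am m x \<noteq> 0"
        then have x: "x \<notin> N" "norm (T x) \<le> real m" "a x \<noteq> 0" by (auto simp: am_def indicator_def split: if_splits)
        then have "0 < \<rho>0 x" using a(2)[of x] by (metis ennreal_neg le_zero_eq not_le)
        then show False using N(2) x that by (auto simp: Gm_def)
      qed
      have "(\<integral>\<^sup>+x. am m x \<partial>lebesgue) \<le> (\<integral>\<^sup>+x. ennreal (\<rho>0 x) \<partial>lebesgue)"
        by (intro nn_integral_mono order_trans[OF am_le a(2)])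
      then show "(\<integral>\<^sup>+x. am m x \<partial>lebesgue) \<noteq> \<infinity>" using mass by (auto simp: top_unique)
      show "(\<integral>\<^sup>+x. am m x * indicator B (T x) \<partial>lebesgue) \<le> emeasure lborel B" if B [measurable]: "B \<in> sets borel" for B
      proof -
        have "(\<integral>\<^sup>+x. am m x * indicator B (T x) \<partial>lebesgue) \<le> (\<integral>\<^sup>+x. ennreal (\<rho>0 x) * indicator B (T x) \<partial>lebesgue)"
          by (intro nn_integral_mono mult_right_mono order_trans[OF am_le a(2)]) simp
        also have "\<dots> = emeasure (density_measure (indicator E)) B"
          by (rule transport_map_nn_integral[OF \<rho>0 T B])
        also have "\<dots> = (\<integral>\<^sup>+x. indicator E x * indicator B x \<partial>lebesgue)"
          using E by (simp add: density_measure_def emeasure_density ennreal_indicator)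
        also have "\<dots> \<le> (\<integral>\<^sup>+x. indicator B x \<partial>lebesgue)"
          by (intro nn_integral_mono) (auto simp: indicator_def)
        also have "\<dots> = emeasure lborel B"
          unfolding nn_integral_completion by simp
        finally show ?thesis .
      qed
    qed measurable
  qed
  have "(\<lambda>m. \<integral>\<^sup>+x. am m x * indicator A (interpolation_map T t x) \<partial>lebesgue)
    \<longlonglongrightarrow> (\<integral>\<^sup>+x. a x * indicator A (interpolation_map T t x) \<partial>lebesgue)"
  proof (rule nn_integral_dominated_convergence[where w = a])
    show "AE x in lebesgue. am m x * indicator A (interpolation_map T t x) \<le> a x" for m
      using am_le by (intro AE_I2) (auto simp: indicator_def)
    have "(\<integral>\<^sup>+x. a x \<partial>lebesgue) \<le> (\<integral>\<^sup>+x. ennreal (\<rho>0 x) \<partial>lebesgue)"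
      by (intro nn_integral_mono a)
    then show "(\<integral>\<^sup>+x. a x \<partial>lebesgue) < \<infinity>" using mass by (simp add: less_top le_less_trans)
    show "AE x in lebesgue. (\<lambda>m. am m x * indicator A (interpolation_map T t x)) \<longlonglongrightarrow> a x * indicator A (interpolation_map T t x)"
      using AE_not_in[OF N(1)]
    proof eventually_elim
      case (elim x)
      obtain m0 where "norm (T x) \<le> real m0" using real_arch_simple by blast
      then have "am m x = a x" if "m0 \<le> m" for m
        using elim that by (simp add: am_def order_trans[of _ "real m0"])
      then have "\<forall>\<^sub>F m in sequentially. am m x * indicator A (interpolation_map T t x) = a x * indicator A (interpolation_map T t x)"
        by (intro eventually_sequentiallyI[of m0]) simp
      then show ?case by (rule tendsto_eventually)
    qed
  qed measurable
  then show ?thesis by (rule LIMSEQ_le_const2) (intro exI allI impI le)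
qed

section \<open>From deviation and energy to the estimate at a fixed time\<close>

text \<open>For a level \<open>l\<close> above the deviation \<open>d\<close> one has
  \<open>g \<le> l + l^(1-p) g^p\<close> for \<open>g = \<bar>\<rho> - 1\<bar>\<close>. Both terms
  integrate over the ball to at most \<open>w l\<close>, whence the factor 2.\<close>

lemma L1_le_density_deviation:
  fixes \<rho> :: "'a::euclidean_space \<Rightarrow> real"
  assumes [measurable]: "\<rho> \<in> borel_measurable lebesgue" and p: "1 \<le> p"
    and bound: "AE x in lebesgue. x \<in> ball 0 1 \<longrightarrow> \<bar>\<rho> x - 1\<bar> \<le> B"
  shows "(\<integral>\<^sup>+x\<in>ball 0 1. ennreal \<bar>\<rho> x - 1\<bar> \<partial>lebesgue)
    \<le> ennreal (2 * measure lebesgue (ball (0::'a) 1) * density_deviation p 1 \<rho>)"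
proof -
  let ?B = "ball (0::'a) 1" and ?g = "\<lambda>x. \<bar>\<rho> x - 1\<bar>"
  have [measurable]: "?B \<in> sets lebesgue" by simp
  define w where "w = measure lebesgue ?B"
  have "0 < w" unfolding w_def using content_ball_pos[of 1 "0::'a"] by simp
  have emB: "emeasure lebesgue ?B = ennreal w"
    unfolding w_def by (rule emeasure_eq_measure2) simp
  define I where "I = (LINT x:?B|lebesgue. ?g x powr p)"
  have "0 \<le> I" unfolding I_def set_lebesgue_integral_def by (intro Bochner_Integration.integral_nonneg) simp
  define d where "d = density_deviation p 1 \<rho>"
  have d: "d = (I / w) powr (1 / p)" by (simp add: d_def density_deviation_def I_def w_def)
  have "0 \<le> d" by (simp add: d)
  have "d powr p = I / w" using p \<open>0 \<le> I\<close> \<open>0 < w\<close> by (simp add: d powr_powr)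
  then have I: "I = w * d powr p" using \<open>0 < w\<close> by simp
  \<comment> \<open>The bound on the ball excludes the default value 0 of the integral in
    \<open>density_deviation\<close>, which would make the deviation meaningless.\<close>
  have int: "integrable lebesgue (\<lambda>x. indicat_real ?B x *\<^sub>R (?g x powr p))"
  proof (rule integrableI_bounded_set_indicator)
    show "AE x in lebesgue. x \<in> ?B \<longrightarrow> norm (?g x powr p) \<le> B powr p"
      using bound by eventually_elim (use p in \<open>auto intro!: powr_mono2\<close>)
  qed (auto simp: emB)
  have "(\<integral>\<^sup>+x\<in>?B. ennreal (?g x powr p) \<partial>lebesgue) = (\<integral>\<^sup>+x. ennreal (indicat_real ?B x *\<^sub>R (?g x powr p)) \<partial>lebesgue)"
    by (intro nn_integral_cong) (simp add: indicator_def)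
  also have "\<dots> = ennreal I"
    unfolding I_def set_lebesgue_integral_def by (rule nn_integral_eq_integral[OF int]) simp
  finally have nnI: "(\<integral>\<^sup>+x\<in>?B. ennreal (?g x powr p) \<partial>lebesgue) = ennreal I" .
  \<comment> \<open>The level is strictly above \<open>d\<close> so that it is positive also when
    \<open>d = 0\<close>; it tends to \<open>d\<close> at the end.\<close>
  have le: "(\<integral>\<^sup>+x\<in>?B. ennreal (?g x) \<partial>lebesgue) \<le> ennreal (2 * w * l)" if "d < l" for l
  proof -
    have "0 < l" using that \<open>0 \<le> d\<close> by simp
    have le: "?g x \<le> l + l powr (1 - p) * ?g x powr p" for x
    proof (cases "?g x \<le> l")
      case False
      then have g: "l < ?g x" by simp
      have "?g x = ?g x powr (1 - p) * ?g x powr p" using g \<open>0 < l\<close> by (simp flip: powr_add)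
      also have "\<dots> \<le> l powr (1 - p) * ?g x powr p"
        using g \<open>0 < l\<close> p by (intro mult_right_mono powr_mono2') auto
      finally show ?thesis using \<open>0 < l\<close> by linarith
    qed (simp add: add_increasing2)
    have "(\<integral>\<^sup>+x\<in>?B. ennreal (?g x) \<partial>lebesgue) \<le> (\<integral>\<^sup>+x. ennreal l * indicator ?B x + ennreal (l powr (1 - p)) * (ennreal (?g x powr p) * indicator ?B x) \<partial>lebesgue)"
    proof (intro nn_integral_mono)
      fix x
      have "ennreal (?g x) \<le> ennreal (l + l powr (1 - p) * ?g x powr p)" by (rule ennreal_leI[OF le])
      also have "\<dots> = ennreal l + ennreal (l powr (1 - p)) * ennreal (?g x powr p)"
        using \<open>0 < l\<close> by (subst ennreal_plus) (simp_all add: ennreal_mult)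
      finally show "ennreal (?g x) * indicator ?B x \<le> ennreal l * indicator ?B x + ennreal (l powr (1 - p)) * (ennreal (?g x powr p) * indicator ?B x)"
        by (simp add: indicator_def)
    qed
    also have "\<dots> = (\<integral>\<^sup>+x. ennreal l * indicator ?B x \<partial>lebesgue) + (\<integral>\<^sup>+x. ennreal (l powr (1 - p)) * (ennreal (?g x powr p) * indicator ?B x) \<partial>lebesgue)"
      by (rule nn_integral_add) measurable
    also have "(\<integral>\<^sup>+x. ennreal l * indicator ?B x \<partial>lebesgue) = ennreal l * ennreal w"
      by (subst nn_integral_cmult_indicator) (simp_all only: emB lmeasurable_ball fmeasurableD)
    also have "(\<integral>\<^sup>+x. ennreal (l powr (1 - p)) * (ennreal (?g x powr p) * indicator ?B x) \<partial>lebesgue) = ennreal (l powr (1 - p)) * ennreal I"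
      unfolding nnI[symmetric] by (rule nn_integral_cmult) measurable
    also have "ennreal l * ennreal w + ennreal (l powr (1 - p)) * ennreal I = ennreal (l * w + l powr (1 - p) * I)"
      using \<open>0 < l\<close> \<open>0 < w\<close> \<open>0 \<le> I\<close> by (subst ennreal_plus) (simp_all add: ennreal_mult)
    also have "\<dots> \<le> ennreal (2 * w * l)"
    proof (rule ennreal_leI)
      have "l powr (1 - p) * d powr p \<le> l powr (1 - p) * l powr p"
        using that \<open>0 \<le> d\<close> p by (intro mult_left_mono powr_mono2) auto
      also have "\<dots> = l" using \<open>0 < l\<close> by (simp flip: powr_add)
      finally have "w * (l powr (1 - p) * d powr p) \<le> w * l" using \<open>0 < w\<close> by simp
      then show "l * w + l powr (1 - p) * I \<le> 2 * w * l" by (simp add: I algebra_simps)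
    qed
    finally show ?thesis .
  qed
  have fin: "(\<integral>\<^sup>+x\<in>?B. ennreal (?g x) \<partial>lebesgue) < \<infinity>"
    by (rule le_less_trans[OF le[of "d + 1"]]) simp_all
  then obtain r where r: "(\<integral>\<^sup>+x\<in>?B. ennreal (?g x) \<partial>lebesgue) = ennreal r" "0 \<le> r"
    by (cases "\<integral>\<^sup>+x\<in>?B. ennreal (?g x) \<partial>lebesgue") auto
  have "r / (2 * w) \<le> d"
  proof (rule dense_ge)
    fix l assume "d < l"
    then have "ennreal r \<le> ennreal (2 * w * l)" "0 < l" using le[of l] \<open>0 \<le> d\<close> by (auto simp: r(1))
    then have "r \<le> 2 * w * l" using \<open>0 < w\<close> by (subst (asm) ennreal_le_iff) auto
    then show "r / (2 * w) \<le> l" using \<open>0 < w\<close> by (simp add: divide_le_eq mult.commute)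
  qed
  then have "r \<le> 2 * w * d" using \<open>0 < w\<close> by (simp add: divide_le_eq mult.commute)
  then show ?thesis unfolding r(1) w_def d_def by (rule ennreal_leI)
qed

lemma power_difference_le:
  fixes x y :: real
  assumes "0 \<le> y" "y \<le> x" "x \<le> 1"
  shows "x ^ n \<le> y ^ n + real n * (x - y)"
proof (induction n)
  case (Suc n)
  have "x * x ^ n \<le> x * (y ^ n + real n * (x - y))"
    using Suc assms by (intro mult_left_mono) auto
  also have "\<dots> = x * y ^ n + x * (real n * (x - y))" by (simp add: distrib_left)
  also have "\<dots> \<le> x * y ^ n + real n * (x - y)"
    using assms by (intro add_left_mono mult_left_le_one_le) auto
  also have "x * y ^ n = y * y ^ n + (x - y) * y ^ n" by (simp add: algebra_simps)
  also have "(x - y) * y ^ n \<le> x - y"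
    using assms by (intro mult_left_le power_le_one) auto
  finally show ?case by (simp add: algebra_simps)
qed simp

text \<open>The shell has volume \<open>w ((1/2)^n - (1/2 - h)^n)\<close>, and the difference of the
  powers is at most \<open>n h\<close> because both radii lie in \<open>[0, 1]\<close>.\<close>

lemma emeasure_small_ball_le:
  fixes w :: real
  defines "w \<equiv> measure lebesgue (ball (0::'a::euclidean_space) 1)"
  assumes h: "0 < h" "h < 1/2"
  shows "emeasure lborel (ball (0::'a) (1/2)) \<le> emeasure lborel (ball (0::'a) (1/2 - h)) + ennreal (w * DIM('a) * h)"
proof -
  have ball: "emeasure lborel (ball (0::'a) r) = ennreal (w * r ^ DIM('a))" if "0 \<le> r" for r
  proof -
    have "emeasure lborel (ball (0::'a) r) = ennreal (measure lborel (ball (0::'a) r))"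
      using emeasure_lborel_ball_finite[of "0::'a" r] by (intro emeasure_eq_ennreal_measure) simp
    then show ?thesis
      using content_ball_conv_unit_ball[OF that, of "0::'a"] by (simp add: w_def mult.commute)
  qed
  have "0 \<le> w" by (simp add: w_def)
  have "(1/2) ^ DIM('a) \<le> (1/2 - h) ^ DIM('a) + DIM('a) * (1/2 - (1/2 - h))"
    using h by (intro power_difference_le) auto
  then have "w * (1/2) ^ DIM('a) \<le> w * ((1/2 - h) ^ DIM('a) + DIM('a) * h)"
    using \<open>0 \<le> w\<close> by (intro mult_left_mono) auto
  then have "ennreal (w * (1/2) ^ DIM('a)) \<le> ennreal (w * (1/2 - h) ^ DIM('a) + w * DIM('a) * h)"
    by (intro ennreal_leI) (simp add: algebra_simps)
  also have "\<dots> = ennreal (w * (1/2 - h) ^ DIM('a)) + ennreal (w * DIM('a) * h)"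
    using \<open>0 \<le> w\<close> h by (intro ennreal_plus) auto
  finally show ?thesis using h by (simp add: ball)
qed

text \<open>A pointwise inequality is integrated. At a point of the smaller ball
  \<open>1 \<le> \<rho> + \<bar>\<rho> - 1\<bar>\<close>, and the mass there either stays in the
  larger ball under \<open>T_t\<close> or is moved by \<open>T\<close> over a distance at least
  \<open>h\<close>, where \<open>\<bar>T x - x\<bar>^2 / h^2 \<ge> 1\<close>.\<close>

lemma emeasure_push_forward_ball_ge:
  fixes T :: "'a::euclidean_space \<Rightarrow> 'a"
  assumes [measurable]: "\<rho> \<in> borel_measurable lebesgue" "T \<in> borel_measurable lebesgue"
    and t: "0 < t" "t < 1" and h: "0 < h" "h < 1/2" and "0 \<le> k" "0 \<le> d"
    and cost: "(\<integral>\<^sup>+x. ennreal (\<rho> x) * ennreal ((norm (T x - x))\<^sup>2) \<partial>lebesgue) = ennreal k"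
    and dev: "(\<integral>\<^sup>+x\<in>ball 0 1. ennreal \<bar>\<rho> x - 1\<bar> \<partial>lebesgue) \<le> ennreal d"
  shows "emeasure lborel (ball (0::'a) (1/2 - h)) \<le>
    (\<integral>\<^sup>+x. ennreal (\<rho> x) * indicator (ball 0 (1/2)) (interpolation_map T t x) \<partial>lebesgue) + ennreal (k / h\<^sup>2) + ennreal d"
proof -
  note [measurable] = measurable_id_lebesgue_borel
  let ?S = "ball (0::'a) (1/2 - h)" and ?B = "ball (0::'a) (1/2)" and ?U = "ball (0::'a) 1"
  have [measurable]: "?S \<in> sets borel" "?B \<in> sets borel" "?U \<in> sets lebesgue" "?S \<in> sets lebesgue" by auto
  have Tt [measurable]: "interpolation_map T t \<in> borel_measurable lebesgue"
    unfolding interpolation_map_def[abs_def] by measurable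
  have m1 [measurable]: "(\<lambda>x. ennreal (\<rho> x) * indicator ?B (interpolation_map T t x)) \<in> borel_measurable lebesgue" by measurable
  have m2 [measurable]: "(\<lambda>x. ennreal (1 / h\<^sup>2) * (ennreal (\<rho> x) * ennreal ((norm (T x - x))\<^sup>2))) \<in> borel_measurable lebesgue" by measurable
  have m3 [measurable]: "(\<lambda>x. ennreal \<bar>\<rho> x - 1\<bar> * indicator ?U x) \<in> borel_measurable lebesgue" by measurable
  have "emeasure lborel ?S = (\<integral>\<^sup>+x. indicator ?S x \<partial>lebesgue)"
    unfolding nn_integral_completion by simp
  also have "\<dots> \<le> (\<integral>\<^sup>+x. (ennreal (\<rho> x) * indicator ?B (interpolation_map T t x) +
    ennreal (1 / h\<^sup>2) * (ennreal (\<rho> x) * ennreal ((norm (T x - x))\<^sup>2))) + ennreal \<bar>\<rho> x - 1\<bar> * indicator ?U x \<partial>lebesgue)"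
  proof (intro nn_integral_mono)
    fix x :: 'a
    show "indicator ?S x \<le> (ennreal (\<rho> x) * indicator ?B (interpolation_map T t x) +
      ennreal (1 / h\<^sup>2) * (ennreal (\<rho> x) * ennreal ((norm (T x - x))\<^sup>2))) + ennreal \<bar>\<rho> x - 1\<bar> * indicator ?U x"
    proof (cases "x \<in> ?S")
      case True
      then have x: "norm x < 1/2 - h" by simp
      then have U: "x \<in> ?U" using h by simp
      have "1 \<le> ennreal (\<rho> x) + ennreal \<bar>\<rho> x - 1\<bar>"
      proof (cases "0 \<le> \<rho> x")
        case True
        then have "ennreal (\<rho> x) + ennreal \<bar>\<rho> x - 1\<bar> = ennreal (\<rho> x + \<bar>\<rho> x - 1\<bar>)" by (simp add: ennreal_plus)
        moreover have "ennreal 1 \<le> ennreal (\<rho> x + \<bar>\<rho> x - 1\<bar>)" by (intro ennreal_leI) linarith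
        ultimately show ?thesis by simp
      next
        case False
        then have "ennreal 1 \<le> ennreal \<bar>\<rho> x - 1\<bar>" by (intro ennreal_leI) linarith
        then show ?thesis by (simp add: add_increasing)
      qed
      moreover have "ennreal (\<rho> x) \<le> ennreal (\<rho> x) * indicator ?B (interpolation_map T t x) +
        ennreal (1 / h\<^sup>2) * (ennreal (\<rho> x) * ennreal ((norm (T x - x))\<^sup>2))"
      proof (cases "norm (T x - x) < h")
        case near: True
        have "interpolation_map T t x = x + t *\<^sub>R (T x - x)"
          by (simp add: interpolation_map_def algebra_simps)
        then have "norm (interpolation_map T t x) \<le> norm x + t * norm (T x - x)"
          using norm_triangle_ineq[of x "t *\<^sub>R (T x - x)"] t by simp
        also have "t * norm (T x - x) \<le> 1 * norm (T x - x)" using t by (intro mult_right_mono) auto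
        finally have "interpolation_map T t x \<in> ?B" using x near by simp
        then show ?thesis by (simp add: indicator_def)
      next
        case False
        then have "h\<^sup>2 \<le> (norm (T x - x))\<^sup>2" using h by (intro power_mono) auto
        then have "1 \<le> (1 / h\<^sup>2) * (norm (T x - x))\<^sup>2" using h by (simp add: field_simps)
        then have "ennreal 1 \<le> ennreal ((1 / h\<^sup>2) * (norm (T x - x))\<^sup>2)" by (rule ennreal_leI)
        then have "1 \<le> ennreal (1 / h\<^sup>2) * ennreal ((norm (T x - x))\<^sup>2)" by (subst (asm) ennreal_mult) simp_all
        then have "ennreal (\<rho> x) * 1 \<le> ennreal (\<rho> x) * (ennreal (1 / h\<^sup>2) * ennreal ((norm (T x - x))\<^sup>2))"
          by (rule mult_left_mono) simp
        then show ?thesis by (simp add: add_increasing mult.left_commute)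
      qed
      ultimately have "1 \<le> (ennreal (\<rho> x) * indicator ?B (interpolation_map T t x) +
        ennreal (1 / h\<^sup>2) * (ennreal (\<rho> x) * ennreal ((norm (T x - x))\<^sup>2))) + ennreal \<bar>\<rho> x - 1\<bar>"
        by (meson add_right_mono order_trans)
      then show ?thesis using True U by (simp only: indicator_simps mult_1_right)
    qed simp
  qed
  also have "\<dots> = (\<integral>\<^sup>+x. ennreal (\<rho> x) * indicator ?B (interpolation_map T t x) \<partial>lebesgue) +
    (\<integral>\<^sup>+x. ennreal (1 / h\<^sup>2) * (ennreal (\<rho> x) * ennreal ((norm (T x - x))\<^sup>2)) \<partial>lebesgue) +
    (\<integral>\<^sup>+x\<in>?U. ennreal \<bar>\<rho> x - 1\<bar> \<partial>lebesgue)"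
    by (simp only: nn_integral_add[OF borel_measurable_add[OF m1 m2] m3] nn_integral_add[OF m1 m2])
  also have "(\<integral>\<^sup>+x. ennreal (1 / h\<^sup>2) * (ennreal (\<rho> x) * ennreal ((norm (T x - x))\<^sup>2)) \<partial>lebesgue) = ennreal (k / h\<^sup>2)"
  proof -
    have "(\<lambda>x. ennreal (\<rho> x) * ennreal ((norm (T x - x))\<^sup>2)) \<in> borel_measurable lebesgue" by measurable
    from nn_integral_cmult[OF this, of "ennreal (1 / h\<^sup>2)"] show ?thesis
      using \<open>0 \<le> k\<close> by (simp add: cost ennreal_mult[symmetric])
  qed
  finally show ?thesis using dev by (meson add_left_mono order_trans)
qed

text \<open>Integrates \<open>\<bar>r - 1\<bar> = 2 (r - 1)_+ + 1 - r\<close> over \<open>B\<close>.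
  The upper bound, tested on the set where \<open>r > 1\<close>, controls the positive part, and the
  lower bound controls the rest. The identity is arranged as a sum, and finiteness permits
  cancellation in \<open>ennreal\<close>.\<close>

lemma L1_deviation_from_bounds:
  fixes r :: "'a::euclidean_space \<Rightarrow> real"
  assumes [measurable]: "r \<in> borel_measurable borel" "B \<in> sets borel" and r: "\<And>x. 0 \<le> r x"
    and B: "emeasure lborel B < \<infinity>" and mB: "(\<integral>\<^sup>+x\<in>B. ennreal (r x) \<partial>lborel) < \<infinity>"
    and upper: "\<And>A. A \<in> sets borel \<Longrightarrow> (\<integral>\<^sup>+x\<in>A. ennreal (r x) \<partial>lborel) \<le> emeasure lborel A + e"
    and lower: "emeasure lborel B \<le> (\<integral>\<^sup>+x\<in>B. ennreal (r x) \<partial>lborel) + e'"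
  shows "(\<integral>\<^sup>+x\<in>B. ennreal \<bar>r x - 1\<bar> \<partial>lborel) \<le> 2 * e + e'"
proof -
  define A where "A = {x \<in> B. 1 < r x}"
  have [measurable]: "A \<in> sets borel"
  proof -
    have "A = B \<inter> {x \<in> space borel. 1 < r x}" by (auto simp: A_def)
    also have "\<dots> \<in> sets borel" by measurable
    finally show ?thesis .
  qed
  define Q where "Q = (\<integral>\<^sup>+x\<in>B. ennreal (r x - 1) \<partial>lborel)"
  have "Q + emeasure lborel A = Q + (\<integral>\<^sup>+x. indicator A x \<partial>lborel)" by simp
  also have "\<dots> = (\<integral>\<^sup>+x. ennreal (r x - 1) * indicator B x + indicator A x \<partial>lborel)"
    unfolding Q_def by (rule nn_integral_add[symmetric]) measurable
  also have "\<dots> = (\<integral>\<^sup>+x\<in>A. ennreal (r x) \<partial>lborel)"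
  proof (intro nn_integral_cong)
    fix x
    have "ennreal (r x - 1) + 1 = ennreal (r x)" if "1 < r x"
      using that by (simp flip: ennreal_1 ennreal_plus)
    then show "ennreal (r x - 1) * indicator B x + indicator A x = ennreal (r x) * indicator A x"
      by (auto simp: A_def indicator_def ennreal_neg)
  qed
  also have "\<dots> \<le> emeasure lborel A + e" by (rule upper) measurable
  finally have "emeasure lborel A + Q \<le> emeasure lborel A + e" by (simp add: add.commute)
  moreover have "emeasure lborel A < \<infinity>"
    by (rule le_less_trans[OF emeasure_mono B]) (auto simp: A_def)
  ultimately have Q: "Q \<le> e" by (auto simp: ennreal_add_left_cancel_le)
  let ?X = "\<integral>\<^sup>+x\<in>B. ennreal \<bar>r x - 1\<bar> \<partial>lborel" and ?N = "\<integral>\<^sup>+x\<in>B. ennreal (r x) \<partial>lborel"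
  have "?N + ?X = (\<integral>\<^sup>+x. ennreal (r x) * indicator B x + ennreal \<bar>r x - 1\<bar> * indicator B x \<partial>lborel)"
    by (rule nn_integral_add[symmetric]) measurable
  also have "\<dots> = (\<integral>\<^sup>+x. 2 * (ennreal (r x - 1) * indicator B x) + indicator B x \<partial>lborel)"
  proof (intro nn_integral_cong)
    fix x
    have "ennreal (r x) + ennreal \<bar>r x - 1\<bar> = 2 * ennreal (r x - 1) + 1"
    proof (cases "1 \<le> r x")
      case True
      then have "ennreal (2 * (r x - 1) + 1) = ennreal (2 * (r x - 1)) + ennreal 1"
        by (intro ennreal_plus) auto
      also have "ennreal (2 * (r x - 1)) = ennreal 2 * ennreal (r x - 1)"
        using True by (intro ennreal_mult) auto
      finally have "2 * ennreal (r x - 1) + 1 = ennreal (2 * (r x - 1) + 1)" by simp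
      moreover have "ennreal (r x) + ennreal \<bar>r x - 1\<bar> = ennreal (r x + \<bar>r x - 1\<bar>)"
        using r[of x] by (intro ennreal_plus[symmetric]) auto
      moreover have "2 * (r x - 1) + 1 = r x + \<bar>r x - 1\<bar>" using True by simp
      ultimately show ?thesis by (simp only:)
    next
      case False
      have "ennreal (r x) + ennreal \<bar>r x - 1\<bar> = ennreal (r x + \<bar>r x - 1\<bar>)"
        using r[of x] by (intro ennreal_plus[symmetric]) auto
      also have "r x + \<bar>r x - 1\<bar> = 1" using False by simp
      finally show ?thesis using False by (simp add: ennreal_neg)
    qed
    then show "ennreal (r x) * indicator B x + ennreal \<bar>r x - 1\<bar> * indicator B x = 2 * (ennreal (r x - 1) * indicator B x) + indicator B x"
      by (simp add: indicator_def)
  qed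
  also have "\<dots> = 2 * Q + emeasure lborel B"
    unfolding Q_def by (subst nn_integral_add) (simp_all add: nn_integral_cmult)
  also have "\<dots> \<le> 2 * e + (?N + e')"
    using Q lower by (intro add_mono mult_left_mono) auto
  finally have "?N + ?X \<le> ?N + (2 * e + e')" by (simp add: ac_simps)
  then show ?thesis using mB by (auto simp: ennreal_add_left_cancel_le)
qed

text \<open>\<open>h\<close> is left free. The push-forward of \<open>min 1 \<rho>0\<close> has
  density at most 1, and the remaining mass is at most \<open>2 w \<gamma>\<close>, where
  \<open>\<gamma>\<close> in this proof is the deviation of \<open>\<rho>0\<close> alone.\<close>

lemma interpolation_density_deviation:
  fixes \<rho>0 :: "real^'n::finite \<Rightarrow> real" and T :: "real^'n \<Rightarrow> real^'n"
  defines "w \<equiv> measure lebesgue (ball (0::real^'n) 1)"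
  assumes \<rho>0: "mass_density \<rho>0" and supp: "AE x in lebesgue. x \<notin> ball 0 1 \<longrightarrow> \<rho>0 x = 0"
    and mass: "(LINT x|lebesgue. \<rho>0 x) = w" and bound: "AE x in lebesgue. x \<in> ball 0 1 \<longrightarrow> \<rho>0 x \<le> C0"
    and E: "E \<in> sets lebesgue" and opt: "optimal_transport_map \<rho>0 (indicator E) T"
    and excess: "(\<integral>\<^sup>+x\<in>ball 0 1. ennreal ((norm (T x - x))\<^sup>2 * \<rho>0 x) \<partial>lebesgue) = ennreal (\<epsilon> * w)"
    and p: "1 \<le> p" and t: "0 < t" "t < 1" and h: "0 < h" "h < 1/2" and \<epsilon>: "0 \<le> \<epsilon>" "\<epsilon> \<le> h ^ 3"
  shows "(\<integral>\<^sup>+x\<in>ball 0 (1 / 2). ennreal \<bar>interpolation_density \<rho>0 T t x - 1\<bar> \<partial>lborel)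
    \<le> ennreal (6 * w * density_deviation p 1 \<rho>0 + w * (real CARD('n) + 1) * h)"
proof -
  let ?B = "ball (0::real^'n) (1/2)" and ?U = "ball (0::real^'n) 1"
  have T: "transport_map \<rho>0 (indicator E) T" using opt by (simp add: optimal_transport_map_def)
  have \<rho>0_meas [measurable]: "\<rho>0 \<in> borel_measurable lebesgue" and T_meas [measurable]: "T \<in> borel_measurable lebesgue"
    and nonneg: "AE x in lebesgue. 0 \<le> \<rho>0 x"
    using \<rho>0 T by (auto simp: mass_density_def transport_map_def)
  note [measurable] = measurable_id_lebesgue_borel
  have Tt [measurable]: "interpolation_map T t \<in> borel_measurable lebesgue"
    unfolding interpolation_map_def[abs_def] by measurable
  have "0 < w" unfolding w_def using content_ball_pos[of 1 "0::real^'n"] by simp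
  define \<gamma> where "\<gamma> = density_deviation p 1 \<rho>0"
  have "0 \<le> \<gamma>" by (simp add: \<gamma>_def density_deviation_def)
  \<comment> \<open>A Bochner integral that differs from its default value 0 is the integral of an
    integrable function.\<close>
  have "integrable lebesgue \<rho>0"
    using mass \<open>0 < w\<close> not_integrable_integral_eq by fastforce
  then have total: "(\<integral>\<^sup>+x. ennreal (\<rho>0 x) \<partial>lebesgue) = ennreal w"
    using nonneg mass by (subst nn_integral_eq_integral) auto
  then have fin: "(\<integral>\<^sup>+x. ennreal (\<rho>0 x) \<partial>lebesgue) \<noteq> \<infinity>" by simp
  have cost: "(\<integral>\<^sup>+x. ennreal (\<rho>0 x) * ennreal ((norm (T x - x))\<^sup>2) \<partial>lebesgue) = ennreal (\<epsilon> * w)"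
    unfolding excess[symmetric]
  proof (rule nn_integral_cong_AE)
    show "AE x in lebesgue. ennreal (\<rho>0 x) * ennreal ((norm (T x - x))\<^sup>2) =
      ennreal ((norm (T x - x))\<^sup>2 * \<rho>0 x) * indicator ?U x"
      using supp nonneg
      by eventually_elim (auto simp: indicator_def ennreal_mult mult.commute)
  qed
  have tcost: "transport_cost \<rho>0 T \<noteq> \<infinity>"
  proof -
    have "transport_cost \<rho>0 T = ennreal (\<epsilon> * w)"
      unfolding transport_cost_def density_measure_def cost[symmetric]
      by (rule nn_integral_density) measurable
    then show ?thesis by simp
  qed
  have dev: "(\<integral>\<^sup>+x\<in>?U. ennreal \<bar>\<rho>0 x - 1\<bar> \<partial>lebesgue) \<le> ennreal (2 * w * \<gamma>)"
    unfolding w_def \<gamma>_def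
  proof (rule L1_le_density_deviation[OF \<rho>0_meas p])
    show "AE x in lebesgue. x \<in> ?U \<longrightarrow> \<bar>\<rho>0 x - 1\<bar> \<le> \<bar>C0\<bar> + 1"
      using bound nonneg by eventually_elim auto
  qed
  have excess_mass: "(\<integral>\<^sup>+x. ennreal (\<rho>0 x - 1) \<partial>lebesgue) \<le> ennreal (2 * w * \<gamma>)"
  proof (rule order_trans[OF nn_integral_mono_AE dev])
    show "AE x in lebesgue. ennreal (\<rho>0 x - 1) \<le> ennreal \<bar>\<rho>0 x - 1\<bar> * indicator ?U x"
      using supp by eventually_elim (auto simp: indicator_def ennreal_neg intro!: ennreal_leI)
  qed
  define \<nu> where "\<nu> = push_forward (interpolation_map T t) \<rho>0"
  have \<nu>: "emeasure \<nu> A = (\<integral>\<^sup>+x. ennreal (\<rho>0 x) * indicator A (interpolation_map T t x) \<partial>lebesgue)"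
    if "A \<in> sets borel" for A
    unfolding \<nu>_def by (rule push_forward_emeasure[OF \<rho>0_meas Tt that])
  have sets_\<nu>: "sets \<nu> = sets lborel" by (simp add: \<nu>_def push_forward_def)
  have upper: "emeasure \<nu> A \<le> emeasure lborel A + ennreal (2 * w * \<gamma>)" if A [measurable]: "A \<in> sets borel" for A
  proof -
    have m1: "(\<lambda>x. min 1 (ennreal (\<rho>0 x)) * indicator A (interpolation_map T t x)) \<in> borel_measurable lebesgue" by measurable
    have m2: "(\<lambda>x. ennreal (\<rho>0 x - 1)) \<in> borel_measurable lebesgue" by measurable
    have "emeasure \<nu> A \<le> (\<integral>\<^sup>+x. min 1 (ennreal (\<rho>0 x)) * indicator A (interpolation_map T t x) + ennreal (\<rho>0 x - 1) \<partial>lebesgue)"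
      unfolding \<nu>[OF A]
    proof (intro nn_integral_mono)
      fix x
      have "ennreal (\<rho>0 x) \<le> min 1 (ennreal (\<rho>0 x)) + ennreal (\<rho>0 x - 1)"
      proof (cases "\<rho>0 x \<le> 1")
        case True
        then have "min 1 (ennreal (\<rho>0 x)) = ennreal (\<rho>0 x)" by (simp add: min_absorb2 ennreal_leI flip: ennreal_1)
        then show ?thesis by simp
      next
        case False
        then have "min 1 (ennreal (\<rho>0 x)) = 1" by (simp add: min_absorb1 ennreal_leI flip: ennreal_1)
        moreover have "ennreal (\<rho>0 x) = ennreal 1 + ennreal (\<rho>0 x - 1)"
          using False by (subst ennreal_plus[symmetric]) auto
        ultimately show ?thesis by simp
      qed
      then show "ennreal (\<rho>0 x) * indicator A (interpolation_map T t x) \<le>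
        min 1 (ennreal (\<rho>0 x)) * indicator A (interpolation_map T t x) + ennreal (\<rho>0 x - 1)"
        by (simp add: indicator_def)
    qed
    also have "\<dots> = (\<integral>\<^sup>+x. min 1 (ennreal (\<rho>0 x)) * indicator A (interpolation_map T t x) \<partial>lebesgue) + (\<integral>\<^sup>+x. ennreal (\<rho>0 x - 1) \<partial>lebesgue)"
      by (rule nn_integral_add[OF m1 m2])
    also have "\<dots> \<le> emeasure lborel A + ennreal (2 * w * \<gamma>)"
      by (intro add_mono excess_mass displacement_interpolation_bound[OF \<rho>0 opt E fin tcost t _ _ _ A]) auto
    finally show ?thesis .
  qed
  define C where "C = max 1 C0"
  have "1 \<le> C" by (simp add: C_def)
  have ac: "absolutely_continuous lborel \<nu>"
    unfolding absolutely_continuous_def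
  proof
    fix A assume A: "A \<in> null_sets (lborel :: (real^'n) measure)"
    then have A' [measurable]: "A \<in> sets borel" by auto
    \<comment> \<open>\<open>a\<close> is bounded by 1 and vanishes only where
      \<open>\<rho>0\<close> has no mass. A null set receives no mass of \<open>a\<close>, hence
      none of \<open>\<rho>0\<close>, and \<open>RN_deriv\<close> is a genuine density.\<close>
    define a where "a x = min 1 (ennreal (1 / C) * ennreal (\<rho>0 x))" for x
    have [measurable]: "a \<in> borel_measurable lebesgue" unfolding a_def[abs_def] by measurable
    have "a x \<le> ennreal (\<rho>0 x)" for x
    proof -
      have "ennreal (1 / C) * ennreal (\<rho>0 x) \<le> 1 * ennreal (\<rho>0 x)"
        using \<open>1 \<le> C\<close> ennreal_leI[of "1 / C" 1] by (intro mult_right_mono) auto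
      then show ?thesis by (simp add: a_def min.coboundedI2)
    qed
    then have "(\<integral>\<^sup>+x. a x * indicator A (interpolation_map T t x) \<partial>lebesgue) \<le> emeasure lborel A"
      by (intro displacement_interpolation_bound[OF \<rho>0 opt E fin tcost t _ _ _ A']) (auto simp: a_def)
    also have "emeasure lborel A = 0" using A by auto
    finally have int0: "(\<integral>\<^sup>+x. a x * indicator A (interpolation_map T t x) \<partial>lebesgue) = 0" by simp
    have meas0: "(\<lambda>x. a x * indicator A (interpolation_map T t x)) \<in> borel_measurable lebesgue"
      "(\<lambda>x. ennreal (\<rho>0 x) * indicator A (interpolation_map T t x)) \<in> borel_measurable lebesgue"
      by measurable
    have 0: "AE x in lebesgue. a x * indicator A (interpolation_map T t x) = 0"
      using int0 by (simp only: nn_integral_0_iff_AE[OF meas0(1)])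
    have "AE x in lebesgue. ennreal (\<rho>0 x) * indicator A (interpolation_map T t x) = 0"
      using 0
    proof eventually_elim
      case (elim x)
      have "\<rho>0 x \<le> 0" if "a x = 0"
      proof (rule ccontr)
        assume "\<not> \<rho>0 x \<le> 0"
        then have "0 < ennreal (1 / C) * ennreal (\<rho>0 x)"
          using \<open>1 \<le> C\<close> by (simp add: ennreal_zero_less_mult_iff)
        then have "0 < a x" by (simp add: a_def)
        then show False using that by simp
      qed
      with elim show ?case by (auto simp: ennreal_neg)
    qed
    then have "emeasure \<nu> A = 0"
      unfolding \<nu>[OF A'] by (simp only: nn_integral_0_iff_AE[OF meas0(2)])
    then show "A \<in> null_sets \<nu>" by (intro null_setsI) (simp_all add: sets_\<nu>)
  qed
  define f where "f = RN_deriv lborel \<nu>"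
  have [measurable]: "f \<in> borel_measurable borel" unfolding f_def by measurable
  have dens: "density lborel f = \<nu>"
    unfolding f_def by (rule sigma_finite_measure.density_RN_deriv[OF sigma_finite_lborel ac sets_\<nu>])
  have \<nu>f: "emeasure \<nu> A = (\<integral>\<^sup>+x\<in>A. f x \<partial>lborel)" if "A \<in> sets borel" for A
    unfolding dens[symmetric] using that by (simp add: emeasure_density)
  define r where "r x = interpolation_density \<rho>0 T t x" for x
  have rf: "r x = enn2real (f x)" for x by (simp add: r_def interpolation_density_def f_def \<nu>_def)
  have [measurable]: "r \<in> borel_measurable borel" unfolding rf[abs_def] by measurable
  have "(\<integral>\<^sup>+x. f x \<partial>lborel) = ennreal w"
    using \<nu>f[of UNIV] \<nu>[of UNIV] total by simp
  then have "AE x in lborel. f x \<noteq> \<infinity>"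
    by (intro nn_integral_PInf_AE) auto
  then have "AE x in lborel. ennreal (r x) = f x"
    by eventually_elim (simp add: rf less_top)
  then have "(\<integral>\<^sup>+x\<in>A. ennreal (r x) \<partial>lborel) = (\<integral>\<^sup>+x\<in>A. f x \<partial>lborel)" for A
    by (intro nn_integral_cong_AE) (auto elim!: eventually_mono)
  then have r: "(\<integral>\<^sup>+x\<in>A. ennreal (r x) \<partial>lborel) = emeasure \<nu> A" if "A \<in> sets borel" for A
    using \<nu>f[OF that] by simp
  \<comment> \<open>With \<open>\<epsilon> \<le> h^3\<close> the Chebyshev error is of the same
    order as the volume of the shell.\<close>
  have "ennreal (\<epsilon> * w / h\<^sup>2) \<le> ennreal (w * h)"
  proof (rule ennreal_leI)
    have "\<epsilon> * w \<le> h ^ 3 * w" using \<epsilon> \<open>0 < w\<close> by (intro mult_right_mono) auto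
    then show "\<epsilon> * w / h\<^sup>2 \<le> w * h" using h by (simp add: divide_le_eq power2_eq_square power3_eq_cube mult_ac)
  qed
  then have "emeasure lborel ?B \<le> (emeasure \<nu> ?B + ennreal (w * h) + ennreal (2 * w * \<gamma>)) + ennreal (w * DIM(real^'n) * h)"
    unfolding \<nu>[of ?B, simplified]
    using emeasure_push_forward_ball_ge[OF \<rho>0_meas T_meas t h _ _ cost dev] \<epsilon>(1) \<open>0 < w\<close> \<open>0 \<le> \<gamma>\<close>
    by (intro order_trans[OF emeasure_small_ball_le[OF h, where 'a = "real^'n", folded w_def]] add_right_mono)
      (auto intro: order_trans add_mono)
  then have lower: "emeasure lborel ?B \<le> emeasure \<nu> ?B + (ennreal (w * h) + ennreal (2 * w * \<gamma>) + ennreal (w * DIM(real^'n) * h))"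
    by (simp add: add.assoc)
  have "(\<integral>\<^sup>+x\<in>?B. ennreal \<bar>r x - 1\<bar> \<partial>lborel) \<le>
    2 * ennreal (2 * w * \<gamma>) + (ennreal (w * h) + ennreal (2 * w * \<gamma>) + ennreal (w * DIM(real^'n) * h))"
  proof (rule L1_deviation_from_bounds)
    show "emeasure lborel ?B < \<infinity>" by (rule emeasure_lborel_ball_finite)
    have "emeasure \<nu> ?B \<le> emeasure \<nu> UNIV" using sets_\<nu> by (intro emeasure_mono) auto
    also have "\<dots> < \<infinity>" using \<nu>[of UNIV] total by simp
    finally show "(\<integral>\<^sup>+x\<in>?B. ennreal (r x) \<partial>lborel) < \<infinity>" by (simp add: r)
    show "(\<integral>\<^sup>+x\<in>A. ennreal (r x) \<partial>lborel) \<le> emeasure lborel A + ennreal (2 * w * \<gamma>)" if "A \<in> sets borel" for A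
      using upper[OF that] by (simp only: r[OF that])
    show "emeasure lborel ?B \<le> (\<integral>\<^sup>+x\<in>?B. ennreal (r x) \<partial>lborel) +
      (ennreal (w * h) + ennreal (2 * w * \<gamma>) + ennreal (w * DIM(real^'n) * h))"
      using lower by (simp only: r[OF borel_open[OF open_ball]])
    show "0 \<le> r x" for x by (simp add: rf)
  qed simp_all
  also have "\<dots> = ennreal (2 * (2 * w * \<gamma>) + (w * h + 2 * w * \<gamma> + w * DIM(real^'n) * h))"
  proof -
    have nn: "0 \<le> 2 * w * \<gamma>" "0 \<le> w * h" "0 \<le> w * DIM(real^'n) * h" using \<open>0 < w\<close> \<open>0 \<le> \<gamma>\<close> h by auto
    have "2 * ennreal (2 * w * \<gamma>) = ennreal (2 * (2 * w * \<gamma>))"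
      using nn ennreal_mult[of 2 "2 * w * \<gamma>"] by simp
    moreover have "ennreal a + (ennreal b + ennreal c + ennreal d) = ennreal (a + (b + c + d))"
      if "0 \<le> a" "0 \<le> b" "0 \<le> c" "0 \<le> d" for a b c d
      using that by simp
    ultimately show ?thesis using nn by (simp only: mult_nonneg_nonneg zero_le_numeral)
  qed
  \<comment> \<open>Four of the six multiples of \<open>w * \<gamma>\<close> come from the doubled
    positive part, two from comparing \<open>\<rho>0\<close> with 1 on the smaller ball. Shell and
    Chebyshev error make up the factor \<open>n + 1\<close>.\<close>
  also have "2 * (2 * w * \<gamma>) + (w * h + 2 * w * \<gamma> + w * DIM(real^'n) * h) = 6 * w * \<gamma> + w * (real CARD('n) + 1) * h"
    by (simp add: algebra_simps)
  finally show ?thesis by (simp add: r_def \<gamma>_def)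
qed

section \<open>Choice of the constants and integration in time\<close>

theorem lemma3p4:
  fixes p \<alpha> C0 :: real
  assumes "CARD('n::finite) \<ge> 2"
    and "p > real CARD('n)"
    and "0 < \<alpha>" and "\<alpha> < 1"
    and "C0 > 0"
  shows "\<exists>\<delta>>0. \<exists>C>0.
    \<forall>(\<rho>0 :: real ^ 'n \<Rightarrow> real) (\<rho>1 :: real ^ 'n \<Rightarrow> real) (E :: (real ^ 'n) set)
      (T :: real ^ 'n \<Rightarrow> real ^ 'n).
      mass_density \<rho>0 \<longrightarrow>
      (AE x in lebesgue. x \<notin> ball 0 1 \<longrightarrow> \<rho>0 x = 0) \<longrightarrow>
      (LINT x|lebesgue. \<rho>0 x) = measure lebesgue (ball (0 :: real ^ 'n) 1) \<longrightarrow>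
      (AE x in lebesgue. x \<in> ball 0 1 \<longrightarrow> inverse C0 \<le> \<rho>0 x \<and> \<rho>0 x \<le> C0) \<longrightarrow>
      E \<in> sets lebesgue \<longrightarrow>
      emeasure lebesgue E = emeasure lebesgue (ball (0 :: real ^ 'n) 1) \<longrightarrow>
      ball 0 (1 / 2) \<subseteq> E \<longrightarrow>
      \<rho>1 = indicator E \<longrightarrow>
      optimal_transport_map \<rho>0 \<rho>1 T \<longrightarrow>
      (let \<E> = excess_energy \<rho>0 T 1;
           \<gamma> = density_deviation p 1 \<rho>0 + density_deviation p 1 \<rho>1
       in \<E> + ennreal (\<gamma>\<^sup>2) \<le> ennreal \<delta> \<longrightarrow>
          (\<integral>\<^sup>+t\<in>{0..1}.
             (\<integral>\<^sup>+x\<in>ball 0 (1 / 2). ennreal \<bar>interpolation_density \<rho>0 T t x - 1\<bar> \<partial>lborel)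
           \<partial>lborel)
          \<le> ennreal (C * (enn2real \<E> powr (1 / (real CARD('n) + 2)) + sqrt \<gamma>)))"
proof -
  let ?n = "CARD('n)"
  define w where "w = measure lebesgue (ball (0 :: real ^ 'n) 1)"
  have "0 < w" unfolding w_def using content_ball_pos[of 1 "0::real^'n"] by simp
  \<comment> \<open>Chosen so that \<open>\<delta>\<close> to the power \<open>1 / (n + 2)\<close>
    is 1/4, which keeps the shrinking width below 1/2.\<close>
  define \<delta> :: real where "\<delta> = (1/4) ^ (?n + 2)"
  \<comment> \<open>Large enough for both coefficients, \<open>6 w\<close> for the deviation and
    \<open>w (n + 1)\<close> for \<open>h\<close>.\<close>
  define C where "C = w * (real ?n + 6)"
  have "0 < \<delta>" by (simp add: \<delta>_def)
  have "\<delta> \<le> 1" unfolding \<delta>_def by (rule power_le_one) auto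
  have "0 < C" using \<open>0 < w\<close> by (simp add: C_def)
  show ?thesis
  proof (rule exI[of _ \<delta>], rule conjI[OF \<open>0 < \<delta>\<close>], rule exI[of _ C], rule conjI[OF \<open>0 < C\<close>],
      intro allI impI, unfold Let_def, rule impI)
    fix \<rho>0 \<rho>1 :: "real^'n \<Rightarrow> real" and E T
    assume \<rho>0: "mass_density \<rho>0" and supp: "AE x in lebesgue. x \<notin> ball 0 1 \<longrightarrow> \<rho>0 x = 0"
      and mass: "(LINT x|lebesgue. \<rho>0 x) = measure lebesgue (ball (0 :: real ^ 'n) 1)"
      and bound: "AE x in lebesgue. x \<in> ball 0 1 \<longrightarrow> inverse C0 \<le> \<rho>0 x \<and> \<rho>0 x \<le> C0"
      and E: "E \<in> sets lebesgue" and \<rho>1: "\<rho>1 = indicator E" and opt: "optimal_transport_map \<rho>0 \<rho>1 T"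
      and small: "excess_energy \<rho>0 T 1 + ennreal ((density_deviation p 1 \<rho>0 + density_deviation p 1 \<rho>1)\<^sup>2) \<le> ennreal \<delta>"
    define \<gamma> where "\<gamma> = density_deviation p 1 \<rho>0 + density_deviation p 1 \<rho>1"
    define \<epsilon> where "\<epsilon> = enn2real (excess_energy \<rho>0 T 1)"
    have dev_nonneg: "0 \<le> density_deviation p 1 \<rho>" for \<rho> :: "real^'n \<Rightarrow> real"
      by (simp add: density_deviation_def)
    have "0 \<le> \<gamma>" using dev_nonneg by (simp add: \<gamma>_def)
    have le: "excess_energy \<rho>0 T 1 \<le> ennreal \<delta>"
      by (rule order_trans[OF _ small]) simp
    have "ennreal (\<gamma>\<^sup>2) \<le> ennreal \<delta>"
      unfolding \<gamma>_def by (rule order_trans[OF _ small]) simp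
    then have "\<gamma>\<^sup>2 \<le> \<delta>" using \<open>0 < \<delta>\<close> by (simp add: ennreal_le_iff)
    have energy: "excess_energy \<rho>0 T 1 = ennreal \<epsilon>"
      unfolding \<epsilon>_def by (rule ennreal_enn2real[symmetric]) (rule le_less_trans[OF le ennreal_less_top])
    have \<epsilon>: "0 \<le> \<epsilon>" "\<epsilon> \<le> \<delta>"
      using le \<open>0 < \<delta>\<close> by (simp_all add: \<epsilon>_def enn2real_leI)
    \<comment> \<open>The estimate at fixed time is linear in the deviation; for values up to 1 this
      is dominated by the square root.\<close>
    have "\<gamma> \<le> 1" using \<open>\<gamma>\<^sup>2 \<le> \<delta>\<close> \<open>\<delta> \<le> 1\<close> \<open>0 \<le> \<gamma>\<close> by (intro power2_le_imp_le[of \<gamma> 1]) auto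
    then have \<gamma>_sqrt: "\<gamma> \<le> sqrt \<gamma>"
      using \<open>0 \<le> \<gamma>\<close> by (intro real_le_rsqrt) (simp add: power2_eq_square mult_left_le)
    have excess: "(\<integral>\<^sup>+x\<in>ball 0 1. ennreal ((norm (T x - x))\<^sup>2 * \<rho>0 x) \<partial>lebesgue) = ennreal (\<epsilon> * w)" (is "?I = _")
    proof -
      have quot: "?I / ennreal w = ennreal \<epsilon>" using energy by (simp add: excess_energy_def w_def)
      have scaled: "ennreal w * (x / ennreal w) = x" for x
        using \<open>0 < w\<close> by (simp add: ennreal_times_divide ennreal_mult_divide_eq mult.commute)
      from scaled[of ?I] have "?I = ennreal w * ennreal \<epsilon>" unfolding quot by (rule sym)
      also have "\<dots> = ennreal (\<epsilon> * w)"
        using \<open>0 < w\<close> \<epsilon>(1) by (simp add: ennreal_mult mult.commute)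
      finally show ?thesis .
    qed
    define h0 where "h0 = \<epsilon> powr (1 / (real ?n + 2))"
    have "h0 \<le> \<delta> powr (1 / (real ?n + 2))"
      unfolding h0_def using \<epsilon> by (intro powr_mono2) auto
    also have "\<delta> powr (1 / (real ?n + 2)) = 1/4"
    proof -
      have "\<delta> = (1/4) powr real (?n + 2)"
        unfolding \<delta>_def by (rule powr_realpow[symmetric]) simp
      then have "\<delta> powr (1 / (real ?n + 2)) = (1/4) powr (real (?n + 2) * (1 / (real ?n + 2)))"
        by (simp only: powr_powr)
      also have "real (?n + 2) * (1 / (real ?n + 2)) = 1" by simp
      finally show ?thesis by simp
    qed
    finally have "h0 \<le> 1/4" .
    have "0 \<le> h0" by (simp add: h0_def)
    let ?inner = "\<lambda>t. \<integral>\<^sup>+x\<in>ball 0 (1 / 2). ennreal \<bar>interpolation_density \<rho>0 T t x - 1\<bar> \<partial>lborel"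
    \<comment> \<open>\<open>h\<close> stays strictly above \<open>h0\<close>, because
      \<open>h0 = 0\<close> when the excess energy vanishes while the Chebyshev estimate divides by
      \<open>h\<close>. The passage to \<open>h0\<close> follows by density.\<close>
    have with_h: "?inner t \<le> ennreal (6 * w * density_deviation p 1 \<rho>0 + w * (real ?n + 1) * h)"
      if t: "0 < t" "t < 1" and h: "h0 < h" "h < 1/2" for t h
    proof -
      have "0 < h" using h \<open>0 \<le> h0\<close> by simp
      have "\<epsilon> = h0 ^ (?n + 2)"
      proof (cases "\<epsilon> = 0")
        case False
        have "h0 powr real (?n + 2) = \<epsilon> powr (1 / (real ?n + 2) * real (?n + 2))"
          unfolding h0_def by (rule powr_powr)
        also have "1 / (real ?n + 2) * real (?n + 2) = 1" by simp
        also have "\<epsilon> powr 1 = \<epsilon>" using \<epsilon> by simp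
        finally have "h0 powr real (?n + 2) = \<epsilon>" .
        moreover have "0 < h0" using False \<epsilon> by (simp add: h0_def)
        ultimately show ?thesis using powr_realpow[of h0 "?n + 2"] by simp
      qed (simp add: h0_def)
      also have "\<dots> \<le> h ^ (?n + 2)" using h \<open>0 \<le> h0\<close> by (intro power_mono) auto
      \<comment> \<open>For \<open>h < 1\<close> a larger exponent gives a smaller power, and
        \<open>n + 2\<close> is at least 3.\<close>
      also have "\<dots> \<le> h ^ 3"
        using h \<open>0 < h\<close> assms(1) by (intro power_decreasing) auto
      finally have "\<epsilon> \<le> h ^ 3" .
      show ?thesis
        unfolding w_def
      proof (rule interpolation_density_deviation[OF \<rho>0 supp mass _ E opt[unfolded \<rho>1]])
        show "AE x in lebesgue. x \<in> ball 0 1 \<longrightarrow> \<rho>0 x \<le> C0"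
          using bound by eventually_elim auto
        show "1 \<le> p" using assms(1,2) by simp
      qed (use t h \<open>0 < h\<close> \<epsilon>(1) \<open>\<epsilon> \<le> h ^ 3\<close> excess in \<open>auto simp: w_def\<close>)
    qed
    have inner: "?inner t \<le> ennreal (C * (h0 + sqrt \<gamma>))" if t: "0 < t" "t < 1" for t
    proof -
      \<comment> \<open>Any width between 1/4 and 1/2 serves here; only finiteness is
        extracted.\<close>
      have fin: "?inner t < \<infinity>"
        by (rule le_less_trans[OF with_h[OF t, of "3/8"]]) (use \<open>h0 \<le> 1/4\<close> in auto)
      then obtain v where v: "?inner t = ennreal v" "0 \<le> v" by (cases "?inner t") auto
      have pos: "0 < w * (real ?n + 1)" using \<open>0 < w\<close> by simp
      let ?d = "density_deviation p 1 \<rho>0"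
      have "(v - 6 * w * ?d) / (w * (real ?n + 1)) \<le> h0"
      proof (rule dense_ge_bounded[of h0 "1/2"])
        fix h assume h: "h0 < h" "h < 1/2"
        have "ennreal v \<le> ennreal (6 * w * ?d + w * (real ?n + 1) * h)"
          using with_h[OF t h] v by simp
        then have "v \<le> 6 * w * ?d + w * (real ?n + 1) * h"
          using h \<open>0 \<le> h0\<close> \<open>0 < w\<close> dev_nonneg by (subst (asm) ennreal_le_iff) auto
        then show "(v - 6 * w * ?d) / (w * (real ?n + 1)) \<le> h"
          using pos by (simp only: pos_divide_le_eq) (simp add: mult.commute)
      qed (use \<open>h0 \<le> 1/4\<close> in auto)
      then have "v \<le> 6 * w * ?d + w * (real ?n + 1) * h0"
        using pos by (simp only: pos_divide_le_eq) (simp add: mult.commute)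
      also have "\<dots> \<le> C * sqrt \<gamma> + C * h0"
      proof (intro add_mono mult_right_mono)
        have "?d \<le> sqrt \<gamma>" using \<gamma>_sqrt dev_nonneg[of \<rho>1] by (simp add: \<gamma>_def)
        then show "6 * w * ?d \<le> C * sqrt \<gamma>"
          using \<open>0 < w\<close> dev_nonneg by (intro mult_mono) (auto simp: C_def)
        show "w * (real ?n + 1) \<le> C" using \<open>0 < w\<close> by (simp add: C_def)
      qed (rule \<open>0 \<le> h0\<close>)
      finally show ?thesis unfolding v(1) by (intro ennreal_leI) (simp add: algebra_simps)
    qed
    \<comment> \<open>The estimate is available for \<open>0 < t < 1\<close>; the two endpoints are
      a null set of times.\<close>
    have "AE t in lborel. t \<notin> {0, 1::real}"
      by (rule AE_not_in) (simp add: finite_imp_null_set_lborel)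
    then have "(\<integral>\<^sup>+t\<in>{0..1}. ?inner t \<partial>lborel) \<le> (\<integral>\<^sup>+t. ennreal (C * (h0 + sqrt \<gamma>)) * indicator {0..1::real} t \<partial>lborel)"
    proof (intro nn_integral_mono_AE, eventually_elim)
      case (elim t)
      show ?case
      proof (cases "t \<in> {0..1}")
        case True
        then have "?inner t \<le> ennreal (C * (h0 + sqrt \<gamma>))"
          using elim by (intro inner) auto
        then show ?thesis using True by (simp only: indicator_simps mult_1_right)
      qed simp
    qed
    also have "\<dots> = ennreal (C * (h0 + sqrt \<gamma>))"
      by (subst nn_integral_cmult_indicator) auto
    finally show "(\<integral>\<^sup>+t\<in>{0..1}. ?inner t \<partial>lborel) \<le>
      ennreal (C * (enn2real (excess_energy \<rho>0 T 1) powr (1 / (real ?n + 2)) +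
        sqrt (density_deviation p 1 \<rho>0 + density_deviation p 1 \<rho>1)))"
      by (simp only: h0_def \<epsilon>_def \<gamma>_def)
  qed
qed

end
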